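(* Let $L$ be a slowly varying function at $\infty$ and let $\mu$ be a probability measure on $\mathbb{Z}_{\ge 0}$ with mean $\sum_{i\ge 0} i\mu(i)=1$ and $\mu(n)\sim L(n)/n^2$ as $n\to\infty$. For $n$ large, let $\mathcal{T}_n$ be a $\mathrm{BGW}_\mu$ tree conditioned on having exactly $n$ vertices, and let $(\Delta_n^{(i)}:i\ge0)$ be the degrees of $\mathcal{T}_n$ ordered in decreasing order. Then $$\left(\frac{\Delta_n^{(0)}}{|b_n|},\frac{\Delta_n^{(1)}}{a_n},\frac{\Delta_n^{(2)}}{a_n},\ldots\right)\ \longrightarrow\ (1,\Delta^{(1)},\Delta^{(2)},\ldots)$$ in distribution for finite-dimensional marginals as $n\to\infty$, where $(\Delta^{(i)}:i\ge1)$ is the decreasing rearrangement of the second coordinates of the atoms of a Poisson measure on $[0,1]\times\mathbb{R}_+$ with intensity $\mathrm{d}t\otimes\frac{\mathrm{d}x}{x^2}$.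
   Context: A plane tree $\tau$ is a rooted ordered tree; $k_v(\tau)$ denotes the number of children of the vertex $v$. A $\mathrm{BGW}_\mu$ tree is a random plane tree with law $\mathrm{BGW}_\mu(\tau)=\prod_{u\in\tau}\mu(k_u(\tau))$ for every finite plane tree $\tau$. Scaling constants: let $X$ have law $\mathbb{P}(X=i)=\mu(i+1)$, $i\ge -1$. $(a_n)_{n\ge1}$ and $(b_n)_{n\ge1}$ are sequences such that $n\,\mathbb{P}(X\ge a_n)\to 1$ and $b_n=n\,\mathbb{E}[X\mathbf{1}_{|X|\le a_n}]$ (one has $b_n\to-\infty$). *)

theory Defs
  imports "HOL-Probability.Probability" "HOL-Library.Landau_Symbols"
begin

text \<open>
  A function that is slowly varying at infinity need only be defined, positive and measurable on
  some half-line.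
\<close>

definition slowly_varying :: "(real \<Rightarrow> real) \<Rightarrow> bool" where
  "slowly_varying L \<longleftrightarrow>
     (\<exists>A. L \<in> borel_measurable (restrict_space borel {A..}) \<and> (\<forall>x\<ge>A. 0 < L x)) \<and>
     (\<forall>c>0. ((\<lambda>x. L (c * x) / L x) \<longlongrightarrow> 1) at_top)"


datatype plane_tree = Node "plane_tree list"

text \<open>
  The list of the numbers of children \<open>k_v(\<tau>)\<close>, with one entry for each vertex \<open>v\<close> of \<open>\<tau>\<close>, in
  depth-first order.
\<close>

fun outdegrees :: "plane_tree \<Rightarrow> nat list" where
  "outdegrees (Node ts) = length ts # concat (map outdegrees ts)"

definition num_vertices :: "plane_tree \<Rightarrow> nat" where
  "num_vertices \<tau> = length (outdegrees \<tau>)"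

text \<open>
  Degrees are numbers of children and are indexed from \<open>0\<close>; the value \<open>0\<close> beyond the number of
  vertices is a dummy.
\<close>

definition ordered_degree :: "plane_tree \<Rightarrow> nat \<Rightarrow> nat" where
  "ordered_degree \<tau> i =
     (if i < num_vertices \<tau> then rev (sort (outdegrees \<tau>)) ! i else 0)"

text \<open>
  The type \<open>plane_tree\<close> contains finite trees only, so for a general offspring law this is the
  restriction of the law of the tree to finite trees; it has mass 1 in the critical case
  (for \<open>\<mu> \<noteq> \<delta>\<^sub>1\<close>).
\<close>

definition BGW :: "nat pmf \<Rightarrow> plane_tree measure" where
  "BGW \<mu> = density (count_space UNIV) (\<lambda>\<tau>. ennreal (prod_list (map (pmf \<mu>) (outdegrees \<tau>))))"

text \<open>
  Note that \<open>uniform_measure M A\<close> is the conditional law \<open>M(\<cdot> \<inter> A) / M(A)\<close>.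
\<close>

definition conditioned_BGW :: "nat pmf \<Rightarrow> nat \<Rightarrow> plane_tree measure" where
  "conditioned_BGW \<mu> n = uniform_measure (BGW \<mu>) {\<tau>. num_vertices \<tau> = n}"

definition step_law :: "nat pmf \<Rightarrow> int pmf" where
  "step_law \<mu> = map_pmf (\<lambda>k. int k - 1) \<mu>"


text \<open>
  \<open>N\<close> is a Poisson random measure with intensity \<open>\<nu>\<close> on the probability space \<open>P\<close>. A Poisson
  variable with infinite parameter is almost surely infinite.
\<close>

definition poisson_random_measure ::
    "'p measure \<Rightarrow> 'a measure \<Rightarrow> ('p \<Rightarrow> 'a measure) \<Rightarrow> bool" where
  "poisson_random_measure P \<nu> N \<longleftrightarrow>
     prob_space P \<and>
     (\<forall>\<omega>\<in>space P. sets (N \<omega>) = sets \<nu> \<and>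
        (\<forall>A\<in>sets \<nu>. emeasure (N \<omega>) A \<in> insert \<infinity> (range of_nat))) \<and>
     (\<forall>A\<in>sets \<nu>. (\<lambda>\<omega>. emeasure (N \<omega>) A) \<in> borel_measurable P) \<and>
     (\<forall>A\<in>sets \<nu>. emeasure \<nu> A < \<infinity> \<longrightarrow>
        (\<forall>k. measure P {\<omega>\<in>space P. emeasure (N \<omega>) A = of_nat k} =
             exp (- measure \<nu> A) * measure \<nu> A ^ k / fact k)) \<and>
     (\<forall>A\<in>sets \<nu>. emeasure \<nu> A = \<infinity> \<longrightarrow> (AE \<omega> in P. emeasure (N \<omega>) A = \<infinity>)) \<and>
     (\<forall>A :: nat \<Rightarrow> 'a set. range A \<subseteq> sets \<nu> \<longrightarrow> disjoint_family A \<longrightarrow>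
        prob_space.indep_vars P (\<lambda>_. borel) (\<lambda>i \<omega>. emeasure (N \<omega>) (A i)) UNIV)"

text \<open>
  The measure \<open>dt \<otimes> dx/x\<^sup>2\<close> on \<open>[0,1] \<times> (0,\<infinity>)\<close>, regarded as a measure on the plane.
\<close>

definition limit_intensity :: "(real \<times> real) measure" where
  "limit_intensity =
     density lborel (\<lambda>(t, x). indicator ({0..1} \<times> {0<..}) (t, x) * ennreal (1 / x\<^sup>2))"

text \<open>
  \<open>m\<close> is the sum of the Dirac masses at \<open>p 1, p 2, \<dots>\<close> (the image under \<open>p\<close> of the counting
  measure on the positive integers), the atoms being listed with multiplicity and so that
  their second coordinates \<open>d 1 \<ge> d 2 \<ge> \<dots>\<close> are in decreasing order.
\<close>

definition decreasing_rearrangement :: "(real \<times> real) measure \<Rightarrow> (nat \<Rightarrow> real) \<Rightarrow> bool" where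
  "decreasing_rearrangement m d \<longleftrightarrow>
     (\<exists>p :: nat \<Rightarrow> real \<times> real.
        m = distr (count_space {1..}) borel p \<and>
        (\<forall>i\<ge>1. d i = snd (p i)) \<and>
        (\<forall>i j. 1 \<le> i \<longrightarrow> i \<le> j \<longrightarrow> d j \<le> d i))"


text \<open>
  Convergence in distribution of the finite-dimensional marginals, as \<open>n \<rightarrow> \<infinity>\<close>, of the sequences
  \<open>(X n i)\<^sub>i\<close> of random variables on \<open>M n\<close> to the sequence \<open>(Y i)\<^sub>i\<close> of random variables on \<open>P\<close>:
  for every finite set \<open>J\<close> of indices, weak convergence in \<open>\<real>\<^sup>J\<close>.
\<close>

definition fdd_convergence ::
    "(nat \<Rightarrow> 'a measure) \<Rightarrow> (nat \<Rightarrow> nat \<Rightarrow> 'a \<Rightarrow> real) \<Rightarrow>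
     'b measure \<Rightarrow> (nat \<Rightarrow> 'b \<Rightarrow> real) \<Rightarrow> bool" where
  "fdd_convergence M X P Y \<longleftrightarrow>
     (\<forall>J f. finite J \<longrightarrow>
        continuous_map (powertop_real J) euclideanreal f \<longrightarrow>
        bounded (f ` (J \<rightarrow>\<^sub>E UNIV)) \<longrightarrow>
        (\<lambda>n. \<integral>\<omega>. f (\<lambda>i\<in>J. X n i \<omega>) \<partial>M n) \<longlonglongrightarrow> (\<integral>\<omega>. f (\<lambda>i\<in>J. Y i \<omega>) \<partial>P))"

end

theory Submission
  imports Defs "HOL-Combinatorics.Multiset_Permutations"
begin

text \<open>
  By the cycle lemma, the degrees of the conditioned tree have (up to the order) the law of \<open>n\<close>
  independent variables \<open>D\<^sub>i\<close> with law \<open>\<mu>\<close>, conditioned on \<open>\<Sum> D\<^sub>i = n - 1\<close>. Let \<open>B = \<bar>b\<^sub>n\<bar>\<close>, which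
  is eventually \<open>n E[(D - 1) 1\<^bsub>D > a\<^sub>n + 1\<^esub>]\<close> and satisfies \<open>B / a\<^sub>n \<rightarrow> \<infinity>\<close>. The sum of \<open>n - 1\<close> centred
  variables is concentrated around \<open>- B\<close>, so that the cheapest way to realise the conditioning is one
  jump of size about \<open>B\<close>, of probability about \<open>n \<mu>(B)\<close>; as \<open>\<mu>\<close> is regularly varying, the cost does
  not depend on the precise size of the jump. For the upper bound, the words whose letters are all at
  most \<open>\<epsilon> B\<close> contribute \<open>O(\<epsilon> n \<mu>(B))\<close>: a largest letter in \<open>(y/2, y]\<close> costs \<open>n \<mu>(y) = O((B/y)\<^sup>3 n \<mu>(B))\<close>,
  and the others have to satisfy a large deviation event of probability \<open>exp(1 - B/(8 y))\<close>. Hence the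
  remaining degrees asymptotically behave like independent ones, whose counts in
  intervals of length of order \<open>a\<^sub>n\<close> converge to independent Poisson variables.
\<close>


section \<open>Slowly varying functions\<close>

text \<open>The law sits on the border of integrability: its tail is of order
  \<open>L x / x\<close>, so the mean converges only thanks to \<open>L\<close>. Fluctuations of the
  sum are of order \<open>a n\<close>, where \<open>n * L (a n) / a n\<close> tends to 1, whereas
  cutting off the letters above \<open>a n\<close> creates a drift which is larger by the factor
  \<open>excess y / L y\<close> at \<open>y = a n + 1\<close>. This factor diverges, because the
  letters between y and M y alone contribute a multiple of \<open>L y * ln M\<close> for every M;
  this is why B is of larger order than \<open>a n\<close>. B is defined through the truncation at
  \<open>a n\<close>, but the exponential bounds have to admit letters up to B. Moving the
  truncation level from \<open>a n + 1\<close> to B changes the drift only by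
  \<open>O (sqrt (a n / B n))\<close> relatively to B, which reconciles the two levels. As L is
  known only to vary slowly, all estimates are drawn from two sources: uniform convergence of
  \<open>L y / L x\<close> on windows of bounded ratio, and a power bound with exponent 1/2 beyond
  them. The exponent 1/2 keeps the sums of \<open>L k / k^2\<close> under control at infinity and
  makes truncated moments comparable with their last terms.\<close>

lemma uniform_convergence_additive:
  fixes h :: "real \<Rightarrow> real"
  assumes [measurable]: "h \<in> borel_measurable borel"
    and h: "\<And>u. ((\<lambda>x. h (x + u) - h x) \<longlongrightarrow> 0) at_top"
    and "e > 0" "A > 0"
  shows "\<forall>\<^sub>F x in at_top. \<forall>u\<in>{0..A}. \<bar>h (x + u) - h x\<bar> < e"
proof (rule ccontr)
  assume "\<not> ?thesis"
  then have "\<exists>x\<ge>real n. \<exists>u\<in>{0..A}. \<not> \<bar>h (x + u) - h x\<bar> < e" for n :: nat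
    unfolding eventually_at_top_linorder by meson
  then obtain x u where xu: "\<And>n. x n \<ge> real n" "\<And>n. u n \<in> {0..A}"
      "\<And>n. \<not> \<bar>h (x n + u n) - h (x n)\<bar> < e"
    by metis
  \<comment> \<open>These are the offsets that are good from index \<open>n\<close> on; they
    increase with \<open>n\<close> to all of \<open>{0..2 * A}\<close>, so their measure tends to
    \<open>2 * A\<close>. Used both for \<open>x\<close> and for \<open>x n + u n\<close>, they
    yield one common point to which \<open>h\<close> at both arguments is close.\<close>
  define V where "V y n = {l \<in> {0..2*A}. \<forall>m\<ge>n. \<bar>h (y m + l) - h (y m)\<bar> < e / 2}"
    for y :: "nat \<Rightarrow> real" and n :: nat
  have V_meas [measurable]: "V y n \<in> sets borel" for y n
    unfolding V_def by measurable
  have V_lim: "(\<lambda>n. measure lborel (V y n)) \<longlonglongrightarrow> 2 * A" if y: "\<And>n. y n \<ge> real n" for y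
  proof -
    have y_top: "filterlim y at_top sequentially"
      using y by (intro filterlim_at_top_mono[OF filterlim_real_sequentially]) auto
    have "(\<Union>n. V y n) = {0..2*A}"
    proof (intro equalityI subsetI)
      fix l assume l: "l \<in> {0..2*A}"
      have "((\<lambda>n. h (y n + l) - h (y n)) \<longlongrightarrow> 0) sequentially"
        by (rule filterlim_compose[OF h y_top])
      then have "\<forall>\<^sub>F n in sequentially. \<bar>h (y n + l) - h (y n)\<bar> < e / 2"
        using \<open>e > 0\<close> by (auto simp: tendsto_iff dist_real_def dest: spec[of _ "e/2"])
      then show "l \<in> (\<Union>n. V y n)"
        using l unfolding V_def eventually_sequentially by auto
    qed (auto simp: V_def)
    moreover have "incseq (V y)"
      unfolding V_def by (auto simp: incseq_def)
    moreover have "(\<lambda>n. measure lborel (V y n)) \<longlonglongrightarrow> measure lborel (\<Union>n. V y n)"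
    proof (rule Lim_measure_incseq)
      show "emeasure lborel (\<Union>n. V y n) \<noteq> \<infinity>"
        unfolding \<open>(\<Union>n. V y n) = {0..2*A}\<close> by (simp add: emeasure_lborel_Icc_eq)
    qed (use \<open>incseq (V y)\<close> in auto)
    ultimately show ?thesis using \<open>A > 0\<close> by simp
  qed
  define y where "y n = x n + u n" for n
  have y: "y n \<ge> real n" for n using xu(1,2)[of n] by (auto simp: y_def)
  have "\<forall>\<^sub>F n in sequentially. measure lborel (V x n) > 3/2 * A"
    using order_tendstoD(1)[OF V_lim[OF xu(1)], of "3/2*A"] \<open>A > 0\<close> by simp
  moreover have "\<forall>\<^sub>F n in sequentially. measure lborel (V y n) > 3/2 * A"
    using order_tendstoD(1)[OF V_lim[OF y], of "3/2*A"] \<open>A > 0\<close> by simp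
  ultimately have "\<forall>\<^sub>F n in sequentially. measure lborel (V x n) > 3/2 * A \<and> measure lborel (V y n) > 3/2 * A"
    by (rule eventually_conj)
  then obtain n where n: "measure lborel (V x n) > 3/2 * A" "measure lborel (V y n) > 3/2 * A"
    unfolding eventually_sequentially by auto
  \<comment> \<open>Translation by \<open>u n\<close> turns offsets from \<open>y n\<close> into
    offsets from \<open>x n\<close>; as \<open>u n\<close> is at most \<open>A\<close>, the
    translate stays in \<open>{0..3 * A}\<close>.\<close>
  define W where "W = (\<lambda>l. l + u n) ` V y n"
  have W_eq: "W = (\<lambda>l. l - u n) -` V y n"
    unfolding W_def by (auto simp: image_iff) (metis add.commute add_diff_cancel_left' diff_add_cancel)
  have [measurable]: "W \<in> sets borel"
    unfolding W_eq using measurable_sets_borel[of "\<lambda>l. l - u n" borel "V y n"] by simp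
  have "emeasure lborel W = emeasure lborel (V y n)"
  proof -
    have "emeasure lborel (V y n) = emeasure (distr lborel borel (\<lambda>l. - u n + l)) (V y n)"
      by (metis lborel_distr_plus)
    also have "\<dots> = emeasure lborel W"
      unfolding W_eq by (subst emeasure_distr) (auto intro!: arg_cong[of _ _ "emeasure lborel"])
    finally show ?thesis by simp
  qed
  then have W_m: "measure lborel W > 3/2 * A" using n(2) by (simp add: measure_def)
  have sub: "V x n \<subseteq> {0..3*A}" "W \<subseteq> {0..3*A}"
    using xu(2)[of n] \<open>A > 0\<close> by (auto simp: V_def W_def)
  have A_fm: "{0..3*A} \<in> fmeasurable lborel"
    by (rule fmeasurableI) (simp_all add: emeasure_lborel_Icc_eq)
  then have fm: "V x n \<in> fmeasurable lborel" "W \<in> fmeasurable lborel"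
    using sub by (auto intro: fmeasurableI2)
  have "V x n \<inter> W \<noteq> {}" \<comment> \<open>both have more than half the measure of \<open>{0..3 * A}\<close>\<close>
  proof
    assume *: "V x n \<inter> W = {}"
    have "measure lborel (V x n \<union> W) = measure lborel (V x n) + measure lborel W"
      by (rule measure_Un3[OF fm, unfolded *, simplified])
    moreover have "measure lborel (V x n \<union> W) \<le> measure lborel {0..3*A}"
      using sub A_fm by (intro measure_mono_fmeasurable) auto
    ultimately show False using n(1) W_m \<open>A > 0\<close> by simp
  qed
  then obtain l where l: "l \<in> V x n" "l - u n \<in> V y n" unfolding W_eq by auto
  have "\<bar>h (x n + l) - h (x n)\<bar> < e / 2" using l(1) by (auto simp: V_def)
  moreover have "\<bar>h (x n + l) - h (x n + u n)\<bar> < e / 2"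
    using l(2) by (auto simp: V_def y_def dest!: spec[of _ n])
  ultimately show False using xu(3)[of n] by linarith
qed

lemma slowly_varying_pos:
  assumes "slowly_varying L"
  shows "\<forall>\<^sub>F x in at_top. L x > 0"
  using assms unfolding slowly_varying_def eventually_at_top_linorder by auto

text \<open>In logarithmic coordinates \<open>h x = ln (L (exp x))\<close> the multiplicative
  condition becomes the additive one, to which the measure-theoretic argument applies.\<close>

lemma slowly_varying_uniform:
  assumes sv: "slowly_varying L" and "M > 1" "e > 0"
  shows "\<forall>\<^sub>F x in at_top. \<forall>u\<in>{1..M}. \<bar>L (u * x) / L x - 1\<bar> < e"
proof -
  obtain A where A: "L \<in> borel_measurable (restrict_space borel {A..})" "\<And>x. x \<ge> A \<Longrightarrow> 0 < L x"
    using sv unfolding slowly_varying_def by auto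
  \<comment> \<open>\<open>L\<close> is positive and measurable only on \<open>{A..}\<close>; the
    value 1 elsewhere makes the logarithm meaningful and measurable everywhere.\<close>
  define K where "K x = (if x \<in> {A..} then L x else 1)" for x
  have [measurable]: "K \<in> borel_measurable borel"
    unfolding K_def using A(1) measurable_restrict_space_iff[of "{A..}" borel 1 borel L] by simp
  have K_pos: "K x > 0" for x using A(2) by (auto simp: K_def)
  define h where "h x = ln (K (exp x))" for x
  have [measurable]: "h \<in> borel_measurable borel" unfolding h_def by measurable
  have h: "((\<lambda>x. h (x + u) - h x) \<longlongrightarrow> 0) at_top" for u
  proof -
    have "((\<lambda>x. L (exp u * x) / L x) \<longlongrightarrow> 1) at_top"
      using sv unfolding slowly_varying_def by auto
    then have "((\<lambda>x. L (exp u * exp x) / L (exp x)) \<longlongrightarrow> 1) at_top"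
      by (rule filterlim_compose[OF _ exp_at_top])
    then have "((\<lambda>x. ln (L (exp u * exp x) / L (exp x))) \<longlongrightarrow> ln 1) at_top"
      by (intro tendsto_ln) auto
    moreover have "\<forall>\<^sub>F x in at_top. ln (L (exp u * exp x) / L (exp x)) = h (x + u) - h x"
    proof -
      have "\<forall>\<^sub>F x in at_top. exp x \<ge> A"
        using exp_at_top filterlim_at_top by blast
      moreover have "\<forall>\<^sub>F x in at_top. exp (x + u) \<ge> A"
        using calculation unfolding eventually_at_top_linorder by (metis diff_le_eq)
      ultimately show ?thesis
      proof eventually_elim
        case (elim x)
        have "h (x + u) - h x = ln (K (exp (x + u)) / K (exp x))"
          unfolding h_def using K_pos[of "exp (x + u)"] K_pos[of "exp x"] by (simp add: ln_div)
        then show ?case using elim by (simp add: K_def exp_add mult.commute)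
      qed
    qed
    ultimately show ?thesis by (simp add: filterlim_cong)
  qed
  \<comment> \<open>A positive ratio whose logarithm is below this bound in absolute value differs
    from 1 by less than \<open>e\<close>. If \<open>e\<close> is at least 1, the lower half follows
    from positivity of the ratio.\<close>
  define e' where "e' = min (ln (1 + e)) (if e < 1 then - ln (1 - e) else 1)"
  have e': "e' > 0" using \<open>e > 0\<close> by (auto simp: e'_def)
  have "\<forall>\<^sub>F x in at_top. \<forall>u\<in>{0..ln M}. \<bar>h (x + u) - h x\<bar> < e'"
    by (rule uniform_convergence_additive) (use h e' \<open>M > 1\<close> in auto)
  then have "\<forall>\<^sub>F x in at_top. \<forall>u\<in>{0..ln M}. \<bar>h (ln x + u) - h (ln x)\<bar> < e'"
    using ln_at_top by (rule eventually_compose_filterlim)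
  then show ?thesis
    using eventually_gt_at_top[of 0] eventually_ge_at_top[of A]
  proof eventually_elim
    case (elim x)
    show ?case
    proof
      fix u assume u: "u \<in> {1..M}"
      then have "1 \<le> u" by simp
      have "A \<le> 1 * x" using elim by simp
      also have "\<dots> \<le> u * x" using \<open>1 \<le> u\<close> elim by (intro mult_right_mono) auto
      finally have xu: "u * x \<ge> A" .
      have "exp (ln x + ln u) = u * x" using elim u by (simp add: exp_add)
      then have *: "h (ln x + ln u) - h (ln x) = ln (L (u * x) / L x)"
        using xu elim A(2) by (simp add: h_def K_def ln_div less_imp_neq[symmetric])
      have "\<bar>ln (L (u * x) / L x)\<bar> < e'"
        using elim(1) u unfolding *[symmetric] by auto
      moreover have r: "L (u * x) / L x > 0" using xu elim A(2) by simp
      moreover have "e' \<le> ln (1 + e)" "e < 1 \<Longrightarrow> e' \<le> - ln (1 - e)" by (auto simp: e'_def)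
      ultimately have "ln (L (u * x) / L x) < ln (1 + e)" "e < 1 \<Longrightarrow> ln (L (u * x) / L x) > ln (1 - e)"
        by linarith+
      then have "L (u * x) / L x < 1 + e" "e < 1 \<Longrightarrow> L (u * x) / L x > 1 - e"
        using r \<open>e > 0\<close> ln_less_cancel_iff[of "L (u * x) / L x" "1 + e"]
          ln_less_cancel_iff[of "1 - e" "L (u * x) / L x"] by simp_all
      then show "\<bar>L (u * x) / L x - 1\<bar> < e" using r by (cases "e < 1") auto
    qed
  qed
qed

text \<open>To pass to a two-sided window, \<open>L y\<close> and \<open>L x\<close> are both
  compared with the value of \<open>L\<close> at the left end \<open>x / M\<close>. Seen from there
  the window has ratio \<open>M * M\<close>, so the one-sided statement covers it.\<close>

lemma slowly_varying_uniform_ratio: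
  assumes sv: "slowly_varying L" and "M > 1" "e > 0"
  shows "\<forall>\<^sub>F x in at_top. \<forall>y\<in>{x / M..M * x}. \<bar>L y / L x - 1\<bar> < e"
proof -
  define d where "d = min (1/2) (e / 4)"
  have d: "d > 0" "d \<le> 1/2" "4 * d \<le> e" using \<open>e > 0\<close> by (auto simp: d_def)
  have "\<forall>\<^sub>F x in at_top. \<forall>u\<in>{1..M * M}. \<bar>L (u * x) / L x - 1\<bar> < d"
    by (rule slowly_varying_uniform[OF sv]) (use d \<open>M > 1\<close> in \<open>auto intro: less_1_mult\<close>)
  then have "\<forall>\<^sub>F x in at_top. x > 0 \<and> L x > 0 \<and> (\<forall>u\<in>{1..M * M}. \<bar>L (u * x) / L x - 1\<bar> < d)"
    using slowly_varying_pos[OF sv] eventually_gt_at_top[of 0] by (auto intro: eventually_conj)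
  moreover have "filterlim (\<lambda>x. x / M) at_top at_top"
    using \<open>M > 1\<close> filterlim_tendsto_pos_mult_at_top[OF tendsto_const[of "inverse M"] _ filterlim_ident]
    by (simp add: divide_inverse mult.commute)
  ultimately have "\<forall>\<^sub>F x in at_top. x / M > 0 \<and> L (x / M) > 0 \<and>
      (\<forall>u\<in>{1..M * M}. \<bar>L (u * (x / M)) / L (x / M) - 1\<bar> < d)"
    by (rule eventually_compose_filterlim)
  then show ?thesis
  proof eventually_elim
    case (elim x)
    define K where "K = L (x / M)"
    have K: "K > 0" using elim by (simp add: K_def)
    have near: "\<bar>L y / K - 1\<bar> < d" if "x / M \<le> y" "y \<le> M * x" for y
    proof -
      have "y / (x / M) \<in> {1..M * M}" using that elim \<open>M > 1\<close> by (auto simp: field_simps)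
      then have "\<bar>L (y / (x / M) * (x / M)) / L (x / M) - 1\<bar> < d" using elim by blast
      moreover have "y / (x / M) * (x / M) = y"
        using elim by (metis less_irrefl nonzero_eq_divide_eq)
      ultimately show ?thesis by (simp only: K_def)
    qed
    show ?case
    proof
      fix y assume y: "y \<in> {x / M..M * x}"
      have x: "x / M \<le> x" "x \<le> M * x" using elim \<open>M > 1\<close> by (auto simp: field_simps)
      have 1: "\<bar>L y / K - 1\<bar> < d" "\<bar>L x / K - 1\<bar> < d" using near y x by auto
      then have x2: "L x / K > 1/2" using d by linarith
      then have Lx: "L x > 0" using K by (simp add: field_simps)
      have "\<bar>L y / K - L x / K\<bar> < 2 * d" using 1 by linarith
      also have "\<dots> \<le> 4 * d * (L x / K)"
        using mult_left_mono[of "1/2" "L x / K" "4 * d"] x2 d by simp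
      also have "\<dots> \<le> e * (L x / K)" using d x2 by (intro mult_right_mono) linarith+
      finally have "\<bar>L y / K - L x / K\<bar> * (K / L x) < e" using K Lx by (simp add: field_simps)
      moreover have "\<bar>L y / K - L x / K\<bar> * (K / L x) = \<bar>L y / L x - 1\<bar>"
      proof -
        have "(L y / K - L x / K) * (K / L x) = L y / L x - 1"
          using K Lx by (simp add: field_simps)
        then have "\<bar>L y / K - L x / K\<bar> * \<bar>K / L x\<bar> = \<bar>L y / L x - 1\<bar>"
          by (simp only: abs_mult[symmetric])
        then show ?thesis using K Lx by simp
      qed
      ultimately show "\<bar>L y / L x - 1\<bar> < e" by simp
    qed
  qed
qed

text \<open>Potter's bounds with exponent 1/2. Far out, one doubling of the argument changes
  \<open>L\<close> at most by the factor 4/3, hence by less than \<open>sqrt 2\<close>, and iterated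
  doubling produces \<open>sqrt (y / x)\<close> up to the constant spent on the last incomplete
  doubling.\<close>

lemma slowly_varying_Potter:
  assumes sv: "slowly_varying L"
  obtains x0 where "x0 > 0" "\<And>x. x \<ge> x0 \<Longrightarrow> L x > 0"
    "\<And>x y. x0 \<le> x \<Longrightarrow> x \<le> y \<Longrightarrow> L y \<le> 2 * L x * sqrt (y / x)"
    "\<And>x y. x0 \<le> x \<Longrightarrow> x \<le> y \<Longrightarrow> L x \<le> 2 * L y * sqrt (y / x)"
proof -
  have "\<forall>\<^sub>F x in at_top. x > 0 \<and> L x > 0 \<and> (\<forall>u\<in>{1..2}. \<bar>L (u * x) / L x - 1\<bar> < 1/4)"
    using slowly_varying_pos[OF sv] slowly_varying_uniform[OF sv, of 2 "1/4"] eventually_gt_at_top[of 0]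
    by (auto intro: eventually_conj)
  then obtain x0 where x0: "\<And>x. x \<ge> x0 \<Longrightarrow> x > 0 \<and> L x > 0 \<and> (\<forall>u\<in>{1..2}. \<bar>L (u * x) / L x - 1\<bar> < 1/4)"
    unfolding eventually_at_top_linorder by auto
  have sqrt2: "sqrt 2 \<ge> 4/3" "sqrt 2 \<le> 2" "sqrt 2 \<ge> 5/4"
    by (rule real_le_rsqrt real_le_lsqrt; simp add: power2_eq_square)+
  have one: "L y \<le> sqrt 2 * L x \<and> L x \<le> sqrt 2 * L y" if "x0 \<le> x" "x \<le> y" "y \<le> 2 * x" for x y
  proof -
    have p: "x > 0" "L x > 0" "L y > 0" using x0 that by force+
    have "y / x \<in> {1..2}" using that p by (auto simp: field_simps)
    then have "\<bar>L (y / x * x) / L x - 1\<bar> < 1/4" using x0[OF that(1)] by blast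
    then have "\<bar>L y / L x - 1\<bar> < 1/4" using p by simp
    then have "L y / L x < 5/4" "L y / L x > 3/4" by linarith+
    then have "L y \<le> 5/4 * L x" "L x \<le> 4/3 * L y" using p by (auto simp: field_simps)
    then show ?thesis using sqrt2 p mult_right_mono[of "5/4" "sqrt 2" "L x"] mult_right_mono[of "4/3" "sqrt 2" "L y"]
      by linarith
  qed
  have iter: "L y \<le> sqrt 2 * sqrt (y / x) * L x \<and> L x \<le> sqrt 2 * sqrt (y / x) * L y"
    if "x0 \<le> x" "x \<le> y" "y \<le> 2 ^ Suc k * x" for x y k
    using that
  proof (induction k arbitrary: y)
    case 0
    have p: "x > 0" "L x > 0" "L y > 0" using x0 0 by force+
    have "sqrt (y / x) \<ge> 1" using p 0 by (auto simp: field_simps)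
    then have "sqrt 2 * L x * 1 \<le> sqrt 2 * L x * sqrt (y/x)" "sqrt 2 * L y * 1 \<le> sqrt 2 * L y * sqrt (y/x)"
      using p by (auto intro!: mult_left_mono)
    then show ?case using one[of x y] 0 by (auto simp: algebra_simps)
  next
    case (Suc k)
    show ?case
    proof (cases "y \<le> 2 ^ Suc k * x")
      case True
      then show ?thesis using Suc by simp
    next
      case False
      have p: "x > 0" using x0 Suc.prems by force
      have "2 * x \<le> 2 ^ Suc k * x" using p by simp
      then have y2: "x \<le> y / 2" "y / 2 \<le> 2 ^ Suc k * x" using False Suc.prems by auto
      have IH: "L (y/2) \<le> sqrt 2 * sqrt (y / 2 / x) * L x" "L x \<le> sqrt 2 * sqrt (y / 2 / x) * L (y/2)"
        using Suc.IH[OF Suc.prems(1) y2] by auto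
      \<comment> \<open>The loss in one doubling is exactly the growth of
        \<open>sqrt (y / x)\<close>, so that the constant does not deteriorate in the
        induction.\<close>
      have *: "sqrt 2 * sqrt (y / 2 / x) = sqrt (y / x)"
        by (simp add: real_sqrt_mult[symmetric])
      have o: "L y \<le> sqrt 2 * L (y/2)" "L (y/2) \<le> sqrt 2 * L y" using one[of "y/2" y] y2 Suc.prems x0[of x] by auto
      have "L y \<le> sqrt 2 * (sqrt (y / x) * L x)"
        using o(1) order_trans[OF _ mult_left_mono[of "L (y/2)" "sqrt (y/x) * L x" "sqrt 2"]] IH(1) unfolding * by simp
      moreover have "sqrt (y / x) * L (y/2) \<le> sqrt (y / x) * (sqrt 2 * L y)"
        using o(2) y2 p by (intro mult_left_mono) auto
      ultimately show ?thesis using IH(2) unfolding * by (auto simp: algebra_simps)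
    qed
  qed
  have fin: "L y \<le> 2 * L x * sqrt (y / x) \<and> L x \<le> 2 * L y * sqrt (y / x)" if "x0 \<le> x" "x \<le> y" for x y
  proof -
    have p: "x > 0" "L x > 0" "L y > 0" using x0 that by force+
    obtain k where "y / x < 2 ^ k" using real_arch_pow[of 2 "y/x"] by auto
    then have "y \<le> 2 ^ k * x" using p by (auto simp: field_simps)
    also have "\<dots> \<le> 2 ^ Suc k * x" using p by simp
    finally have "L y \<le> sqrt 2 * sqrt (y / x) * L x \<and> L x \<le> sqrt 2 * sqrt (y / x) * L y"
      using iter that by blast
    moreover have "sqrt 2 * (sqrt (y / x) * L x) \<le> 2 * (sqrt (y / x) * L x)"
      "sqrt 2 * (sqrt (y / x) * L y) \<le> 2 * (sqrt (y / x) * L y)"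
      using sqrt2 p that by (intro mult_right_mono; simp)+
    ultimately show ?thesis by (auto simp: algebra_simps)
  qed
  show ?thesis
    by (rule that[of x0]) (use x0 fin in \<open>auto\<close>)
qed


section \<open>Sums and expectations over the natural numbers\<close>

text \<open>The bound is one-sided: \<open>u\<close> may be arbitrarily negative, as happens for the
  lower tail of a sum with unbounded letters. For \<open>u = - v\<close> it follows from
  \<open>exp (- v) \<le> 1 - v + v^2\<close>, obtained by multiplying the right-hand side with the
  quadratic Taylor polynomial of \<open>exp v\<close>.\<close>

lemma exp_le_quadratic:
  fixes u K :: real
  assumes "u \<le> K" "K \<ge> 0"
  shows "exp u \<le> 1 + u + u\<^sup>2 * exp K"
proof (cases "u \<ge> 0")
  case True
  obtain t where t: "\<bar>t\<bar> \<le> \<bar>u\<bar>" "exp u = (\<Sum>m<2. u ^ m / fact m) + exp t / fact 2 * u ^ 2"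
    using Maclaurin_exp_le by blast
  have "exp t / 2 * u\<^sup>2 \<le> exp K * u\<^sup>2"
  proof (rule mult_right_mono)
    have "exp t \<le> exp K" using t True assms by simp
    then show "exp t / 2 \<le> exp K" using exp_gt_zero[of t] by linarith
  qed simp
  moreover have "(\<Sum>m<2. u ^ m / fact m) = 1 + u" by (simp add: lessThan_nat_numeral)
  ultimately show ?thesis using t(2) by (simp add: fact_numeral mult.commute)
next
  case False
  define v where "v = - u"
  have v: "v > 0" using False by (simp add: v_def)
  have "1 \<le> (1 - v + v\<^sup>2) * (1 + v + v\<^sup>2 / 2)"
  proof -
    have "(1 - v + v\<^sup>2) * (1 + v + v\<^sup>2 / 2) = 1 + v\<^sup>2 / 2 + v ^ 3 / 2 + v ^ 4 / 2"
      by (simp add: power2_eq_square power3_eq_cube power4_eq_xxxx field_simps)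
    then show ?thesis using v by simp
  qed
  also have "\<dots> \<le> (1 - v + v\<^sup>2) * exp v"
  proof (rule mult_left_mono)
    show "1 + v + v\<^sup>2 / 2 \<le> exp v" using exp_lower_Taylor_quadratic[of v] v by simp
    have "1 - v + v\<^sup>2 = (v - 1/2)\<^sup>2 + 3/4" by (simp add: power2_eq_square algebra_simps)
    then show "0 \<le> 1 - v + v\<^sup>2" by (simp only:) simp
  qed
  finally have "exp u \<le> 1 - v + v\<^sup>2" by (simp add: v_def exp_minus field_simps)
  moreover have "u\<^sup>2 * 1 \<le> u\<^sup>2 * exp K" using assms by (intro mult_left_mono) auto
  ultimately show ?thesis by (simp add: v_def)
qed

lemma sum_inverse_sqrt_le: "(\<Sum>k=1..n. 1 / sqrt (real k)) \<le> 2 * sqrt (real n)"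
proof (induction n)
  case (Suc n)
  have "sqrt (real n) * sqrt (real (Suc n)) \<le> real n + 1/2"
    unfolding real_sqrt_mult[symmetric]
    by (rule real_le_lsqrt) (auto simp: power2_eq_square algebra_simps)
  moreover have t: "sqrt (real (Suc n)) * sqrt (real (Suc n)) = real n + 1" by simp
  ultimately have "1 \<le> (2 * sqrt (real (Suc n)) - 2 * sqrt (real n)) * sqrt (real (Suc n))"
    unfolding left_diff_distrib mult.assoc t by simp
  moreover have "sqrt (real (Suc n)) > 0" by simp
  ultimately have "1 / sqrt (real (Suc n)) \<le> 2 * sqrt (real (Suc n)) - 2 * sqrt (real n)"
    by (simp only: pos_divide_le_eq)
  then show ?case using Suc by simp
qed simp

text \<open>Telescoping comparison with the integral of the power -3/2. The constant 4 instead of 2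
  pays for replacing \<open>sqrt (k + 1)\<close> by \<open>sqrt k\<close> in the difference.\<close>

lemma sum_inverse_three_halves_le:
  assumes "m \<ge> 1"
  shows "(\<Sum>k=m..n. 1 / (real k * sqrt (real k))) \<le> 4 / sqrt (real m)"
proof (cases "m \<le> n")
  case True
  have step: "1 / (real k * sqrt (real k)) \<le> 4 / sqrt (real k) - 4 / sqrt (real (Suc k))" if "k \<ge> 1" for k
  proof -
    define s t where "s = sqrt (real k)" "t = sqrt (real (Suc k))"
    have s: "s \<ge> 1" "s \<le> t" "t * t = s * s + 1" "s * s = real k" using that by (auto simp: s_t_def)
    have "t \<le> 2 * s"
    proof (rule power2_le_imp_le)
      have "s * s \<ge> 1" using s mult_mono[of 1 s 1 s] by auto
      then show "t\<^sup>2 \<le> (2 * s)\<^sup>2" using s by (simp add: power2_eq_square)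
    qed (use s in auto)
    have "(t - s) * (t + s) = 1" using s by (simp add: algebra_simps)
    then have *: "t - s = 1 / (t + s)" using s by (simp add: field_simps)
    have "t * (t + s) \<le> (2 * s) * (3 * s)" using s \<open>t \<le> 2 * s\<close> by (intro mult_mono) auto
    have tt: "t * (t + s) \<le> 4 * (s * s)"
    proof -
      have "t * s \<le> 2 * s * s" using s \<open>t \<le> 2 * s\<close> by (intro mult_right_mono) auto
      moreover have "s * s \<ge> 1" using s mult_mono[of 1 s 1 s] by auto
      moreover have "t * (t + s) = s * s + 1 + t * s" using s by (simp add: distrib_left)
      ultimately show ?thesis by simp
    qed
    have "4 / s - 4 / t = 4 * (t - s) / (s * t)" using s by (simp add: field_simps)
    also have "\<dots> = 4 / (s * (t * (t + s)))" unfolding * by simp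
    finally have "4 / s - 4 / t = 4 / (s * (t * (t + s)))" .
    moreover have "4 / (s * (4 * (s * s))) \<le> 4 / (s * (t * (t + s)))"
      using tt s by (intro divide_left_mono mult_left_mono mult_pos_pos) auto
    moreover have "4 / (s * (4 * (s * s))) = 1 / (real k * s)"
      using s(4) by (simp add: mult.commute)
    ultimately have "1 / (real k * s) \<le> 4 / s - 4 / t" by simp
    then show ?thesis by (simp only: s_t_def)
  qed
  have "(\<Sum>k=m..n. 1 / (real k * sqrt (real k))) \<le> (\<Sum>k=m..n. 4 / sqrt (real k) - 4 / sqrt (real (Suc k)))"
    by (intro sum_mono step) (use assms in auto)
  also have "\<dots> = 4 / sqrt (real m) - 4 / sqrt (real (Suc n))"
    using sum_Suc_diff'[of m "Suc n" "\<lambda>k. - (4 / sqrt (real k))"] True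
    by (simp add: atLeastLessThanSuc_atLeastAtMost)
  also have "\<dots> \<le> 4 / sqrt (real m)" by simp
  finally show ?thesis .
qed simp

lemma sum_inverse_squares_le:
  assumes "m \<ge> 2"
  shows "(\<Sum>k=m..n. 1 / (real k)\<^sup>2) \<le> 1 / (real m - 1)"
proof (cases "m \<le> n")
  case True
  have "(\<Sum>k=m..n. 1 / (real k)\<^sup>2) \<le> (\<Sum>k=m..n. 1 / (real k - 1) - 1 / (real (Suc k) - 1))"
    by (intro sum_mono) (use assms in \<open>auto simp: field_simps power2_eq_square\<close>)
  also have "\<dots> = 1 / (real m - 1) - 1 / (real (Suc n) - 1)"
    using sum_Suc_diff'[of m "Suc n" "\<lambda>k. - (1 / (real k - 1))"] True
    by (simp add: atLeastLessThanSuc_atLeastAtMost)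
  also have "\<dots> \<le> 1 / (real m - 1)" by simp
  finally show ?thesis .
qed (use assms in simp)

lemma sum_inverse_squares_ge:
  assumes "m \<ge> 1" "m \<le> Suc n"
  shows "(\<Sum>k=m..n. 1 / (real k)\<^sup>2) \<ge> 1 / real m - 1 / real (Suc n)"
proof -
  have "1 / real m - 1 / real (Suc n) = (\<Sum>k=m..n. 1 / real k - 1 / real (Suc k))"
    using sum_Suc_diff'[of m "Suc n" "\<lambda>k. - (1 / real k)"] assms
    by (simp add: atLeastLessThanSuc_atLeastAtMost)
  also have "\<dots> \<le> (\<Sum>k=m..n. 1 / (real k)\<^sup>2)"
  proof (rule sum_mono)
    fix k assume "k \<in> {m..n}"
    then have k: "real k > 0" using assms by auto
    have "1 / real k - 1 / real (Suc k) = 1 / (real k * (real k + 1))"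
      using k by (simp add: field_simps)
    also have "\<dots> \<le> 1 / (real k * real k)"
      using k by (intro divide_left_mono mult_left_mono) auto
    finally show "1 / real k - 1 / real (Suc k) \<le> 1 / (real k)\<^sup>2" by (simp add: power2_eq_square)
  qed
  finally show ?thesis .
qed

lemma sum_inverse_ge_ln:
  assumes "m \<ge> 1" "m \<le> Suc n"
  shows "(\<Sum>k=m..n. 1 / real k) \<ge> ln (real (Suc n)) - ln (real m)"
proof -
  have "ln (real (Suc n)) - ln (real m) = (\<Sum>k=m..n. ln (real (Suc k)) - ln (real k))"
    using sum_Suc_diff'[of m "Suc n" "\<lambda>k. ln (real k)"] assms
    by (simp add: atLeastLessThanSuc_atLeastAtMost)
  also have "\<dots> \<le> (\<Sum>k=m..n. 1 / real k)"
  proof (rule sum_mono)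
    fix k assume "k \<in> {m..n}"
    then have k: "real k > 0" using assms by auto
    have "1 + 1 / real k = real (Suc k) / real k" using k by (simp add: field_simps)
    then have "ln (real (Suc k)) - ln (real k) = ln (1 + 1 / real k)"
      using k by (simp add: ln_div)
    also have "\<dots> \<le> 1 / real k" by (rule ln_add_one_self_le_self) (use k in auto)
    finally show "ln (real (Suc k)) - ln (real k) \<le> 1 / real k" .
  qed
  finally show ?thesis .
qed

text \<open>Monotone convergence in the form needed below: a bound on the finite partial sums, which
  are estimated termwise, yields integrability and the bound on the expectation at once. Lower
  bounds come from \<open>sum_le_expectation_nat\<close>.\<close>

lemma expectation_nat_le:
  fixes \<mu> :: "nat pmf" and g :: "nat \<Rightarrow> real"
  assumes g: "\<And>k. g k \<ge> 0" and le: "\<And>n. (\<Sum>k<n. g k * pmf \<mu> k) \<le> c"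
  shows "integrable \<mu> g" "measure_pmf.expectation \<mu> g \<le> c"
proof -
  have c: "c \<ge> 0" using le[of 0] by simp
  have "(\<integral>\<^sup>+k. ennreal (g k) \<partial>\<mu>) = (\<Sum>k. ennreal (g k * pmf \<mu> k))"
    by (simp add: nn_integral_measure_pmf nn_integral_count_space_nat ennreal_mult g mult.commute)
  also have "\<dots> \<le> ennreal c"
    using le g by (intro suminf_le_const) (auto simp: ennreal_leI)
  finally have nn: "(\<integral>\<^sup>+k. ennreal (g k) \<partial>\<mu>) \<le> ennreal c" .
  then show int: "integrable \<mu> g"
    using g by (intro integrableI_nonneg) (auto simp: top.not_eq_extremum intro: le_less_trans)
  show "measure_pmf.expectation \<mu> g \<le> c"
    using nn nn_integral_eq_integral[OF int] g c by simp
qed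

lemma sum_le_expectation_nat:
  fixes \<mu> :: "nat pmf" and g :: "nat \<Rightarrow> real"
  assumes int: "integrable \<mu> g" and g: "\<And>k. g k \<ge> 0" and "finite F"
  shows "(\<Sum>k\<in>F. g k * pmf \<mu> k) \<le> measure_pmf.expectation \<mu> g"
proof -
  have "(\<Sum>k\<in>F. g k * pmf \<mu> k) = (\<Sum>k\<in>F. (g k * indicator F k) * pmf \<mu> k)"
    by (intro sum.cong) auto
  also have "\<dots> = measure_pmf.expectation \<mu> (\<lambda>k. g k * indicator F k)"
    using \<open>finite F\<close> by (subst integral_measure_pmf_real[of F]) (auto simp: indicator_def split: if_splits)
  also have "\<dots> \<le> measure_pmf.expectation \<mu> g"
    by (rule integral_mono[OF integrable_real_mult_indicator[OF _ int] int])
       (use g in \<open>auto simp: indicator_def\<close>)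
  finally show ?thesis .
qed

lemma expectation_nat_sums:
  fixes \<mu> :: "nat pmf" and g :: "nat \<Rightarrow> real"
  assumes g: "\<And>k. g k \<ge> 0" and s: "(\<lambda>k. g k * pmf \<mu> k) sums c"
  shows "integrable \<mu> g" "measure_pmf.expectation \<mu> g = c"
proof -
  have le: "(\<Sum>k<n. g k * pmf \<mu> k) \<le> c" for n
    using sum_le_suminf[of "\<lambda>k. g k * pmf \<mu> k" "{..<n}"] s g by (auto simp: sums_iff)
  note * = expectation_nat_le[of g, OF g le]
  show int: "integrable \<mu> g" by (rule *)
  have "c \<le> measure_pmf.expectation \<mu> g"
    using s unfolding sums_def by (rule LIMSEQ_le_const2) (auto intro!: sum_le_expectation_nat int g)
  then show "measure_pmf.expectation \<mu> g = c" using *(2) by simp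
qed


section \<open>The offspring law\<close>

locale critical_cauchy =
  fixes L :: "real \<Rightarrow> real" and \<mu> :: "nat pmf"
  assumes slowly_varying: "slowly_varying L"
    and mean: "(\<lambda>i. real i * pmf \<mu> i) sums 1"
    and pmf_equiv: "(\<lambda>n. pmf \<mu> n) \<sim>[sequentially] (\<lambda>n. L (real n) / (real n)\<^sup>2)"
begin

definition tail :: "real \<Rightarrow> real" where
  "tail x = measure_pmf.prob \<mu> {k. x \<le> real k}"

text \<open>As the mean of the step is 0, this is minus the mean of the step truncated at
  \<open>y\<close> (see \<open>excess_eq\<close>). For \<open>y \<ge> 1\<close> it is a sum of
  nonnegative terms, hence monotone and easy to bound from below.\<close>

definition excess :: "real \<Rightarrow> real" where
  "excess y = measure_pmf.expectation \<mu> (\<lambda>k. (real k - 1) * indicator {k. y < real k} k)"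

definition trunc_var :: "real \<Rightarrow> real" where
  "trunc_var y = measure_pmf.expectation \<mu> (\<lambda>k. (real k - 1)\<^sup>2 * indicator {k. real k \<le> y} k)"

lemma eventually_pmf_bounds:
  assumes "e > 0"
  shows "\<forall>\<^sub>F x in at_top. \<forall>k. x \<le> real k \<longrightarrow>
    (1 - e) * (L k / (real k)\<^sup>2) \<le> pmf \<mu> k \<and> pmf \<mu> k \<le> (1 + e) * (L k / (real k)\<^sup>2)"
proof -
  \<comment> \<open>The relation \<open>asymp_equiv\<close> gives the quotient the value 1 where
    both sides vanish; far out \<open>L\<close> is positive and only the genuine quotient
    remains.\<close>
  have "((\<lambda>n. if pmf \<mu> n = 0 \<and> L (real n) / (real n)\<^sup>2 = 0 then 1 else pmf \<mu> n / (L (real n) / (real n)\<^sup>2)) \<longlonglongrightarrow> 1)"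
    using pmf_equiv unfolding asymp_equiv_def .
  then have "\<forall>\<^sub>F n in sequentially. \<bar>(if pmf \<mu> n = 0 \<and> L (real n) / (real n)\<^sup>2 = 0 then 1 else pmf \<mu> n / (L (real n) / (real n)\<^sup>2)) - 1\<bar> < e"
    using \<open>e > 0\<close> unfolding tendsto_iff dist_real_def by blast
  moreover have "\<forall>\<^sub>F n :: nat in sequentially. L (real n) > 0"
    using slowly_varying_pos[OF slowly_varying] filterlim_real_sequentially by (rule eventually_compose_filterlim)
  ultimately have "\<forall>\<^sub>F n :: nat in sequentially.
     (1 - e) * (L n / (real n)\<^sup>2) \<le> pmf \<mu> n \<and> pmf \<mu> n \<le> (1 + e) * (L n / (real n)\<^sup>2)"
    using eventually_gt_at_top[of 0]
  proof eventually_elim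
    case (elim n)
    define r where "r = L n / (real n)\<^sup>2"
    have r: "r > 0" using elim by (simp add: r_def)
    then have "\<bar>pmf \<mu> n / r - 1\<bar> < e" using elim by (auto simp: r_def)
    then have "pmf \<mu> n / r \<le> 1 + e" "pmf \<mu> n / r \<ge> 1 - e" by linarith+
    then show ?case using r unfolding r_def[symmetric] by (simp add: field_simps)
  qed
  then obtain N where N: "\<And>n. n \<ge> N \<Longrightarrow>
     (1 - e) * (L n / (real n)\<^sup>2) \<le> pmf \<mu> n \<and> pmf \<mu> n \<le> (1 + e) * (L n / (real n)\<^sup>2)"
    unfolding eventually_sequentially by auto
  show ?thesis
    using eventually_ge_at_top[of "real N"] by eventually_elim (use N in auto)
qed

lemma mean_expectation: "integrable \<mu> real" "measure_pmf.expectation \<mu> real = 1"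
  using expectation_nat_sums[of real \<mu> 1] mean by auto

lemma integrable_step: "integrable \<mu> (\<lambda>k. real k - 1)"
  using mean_expectation by simp

lemma integrable_step_indicator: "integrable \<mu> (\<lambda>k. (real k - 1) * indicator A k)"
  by (rule integrable_real_mult_indicator[OF _ integrable_step]) simp

lemma excess_eq: "measure_pmf.expectation \<mu> (\<lambda>k. (real k - 1) * indicator {k. real k \<le> y} k) = - excess y"
proof -
  have "measure_pmf.expectation \<mu> (\<lambda>k. (real k - 1) * indicator {k. real k \<le> y} k) + excess y =
    measure_pmf.expectation \<mu> (\<lambda>k. (real k - 1) * indicator {k. real k \<le> y} k + (real k - 1) * indicator {k. y < real k} k)"
    unfolding excess_def by (rule Bochner_Integration.integral_add[symmetric]; rule integrable_step_indicator)
  also have "\<dots> = measure_pmf.expectation \<mu> (\<lambda>k. real k - 1)"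
    by (rule Bochner_Integration.integral_cong) (auto simp: indicator_def)
  also have "\<dots> = 0" using mean_expectation by (subst Bochner_Integration.integral_diff) auto
  finally show ?thesis by simp
qed

lemma excess_diff:
  "x \<le> y \<Longrightarrow> excess x - excess y = measure_pmf.expectation \<mu> (\<lambda>k. (real k - 1) * indicator {k. x < real k \<and> real k \<le> y} k)"
  unfolding excess_def
  by (subst Bochner_Integration.integral_diff[symmetric])
     (rule integrable_step_indicator Bochner_Integration.integral_cong; auto simp: indicator_def)+

lemma excess_antimono: "1 \<le> x \<Longrightarrow> x \<le> y \<Longrightarrow> excess y \<le> excess x"
proof -
  assume xy: "1 \<le> x" "x \<le> y"
  have "measure_pmf.expectation \<mu> (\<lambda>k. (real k - 1) * indicator {k. x < real k \<and> real k \<le> y} k) \<ge> 0"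
    using xy by (intro Bochner_Integration.integral_nonneg) (auto simp: indicator_def)
  then show ?thesis using excess_diff[OF xy(2)] by simp
qed

lemma trunc_var_nonneg: "trunc_var y \<ge> 0"
  unfolding trunc_var_def by (intro Bochner_Integration.integral_nonneg) auto

section \<open>Karamata-type estimates for the tail and the truncated moments\<close>

lemma regular_constants:
  obtains x0 where "x0 \<ge> 2" "\<And>x. x \<ge> x0 \<Longrightarrow> L x > 0"
    "\<And>x y. x0 \<le> x \<Longrightarrow> x \<le> y \<Longrightarrow> L y \<le> 2 * L x * sqrt (y / x)"
    "\<And>x y. x0 \<le> x \<Longrightarrow> x \<le> y \<Longrightarrow> L x \<le> 2 * L y * sqrt (y / x)"
    "\<And>k. x0 \<le> real k \<Longrightarrow> pmf \<mu> k \<le> 2 * (L k / (real k)\<^sup>2)"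
    "\<And>k. x0 \<le> real k \<Longrightarrow> L k / (real k)\<^sup>2 \<le> 2 * pmf \<mu> k"
proof -
  obtain x1 where x1: "x1 > 0" "\<And>x. x \<ge> x1 \<Longrightarrow> L x > 0"
    "\<And>x y. x1 \<le> x \<Longrightarrow> x \<le> y \<Longrightarrow> L y \<le> 2 * L x * sqrt (y / x)"
    "\<And>x y. x1 \<le> x \<Longrightarrow> x \<le> y \<Longrightarrow> L x \<le> 2 * L y * sqrt (y / x)"
    using slowly_varying_Potter[OF slowly_varying] by blast
  obtain x2 where x2: "\<And>k. x2 \<le> real k \<Longrightarrow>
    (1 - 1/2) * (L k / (real k)\<^sup>2) \<le> pmf \<mu> k \<and> pmf \<mu> k \<le> (1 + 1/2) * (L k / (real k)\<^sup>2)"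
    using eventually_pmf_bounds[of "1/2"] unfolding eventually_at_top_linorder by auto
  show ?thesis
  proof (rule that[of "max 2 (max x1 x2)"])
    fix k assume k: "max 2 (max x1 x2) \<le> real k"
    have "(1 + 1/2) * (L k / (real k)\<^sup>2) \<le> 2 * (L k / (real k)\<^sup>2)"
      using x1(2)[of k] k by (intro mult_right_mono) auto
    then show "pmf \<mu> k \<le> 2 * (L k / (real k)\<^sup>2)" using x2[of k] k by auto
    show "L k / (real k)\<^sup>2 \<le> 2 * pmf \<mu> k" using x2[of k] k by auto
  qed (use x1 in auto)
qed

text \<open>By Potter's bound \<open>L x\<close> is at least a constant times the inverse of
  \<open>sqrt x\<close>, which leaves a growth of order \<open>sqrt x\<close>.\<close>

lemma xL_at_top: "filterlim (\<lambda>x. x * L x) at_top at_top"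
proof -
  obtain x0 where x0: "x0 \<ge> 2" "\<And>x. x \<ge> x0 \<Longrightarrow> L x > 0"
    "\<And>x y. x0 \<le> x \<Longrightarrow> x \<le> y \<Longrightarrow> L x \<le> 2 * L y * sqrt (y / x)"
    using regular_constants by metis
  show ?thesis
  proof (rule filterlim_at_top_mono)
    show "filterlim (\<lambda>x. L x0 * sqrt x0 / 2 * sqrt x) at_top at_top"
      using x0 by (intro filterlim_tendsto_pos_mult_at_top[OF tendsto_const _ sqrt_at_top]) auto
    show "\<forall>\<^sub>F x in at_top. L x0 * sqrt x0 / 2 * sqrt x \<le> x * L x"
      using eventually_ge_at_top[of x0]
    proof eventually_elim
      case (elim x)
      have "L x0 * (sqrt x0 * sqrt x) \<le> (2 * L x * sqrt (x / x0)) * (sqrt x0 * sqrt x)"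
        using x0 elim by (intro mult_right_mono) auto
      also have "\<dots> = 2 * L x * (sqrt x * sqrt x)"
        using x0 by (simp add: real_sqrt_divide)
      also have "\<dots> = 2 * (x * L x)" using x0 elim by simp
      finally show ?case by simp
    qed
  qed
qed

lemma expectation_indicator_tail: "measure_pmf.expectation \<mu> (indicator {k. x \<le> real k}) = tail x"
  by (simp add: tail_def)

text \<open>Karamata's theorem for the tail. Up to \<open>M * x\<close> the weights are uniformly
  close to \<open>L x / k^2\<close>, whose sum is about \<open>L x / x\<close>; beyond
  \<open>M * x\<close> Potter's bound leaves at most \<open>16 / sqrt M\<close> times this
  amount.\<close>

lemma tail_asymp: "((\<lambda>x. tail x * x / L x) \<longlongrightarrow> 1) at_top"
proof -
  obtain x0 where x0: "x0 \<ge> 2" "\<And>x. x \<ge> x0 \<Longrightarrow> L x > 0"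
    "\<And>x y. x0 \<le> x \<Longrightarrow> x \<le> y \<Longrightarrow> L y \<le> 2 * L x * sqrt (y / x)"
    "\<And>k. x0 \<le> real k \<Longrightarrow> pmf \<mu> k \<le> 2 * (L k / (real k)\<^sup>2)"
    using regular_constants by metis
  have main: "\<forall>\<^sub>F x in at_top. \<bar>tail x * x / L x - 1\<bar> \<le> 5 * e" if e: "0 < e" "e \<le> 1/10" for e :: real
  proof -
    \<comment> \<open>The three summands serve the far sum (\<open>16 / sqrt M \<le> e\<close>), the
      condition \<open>M > 1\<close>, and the part of the sum of inverse squares lost by stopping at
      \<open>M * x\<close> (\<open>1 / M \<le> e\<close>).\<close>
    define M where "M = (16 / e)\<^sup>2 + 2 + 1 / e"
    have M: "M > 1" "16 / sqrt M \<le> e" "1 / M \<le> e"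
    proof -
      show "M > 1" using e by (simp add: M_def add_nonneg_pos add_pos_pos)
      have "16 / e \<le> sqrt M" using e by (intro real_le_rsqrt) (simp add: M_def)
      then show "16 / sqrt M \<le> e" using e \<open>M > 1\<close> by (simp add: field_simps)
      have "1 / e \<le> M" using e by (simp add: M_def)
      then show "1 / M \<le> e" using e \<open>M > 1\<close> by (simp add: field_simps)
    qed
    show ?thesis
      using slowly_varying_uniform_ratio[OF slowly_varying M(1) e(1)] eventually_pmf_bounds[OF e(1)]
        eventually_ge_at_top[of x0] eventually_ge_at_top[of "2 / e"]
    proof eventually_elim
      case (elim x)
      have x: "x \<ge> 2" "L x > 0" "2 / e \<le> x" using elim x0 by auto
      then have ex: "2 \<le> e * x" using e by (simp add: field_simps)
      define s t where "s = nat \<lceil>x\<rceil>" "t = nat \<lfloor>M * x\<rfloor>"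
      have xM: "x \<le> M * x" using M x by simp
      have s: "real s \<ge> x" "real s < x + 1" using x by (auto simp: s_t_def) linarith+
      have t: "real t \<le> M * x" "real t + 1 > M * x" using x M xM by (auto simp: s_t_def) 
      have s2: "s \<ge> 2" using s x by linarith
      have near: "(1 - e)\<^sup>2 * L x * (1 / (real k)\<^sup>2) \<le> pmf \<mu> k \<and> pmf \<mu> k \<le> (1 + e)\<^sup>2 * L x * (1 / (real k)\<^sup>2)"
        if "k \<in> {s..t}" for k
      proof -
        have k: "x \<le> real k" "real k \<le> M * x"
          using that s t by (auto intro: order_trans[of _ "real s"] order_trans[of _ "real t"])
        moreover have "x / M \<le> x" using M x by (simp add: field_simps)
        ultimately have "\<bar>L k / L x - 1\<bar> < e" using elim(1) by auto
        then have "L k / L x \<le> 1 + e" "L k / L x \<ge> 1 - e" by linarith+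
        then have Lk: "L k \<le> (1 + e) * L x" "L k \<ge> (1 - e) * L x" using x by (auto simp: field_simps)
        have p: "(1 - e) * (L k / (real k)\<^sup>2) \<le> pmf \<mu> k" "pmf \<mu> k \<le> (1 + e) * (L k / (real k)\<^sup>2)"
          using elim(2) k by auto
        have "(1 - e) * ((1 - e) * L x / (real k)\<^sup>2) \<le> (1 - e) * (L k / (real k)\<^sup>2)"
          using e Lk by (intro mult_left_mono divide_right_mono) auto
        moreover have "(1 + e) * (L k / (real k)\<^sup>2) \<le> (1 + e) * ((1 + e) * L x / (real k)\<^sup>2)"
          using e Lk by (intro mult_left_mono divide_right_mono) auto
        ultimately show ?thesis using p by (simp add: power2_eq_square mult.assoc)
      qed
      have far: "(\<Sum>k=Suc t..n. pmf \<mu> k) \<le> L x * e / x" for n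
      proof -
        have "(\<Sum>k=Suc t..n. pmf \<mu> k) \<le> (\<Sum>k=Suc t..n. 4 * L x / sqrt x * (1 / (real k * sqrt (real k))))"
        proof (rule sum_mono)
          fix k assume "k \<in> {Suc t..n}"
          then have k: "x \<le> real k" using t xM by auto
          have "pmf \<mu> k \<le> 2 * (L k / (real k)\<^sup>2)" using x0(4) k elim by auto
          also have "\<dots> \<le> 2 * (2 * L x * sqrt (real k / x) / (real k)\<^sup>2)"
            using x0(3)[of x k] k elim by (intro mult_left_mono divide_right_mono) auto
          also have "\<dots> = 4 * L x / sqrt x * (sqrt k / (real k)\<^sup>2)" by (simp add: real_sqrt_divide)
          also have "sqrt k / (real k)\<^sup>2 = 1 / (real k * sqrt (real k))"
            using k x by (simp add: power2_eq_square field_simps)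
          finally show "pmf \<mu> k \<le> 4 * L x / sqrt x * (1 / (real k * sqrt (real k)))" .
        qed
        also have "\<dots> = 4 * L x / sqrt x * (\<Sum>k=Suc t..n. 1 / (real k * sqrt (real k)))"
          by (simp add: sum_distrib_left)
        also have "\<dots> \<le> 4 * L x / sqrt x * (4 / sqrt (real (Suc t)))"
          using x by (intro mult_left_mono sum_inverse_three_halves_le) auto
        also have "\<dots> \<le> 4 * L x / sqrt x * (4 / sqrt (M * x))"
          using x M t by (intro mult_left_mono divide_left_mono mult_pos_pos) auto
        also have "\<dots> = L x * (16 / sqrt M) / (sqrt x * sqrt x)"
          by (simp add: real_sqrt_mult mult_ac)
        also have "\<dots> \<le> L x * e / x"
          using x M(2) by (simp add: divide_right_mono mult_left_mono del: times_divide_eq_right)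
        finally show ?thesis .
      qed
      have upper: "tail x \<le> (1 + e)\<^sup>2 * L x * (1 / (x - 1)) + L x * e / x"
        unfolding expectation_indicator_tail[symmetric]
      proof (rule expectation_nat_le)
        fix n
        have "(\<Sum>k<n. indicator {k. x \<le> real k} k * pmf \<mu> k) = (\<Sum>k\<in>{k. k < n \<and> x \<le> real k}. pmf \<mu> k)"
          by (intro sum.mono_neutral_cong_right) auto
        also have "\<dots> \<le> (\<Sum>k\<in>{s..t} \<union> {Suc t..n}. pmf \<mu> k)"
          by (rule sum_mono2) (auto simp: s_t_def nat_ceiling_le_eq)
        also have "\<dots> \<le> (\<Sum>k=s..t. pmf \<mu> k) + (\<Sum>k=Suc t..n. pmf \<mu> k)"
          by (subst sum.union_disjoint) auto
        also have "(\<Sum>k=s..t. pmf \<mu> k) \<le> (\<Sum>k=s..t. (1 + e)\<^sup>2 * L x * (1 / (real k)\<^sup>2))"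
          by (intro sum_mono) (use near in auto)
        also have "\<dots> = (1 + e)\<^sup>2 * L x * (\<Sum>k=s..t. 1 / (real k)\<^sup>2)"
          by (simp only: sum_distrib_left)
        also have "\<dots> \<le> (1 + e)\<^sup>2 * L x * (1 / (real s - 1))"
          using x s2 by (intro mult_left_mono sum_inverse_squares_le) auto
        also have "\<dots> \<le> (1 + e)\<^sup>2 * L x * (1 / (x - 1))"
          using x s by (intro mult_left_mono divide_left_mono) auto
        finally show "(\<Sum>k<n. indicator {k. x \<le> real k} k * pmf \<mu> k) \<le> (1 + e)\<^sup>2 * L x * (1 / (x - 1)) + L x * e / x"
          using far[of n] by simp
      qed auto
      have lower: "(1 - e)\<^sup>2 * L x * (1 / (x + 1) - 1 / (M * x)) \<le> tail x"
      proof -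
        have "(1 - e)\<^sup>2 * L x * (1 / (x + 1) - 1 / (M * x)) \<le> (1 - e)\<^sup>2 * L x * (1 / real s - 1 / real (Suc t))"
        proof -
          have "1 / (x + 1) \<le> 1 / real s" using s x by (intro divide_left_mono) auto
          moreover have "1 / real (Suc t) \<le> 1 / (M * x)" using t x M by (intro divide_left_mono) auto
          ultimately show ?thesis using x by (intro mult_left_mono) auto
        qed
        also have "\<dots> \<le> (1 - e)\<^sup>2 * L x * (\<Sum>k=s..t. 1 / (real k)\<^sup>2)"
        proof (intro mult_left_mono sum_inverse_squares_ge)
          have "real s < real (Suc t) + 1" using s t xM by simp
          then show "s \<le> Suc t" by linarith
        qed (use s2 x in auto)
        also have "\<dots> = (\<Sum>k=s..t. (1 - e)\<^sup>2 * L x * (1 / (real k)\<^sup>2))"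
          by (simp only: sum_distrib_left)
        also have "\<dots> \<le> (\<Sum>k=s..t. pmf \<mu> k)" by (intro sum_mono) (use near in auto)
        also have "\<dots> = (\<Sum>k=s..t. indicator {k. x \<le> real k} k * pmf \<mu> k)"
          using s by (intro sum.cong) (auto simp: indicator_def intro: order_trans)
        also have "\<dots> \<le> measure_pmf.expectation \<mu> (indicator {k. x \<le> real k})"
          by (rule sum_le_expectation_nat) (auto intro!: measure_pmf.integrable_const_bound[of _ 1])
        finally show ?thesis by (simp only: expectation_indicator_tail)
      qed
      have "tail x * x / L x \<le> ((1 + e)\<^sup>2 * L x * (1 / (x - 1)) + L x * e / x) * x / L x"
        using upper x by (intro divide_right_mono mult_right_mono) auto
      also have "\<dots> = (1 + e)\<^sup>2 * (x / (x - 1)) + e"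
        using x by (simp add: field_simps)
      also have "x / (x - 1) \<le> 1 + e"
      proof -
        have "x + 2 \<le> x + e * x" using ex by simp
        then have "x \<le> (1 + e) * (x - 1)" using e by (simp add: algebra_simps)
        then show ?thesis using x by (simp add: pos_divide_le_eq)
      qed
      also have "(1 + e)\<^sup>2 * (1 + e) + e \<le> 1 + 5 * e"
      proof -
        have "(1 + e)\<^sup>2 * (1 + e) + e = 1 + 4 * e + e * (3 * e + e * e)" by (simp add: power2_eq_square algebra_simps)
        moreover have "e * (3 * e + e * e) \<le> e * 1"
          using e mult_mono[of e "1/10" e "1/10"] by (intro mult_left_mono) auto
        ultimately show ?thesis by simp
      qed
      finally have up: "tail x * x / L x \<le> 1 + 5 * e" using e by (simp add: mult_left_mono)
      have "(1 - 2 * e) * (1 - 2 * e) \<le> (1 - e)\<^sup>2 * (x / (x + 1) - 1 / M)"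
      proof (rule mult_mono)
        show "1 - 2 * e \<le> (1 - e)\<^sup>2" by (simp add: power2_eq_square algebra_simps)
        have "(1 - e) * (x + 1) \<le> x" using ex e by (simp add: algebra_simps)
        then have "1 - e \<le> x / (x + 1)" using x by (simp add: pos_le_divide_eq)
        then show "1 - 2 * e \<le> x / (x + 1) - 1 / M" using M by simp
      qed (use e in auto)
      also have "x / (x + 1) - 1 / M = (1 / (x + 1) - 1 / (M * x)) * x"
        using x by (simp add: left_diff_distrib)
      also have "(1 - e)\<^sup>2 * ((1 / (x + 1) - 1 / (M * x)) * x) =
          (1 - e)\<^sup>2 * L x * (1 / (x + 1) - 1 / (M * x)) * x / L x"
        using x by simp
      also have "\<dots> \<le> tail x * x / L x"
        using lower x by (intro divide_right_mono mult_right_mono) auto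
      finally have "(1 - 2 * e) * (1 - 2 * e) \<le> tail x * x / L x" .
      moreover have "(1 - 2 * e) * (1 - 2 * e) = 1 - 4 * e + 4 * (e * e)" by (simp add: algebra_simps)
      ultimately have "1 - 5 * e \<le> tail x * x / L x" using e by (smt (verit) mult_nonneg_nonneg)
      then show ?case using up by linarith
    qed
  qed
  show ?thesis
  proof (rule tendstoI)
    fix e :: real assume "e > 0"
    define d where "d = min (1/10) (e / 6)"
    have d: "0 < d" "d \<le> 1/10" "5 * d < e" using \<open>e > 0\<close> by (auto simp: d_def min_def)
    show "\<forall>\<^sub>F x in at_top. dist (tail x * x / L x) 1 < e"
      using main[OF d(1,2)] by eventually_elim (use d in \<open>auto simp: dist_real_def\<close>)
  qed
qed

text \<open>The terms \<open>k^2 * pmf \<mu> k\<close> are of order \<open>L k\<close>, at most a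
  multiple of \<open>L y * sqrt (y / k)\<close>, and the sum of \<open>1 / sqrt k\<close> supplies
  another \<open>sqrt y\<close>; this gives the constant 8. The finitely many letters outside the
  range of the estimates add a constant, which \<open>y * L y\<close> eventually dominates.\<close>

lemma eventually_trunc_var_le: "\<forall>\<^sub>F y in at_top. trunc_var y \<le> 9 * (y * L y)"
proof -
  obtain x0 where x0: "x0 \<ge> 2" "\<And>x. x \<ge> x0 \<Longrightarrow> L x > 0"
    "\<And>x y. x0 \<le> x \<Longrightarrow> x \<le> y \<Longrightarrow> L x \<le> 2 * L y * sqrt (y / x)"
    "\<And>k. x0 \<le> real k \<Longrightarrow> pmf \<mu> k \<le> 2 * (L k / (real k)\<^sup>2)"
    using regular_constants by metis
  define k0 where "k0 = nat \<lceil>x0\<rceil>"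
  have k0: "real k0 \<ge> x0" "k0 \<ge> 1" using x0 by (auto simp: k0_def) linarith+
  have "\<forall>\<^sub>F y in at_top. real k0 * (real k0)\<^sup>2 \<le> y * L y"
    using xL_at_top by (simp add: filterlim_at_top)
  then show ?thesis using eventually_ge_at_top[of x0]
  proof eventually_elim
    case (elim y)
    define t where "t = nat \<lfloor>y\<rfloor>"
    have y: "y \<ge> 2" "L y > 0" using x0 elim by auto
    then have t: "real t \<le> y" by (simp add: t_def)
    have "trunc_var y \<le> real k0 * (real k0)\<^sup>2 + 8 * (y * L y)"
      unfolding trunc_var_def
    proof (rule expectation_nat_le)
      fix n
      let ?g = "\<lambda>k. (real k - 1)\<^sup>2 * indicator {k. real k \<le> y} k * pmf \<mu> k"
      have "(\<Sum>k<n. ?g k) = (\<Sum>k\<in>{k. k < n \<and> real k \<le> y}. (real k - 1)\<^sup>2 * pmf \<mu> k)"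
        by (intro sum.mono_neutral_cong_right) auto
      also have "\<dots> \<le> (\<Sum>k\<in>{..<k0} \<union> {k0..t}. (real k - 1)\<^sup>2 * pmf \<mu> k)"
        by (rule sum_mono2) (auto simp: t_def le_nat_floor)
      also have "\<dots> = (\<Sum>k<k0. (real k - 1)\<^sup>2 * pmf \<mu> k) + (\<Sum>k=k0..t. (real k - 1)\<^sup>2 * pmf \<mu> k)"
        by (subst sum.union_disjoint) auto
      also have "(\<Sum>k<k0. (real k - 1)\<^sup>2 * pmf \<mu> k) \<le> (\<Sum>k<k0. (real k0)\<^sup>2 * 1)"
      proof (rule sum_mono, rule mult_mono)
        fix k assume "k \<in> {..<k0}"
        then have "\<bar>real k - 1\<bar> \<le> \<bar>real k0\<bar>" by auto
        then show "(real k - 1)\<^sup>2 \<le> (real k0)\<^sup>2" by (rule abs_le_square_iff[THEN iffD1])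
      qed (auto simp: pmf_le_1)
      also have "(\<Sum>k=k0..t. (real k - 1)\<^sup>2 * pmf \<mu> k) \<le> (\<Sum>k=k0..t. 4 * L y * sqrt y * (1 / sqrt (real k)))"
      proof (rule sum_mono)
        fix k assume "k \<in> {k0..t}"
        then have k: "x0 \<le> real k" "real k \<le> y" using k0 t by (auto intro: order_trans[of _ "real k0"] order_trans[of _ "real t"])
        have "(real k - 1)\<^sup>2 * pmf \<mu> k \<le> (real k)\<^sup>2 * (2 * (L k / (real k)\<^sup>2))"
          using k x0 by (intro mult_mono power_mono) auto
        also have "\<dots> = 2 * L k" using k x0 by simp
        also have "\<dots> \<le> 2 * (2 * L y * sqrt (y / k))" using x0(3)[of k y] k by simp
        finally show "(real k - 1)\<^sup>2 * pmf \<mu> k \<le> 4 * L y * sqrt y * (1 / sqrt (real k))"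
          by (simp add: real_sqrt_divide)
      qed
      also have "\<dots> = 4 * L y * sqrt y * (\<Sum>k=k0..t. 1 / sqrt (real k))"
        by (simp only: sum_distrib_left)
      also have "\<dots> \<le> 4 * L y * sqrt y * (2 * sqrt y)"
      proof (rule mult_left_mono)
        have "(\<Sum>k=k0..t. 1 / sqrt (real k)) \<le> (\<Sum>k=1..t. 1 / sqrt (real k))"
          using k0 by (intro sum_mono2) auto
        also have "\<dots> \<le> 2 * sqrt (real t)" by (rule sum_inverse_sqrt_le)
        also have "\<dots> \<le> 2 * sqrt y" using t by simp
        finally show "(\<Sum>k=k0..t. 1 / sqrt (real k)) \<le> 2 * sqrt y" .
      qed (use y in auto)
      also have "4 * L y * sqrt y * (2 * sqrt y) = 8 * (y * L y)" using y by simp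
      finally show "(\<Sum>k<n. ?g k) \<le> real k0 * (real k0)\<^sup>2 + 8 * (y * L y)" by simp
    qed auto
    then show ?case using elim by simp
  qed
qed

text \<open>Between \<open>y\<close> and \<open>M * y\<close> the summands are comparable to
  \<open>L y / k\<close>, so they add up to a multiple of \<open>L y * ln M\<close>, and
  \<open>M\<close> is arbitrary. This divergence makes the drift dominate both the fluctuations and
  the truncated variance.\<close>

lemma excess_ratio_at_top: "filterlim (\<lambda>y. excess y / L y) at_top at_top"
proof -
  obtain x0 where x0: "x0 \<ge> 2" "\<And>x. x \<ge> x0 \<Longrightarrow> L x > 0"
    "\<And>k. x0 \<le> real k \<Longrightarrow> L k / (real k)\<^sup>2 \<le> 2 * pmf \<mu> k"
    using regular_constants by metis
  show ?thesis
    unfolding filterlim_at_top_ge[where c = 1]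
  proof (intro allI impI)
    fix K :: real assume "K \<ge> 1"
    \<comment> \<open>The 8 collects three factors 1/2, lost in \<open>k - 1 \<ge> k / 2\<close>, in
      the comparison of \<open>pmf \<mu> k\<close> with \<open>L k / k^2\<close>, and in
      \<open>L k \<ge> L y / 2\<close>. The factor 2 in front compensates for starting the sum at an
      integer \<open>s\<close>, of which only \<open>s \<le> 2 * y\<close> is used.\<close>
    define M where "M = 2 * exp (8 * K)"
    have "exp (8 * K) > 1" using \<open>K \<ge> 1\<close> by simp
    then have M: "M > 1" unfolding M_def by linarith
    have half: "(1/2 :: real) > 0" by simp
    show "\<forall>\<^sub>F y in at_top. K \<le> excess y / L y"
      using slowly_varying_uniform_ratio[OF slowly_varying M half] eventually_ge_at_top[of x0]
    proof eventually_elim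
      case (elim y)
      have y: "y \<ge> 2" "L y > 0" using elim x0 by auto
      define s t where "s = Suc (nat \<lfloor>y\<rfloor>)" "t = nat \<lfloor>M * y\<rfloor>"
      have yM: "y \<le> M * y" using M y by simp
      have s: "real s > y" "real s \<le> y + 1" using y by (auto simp: s_t_def) linarith
      have t: "real t \<le> M * y" "real t + 1 > M * y" using y M yM by (auto simp: s_t_def) 
      have "s \<ge> 1" by (simp add: s_t_def)
      have "s \<le> Suc t" 
      proof -
        have "real s < real (Suc t) + 1" using s t yM by simp
        then show ?thesis by linarith
      qed
      have "K * L y \<le> L y / 8 * (ln (real (Suc t)) - ln (real s))"
      proof -
        have "8 * K = ln (M / 2)" by (simp add: M_def)
        also have "\<dots> \<le> ln (real (Suc t) / real s)"
        proof (subst ln_le_cancel_iff)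
          have "M / 2 * real s \<le> M / 2 * (2 * y)" using s y M by (intro mult_left_mono) auto
          also have "\<dots> \<le> real (Suc t)" using t by simp
          finally show "M / 2 \<le> real (Suc t) / real s" using \<open>s \<ge> 1\<close> by (simp add: field_simps)
        qed (use M \<open>s \<ge> 1\<close> in auto)
        also have "\<dots> = ln (real (Suc t)) - ln (real s)" using \<open>s \<ge> 1\<close> by (simp add: ln_div)
        finally have "L y / 8 * (8 * K) \<le> L y / 8 * (ln (real (Suc t)) - ln (real s))"
          using y by (intro mult_left_mono) auto
        then show ?thesis by (simp add: mult.commute)
      qed
      also have "\<dots> \<le> L y / 8 * (\<Sum>k=s..t. 1 / real k)"
        using y \<open>s \<ge> 1\<close> \<open>s \<le> Suc t\<close> by (intro mult_left_mono sum_inverse_ge_ln) auto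
      also have "\<dots> = (\<Sum>k=s..t. L y / 8 * (1 / real k))" by (simp only: sum_distrib_left)
      also have "\<dots> \<le> (\<Sum>k=s..t. (real k - 1) * indicator {k. y < real k} k * pmf \<mu> k)"
      proof (rule sum_mono)
        fix k assume "k \<in> {s..t}"
        then have k: "y < real k" "real k \<le> M * y"
          using s t by (auto intro: less_le_trans[of _ "real s"] order_trans[of _ "real t"])
        moreover have "y / M \<le> y" using M y by (simp add: field_simps)
        ultimately have "\<bar>L k / L y - 1\<bar> < 1/2" using elim(1) by auto
        then have "L k / L y \<ge> 1 / 2" by linarith
        then have Lk: "L k \<ge> L y / 2" using y by (simp add: field_simps)
        have "L y / 8 * (1 / real k) = (real k / 2) * (L y / 2 / (real k)\<^sup>2 / 2)"
          using k y by (simp add: power2_eq_square field_simps)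
        also have "\<dots> \<le> (real k / 2) * (L k / (real k)\<^sup>2 / 2)"
          using Lk k y by (intro mult_left_mono divide_right_mono) auto
        also have "\<dots> \<le> (real k - 1) * pmf \<mu> k"
          using k y x0(3)[of k] elim x0(2)[of k] by (intro mult_mono) auto
        finally show "L y / 8 * (1 / real k) \<le> (real k - 1) * indicator {k. y < real k} k * pmf \<mu> k"
          using k by simp
      qed
      also have "\<dots> \<le> excess y" unfolding excess_def
        using y by (intro sum_le_expectation_nat integrable_step_indicator) (auto simp: indicator_def)
      finally show ?case using y by (simp add: field_simps)
    qed
  qed
qed

text \<open>Needed to move the truncation level from \<open>a n + 1\<close> to \<open>B n\<close>.
  Potter's bound turns the summands into multiples of \<open>L x / sqrt (x * k)\<close>, whose sum
  up to \<open>y\<close> is of order \<open>L x * sqrt (y / x)\<close>.\<close>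

lemma eventually_excess_diff_le:
  "\<forall>\<^sub>F x in at_top. \<forall>y\<ge>x. excess x - excess y \<le> 8 * L x * sqrt (y / x)"
proof -
  obtain x0 where x0: "x0 \<ge> 2" "\<And>x. x \<ge> x0 \<Longrightarrow> L x > 0"
    "\<And>x y. x0 \<le> x \<Longrightarrow> x \<le> y \<Longrightarrow> L y \<le> 2 * L x * sqrt (y / x)"
    "\<And>k. x0 \<le> real k \<Longrightarrow> pmf \<mu> k \<le> 2 * (L k / (real k)\<^sup>2)"
    using regular_constants by metis
  show ?thesis using eventually_ge_at_top[of x0]
  proof eventually_elim
    case (elim x)
    show ?case
    proof (intro allI impI)
      fix y assume xy: "x \<le> y"
      have x: "x \<ge> 2" "L x > 0" using elim x0 by auto
      define t where "t = nat \<lfloor>y\<rfloor>"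
      have t: "real t \<le> y" using x xy by (simp add: t_def)
      let ?I = "{k. x < real k \<and> real k \<le> y}"
      have I: "?I \<subseteq> {1..t}" using x by (auto simp: t_def le_nat_floor Suc_le_eq)
      then have "finite ?I" by (rule finite_subset) simp
      have "excess x - excess y \<le> 8 * L x * sqrt y / sqrt x"
        unfolding excess_diff[OF xy]
      proof (rule expectation_nat_le)
        fix n
        have "(\<Sum>k<n. (real k - 1) * indicator ?I k * pmf \<mu> k) = (\<Sum>k\<in>{..<n} \<inter> ?I. (real k - 1) * pmf \<mu> k)"
          by (intro sum.mono_neutral_cong_right) auto
        also have "\<dots> \<le> (\<Sum>k\<in>{..<n} \<inter> ?I. 4 * L x / sqrt x * (1 / sqrt (real k)))"
        proof (rule sum_mono)
          fix k assume "k \<in> {..<n} \<inter> ?I"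
          then have k: "x \<le> real k" by auto
          have "(real k - 1) * pmf \<mu> k \<le> real k * (2 * (L k / (real k)\<^sup>2))"
            using x0(4)[of k] k elim x by (intro mult_mono) auto
          also have "\<dots> \<le> real k * (2 * (2 * L x * sqrt (k / x) / (real k)\<^sup>2))"
            using x0(3)[of x k] k elim by (intro mult_left_mono divide_right_mono) auto
          also have "\<dots> = 4 * L x / sqrt x * (real k * sqrt k / (real k)\<^sup>2)"
            by (simp add: real_sqrt_divide)
          also have "real k * sqrt k / (real k)\<^sup>2 = sqrt k / (sqrt k * sqrt k)"
            using k x by (simp add: power2_eq_square)
          also have "\<dots> = 1 / sqrt k" by (simp only: divide_divide_eq_left[symmetric]) (use k x in \<open>simp add: divide_self\<close>)
          finally show "(real k - 1) * pmf \<mu> k \<le> 4 * L x / sqrt x * (1 / sqrt (real k))" .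
        qed
        also have "\<dots> \<le> (\<Sum>k=1..t. 4 * L x / sqrt x * (1 / sqrt (real k)))"
          using I x by (intro sum_mono2) auto
        also have "\<dots> = 4 * L x / sqrt x * (\<Sum>k=1..t. 1 / sqrt (real k))"
          by (simp only: sum_distrib_left)
        also have "\<dots> \<le> 4 * L x / sqrt x * (2 * sqrt (real t))"
          using x by (intro mult_left_mono sum_inverse_sqrt_le) auto
        also have "\<dots> \<le> 4 * L x / sqrt x * (2 * sqrt y)"
          using x t by (intro mult_left_mono) auto
        finally show "(\<Sum>k<n. (real k - 1) * indicator ?I k * pmf \<mu> k) \<le> 8 * L x * sqrt y / sqrt x"
          by simp
      qed (use x in \<open>auto simp: indicator_def\<close>)
      then show "excess x - excess y \<le> 8 * L x * sqrt (y / x)" by (simp add: real_sqrt_divide)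
    qed
  qed
qed

end


section \<open>Random words\<close>

lemma pmf_replicate_pmf:
  "pmf (replicate_pmf n p) xs = (if length xs = n then prod_list (map (pmf p) xs) else 0)"
proof (induction n arbitrary: xs)
  case 0
  then show ?case by (auto simp: indicator_def)
next
  case (Suc n)
  have eq: "replicate_pmf (Suc n) p = map_pmf (\<lambda>(x, xs). x # xs) (pair_pmf p (replicate_pmf n p))"
    by (simp add: pair_pmf_def map_bind_pmf map_pmf_def bind_assoc_pmf bind_return_pmf)
  show ?case
  proof (cases xs)
    case Nil
    then have "xs \<notin> set_pmf (replicate_pmf (Suc n) p)"
      by (subst set_replicate_pmf) auto
    then show ?thesis using Nil by (simp only: set_pmf_iff) simp
  next
    case (Cons y ys)
    have inj: "inj (\<lambda>(x, xs). x # xs)" by (auto simp: inj_def)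
    have "pmf (replicate_pmf (Suc n) p) (case (y, ys) of (x, xs) \<Rightarrow> x # xs) = pmf (pair_pmf p (replicate_pmf n p)) (y, ys)"
      unfolding eq by (rule pmf_map_inj'[OF inj])
    then show ?thesis using Suc Cons by (simp add: pmf_pair del: replicate_pmf.simps)
  qed
qed

lemma mset_rotate: "mset (rotate k xs) = mset xs"
proof (induction k)
  case (Suc k)
  then show ?case by (cases "rotate k xs") auto
qed simp

lemma map_rotate_replicate_pmf: "map_pmf (rotate k) (replicate_pmf n p) = replicate_pmf n p"
proof (rule pmf_eqI)
  fix xs :: "'a list"
  have inj: "inj (rotate k :: 'a list \<Rightarrow> 'a list)"
    unfolding rotate_def by (intro inj_fn inj_rotate1)
  have "surj (rotate k :: 'a list \<Rightarrow> 'a list)"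
    unfolding rotate_def by (intro surj_fn surj_rotate1)
  then obtain ys where ys: "xs = rotate k ys" by (rule surjE)
  have "pmf (map_pmf (rotate k) (replicate_pmf n p)) xs = pmf (replicate_pmf n p) ys"
    unfolding ys by (rule pmf_map_inj'[OF inj])
  also have "\<dots> = pmf (replicate_pmf n p) xs"
  proof -
    have "mset (map (pmf p) xs) = mset (map (pmf p) ys)" unfolding ys by (simp add: mset_rotate)
    then have "prod_list (map (pmf p) xs) = prod_list (map (pmf p) ys)"
      by (metis prod_mset_prod_list)
    then show ?thesis unfolding pmf_replicate_pmf by (simp add: ys)
  qed
  finally show "pmf (map_pmf (rotate k) (replicate_pmf n p)) xs = pmf (replicate_pmf n p) xs" .
qed

lemma emeasure_rotate_replicate_pmf:
  "emeasure (replicate_pmf n p) {xs. rotate k xs \<in> E} = emeasure (replicate_pmf n p) E"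
proof -
  have "emeasure (replicate_pmf n p) E = emeasure (map_pmf (rotate k) (replicate_pmf n p)) E"
    by (simp only: map_rotate_replicate_pmf)
  also have "\<dots> = emeasure (replicate_pmf n p) {xs. rotate k xs \<in> E}"
    by (simp add: vimage_def)
  finally show ?thesis by simp
qed

lemma measure_rotate_replicate_pmf:
  "measure_pmf.prob (replicate_pmf n p) {xs. rotate k xs \<in> E} = measure_pmf.prob (replicate_pmf n p) E"
  by (simp add: measure_def emeasure_rotate_replicate_pmf)

lemma prob_ex_rotate_le:
  "measure_pmf.prob (replicate_pmf n p) {xs. \<exists>k<n. rotate k xs \<in> E}
     \<le> n * measure_pmf.prob (replicate_pmf n p) E"
proof -
  have "measure_pmf.prob (replicate_pmf n p) (\<Union>k<n. {xs. rotate k xs \<in> E})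
      \<le> (\<Sum>k<n. measure_pmf.prob (replicate_pmf n p) {xs. rotate k xs \<in> E})"
    by (intro measure_pmf.finite_measure_subadditive_finite) auto
  also have "\<dots> = n * measure_pmf.prob (replicate_pmf n p) E"
    by (simp add: measure_rotate_replicate_pmf)
  also have "(\<Union>k<n. {xs. rotate k xs \<in> E}) = {xs. \<exists>k<n. rotate k xs \<in> E}" by auto
  finally show ?thesis .
qed

text \<open>The \<open>n\<close> events obtained by rotation are equally likely, and the assumption
  makes them disjoint. This is used both for the cycle lemma and for words with exactly one letter
  in a given set.\<close>

lemma prob_ex_rotate_eq:
  assumes "\<And>xs j k. length xs = n \<Longrightarrow> j < n \<Longrightarrow> k < n \<Longrightarrow> rotate j xs \<in> E \<Longrightarrow> rotate k xs \<in> E \<Longrightarrow> j = k"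
  shows "measure_pmf.prob (replicate_pmf n p) {xs. \<exists>k<n. rotate k xs \<in> E}
     = n * measure_pmf.prob (replicate_pmf n p) E"
proof -
  define E' where "E' k = {xs. length xs = n \<and> rotate k xs \<in> E}" for k
  have len: "AE xs in replicate_pmf n p. length xs = n"
    by (auto simp: AE_measure_pmf_iff set_replicate_pmf)
  have E': "measure_pmf.prob (replicate_pmf n p) (E' k) = measure_pmf.prob (replicate_pmf n p) E" for k
    unfolding measure_rotate_replicate_pmf[of n p k E, symmetric] E'_def
    by (intro measure_pmf.finite_measure_eq_AE) (use len in auto)
  have "measure_pmf.prob (replicate_pmf n p) (\<Union>k<n. E' k)
      = (\<Sum>k<n. measure_pmf.prob (replicate_pmf n p) (E' k))"
    by (intro measure_pmf.finite_measure_finite_Union)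
       (use assms in \<open>auto simp: E'_def disjoint_family_on_def\<close>)
  also have "\<dots> = n * measure_pmf.prob (replicate_pmf n p) E"
    by (simp add: E')
  also have "measure_pmf.prob (replicate_pmf n p) (\<Union>k<n. E' k)
      = measure_pmf.prob (replicate_pmf n p) {xs. \<exists>k<n. rotate k xs \<in> E}"
    by (intro measure_pmf.finite_measure_eq_AE) (use len in \<open>auto simp: E'_def\<close>)
  finally show ?thesis .
qed

text \<open>The first letter is integrated given the rest of the word, so that a prescribed sum
  leaves a single possible value for it.\<close>

lemma emeasure_replicate_pmf_Suc:
  "emeasure (replicate_pmf (Suc n) p) E =
     (\<integral>\<^sup>+t. emeasure (measure_pmf p) {x. x # t \<in> E} \<partial>replicate_pmf n p)"
proof -
  have "replicate_pmf (Suc n) p = bind_pmf (replicate_pmf n p) (\<lambda>t. map_pmf (\<lambda>x. x # t) p)"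
    by (simp add: map_pmf_def) (rule bind_commute_pmf)
  then show ?thesis by (simp add: vimage_def del: replicate_pmf.simps)
qed

lemma nn_integral_replicate_pmf_prod:
  fixes g :: "'a \<Rightarrow> ennreal"
  shows "(\<integral>\<^sup>+xs. prod_list (map g xs) \<partial>replicate_pmf n p) = (\<integral>\<^sup>+x. g x \<partial>p) ^ n"
  by (induction n) (simp_all add: nn_integral_cmult nn_integral_multc)



text \<open>Markov's inequality for a multiplicative functional of the word. Exponential moments are
  the main instance; since \<open>g\<close> may vanish, a constraint on all letters can be built
  into it.\<close>

lemma prob_replicate_pmf_le_prod:
  fixes g :: "'a \<Rightarrow> real"
  assumes g: "\<And>x. g x \<ge> 0" and bd: "\<And>x. g x \<le> K" and M: "measure_pmf.expectation p g \<le> M" and "c > 0"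
    and E: "\<And>xs. length xs = n \<Longrightarrow> xs \<in> E \<Longrightarrow> c \<le> prod_list (map g xs)"
  shows "measure_pmf.prob (replicate_pmf n p) E \<le> M ^ n / c"
proof -
  have int: "integrable p g"
    by (rule measure_pmf.integrable_const_bound[of _ K]) (use g bd in auto)
  have e0: "measure_pmf.expectation p g \<ge> 0" using g by simp
  then have M0: "M \<ge> 0" using M by simp
  have "ennreal c * emeasure (replicate_pmf n p) E = (\<integral>\<^sup>+xs. ennreal c * indicator E xs \<partial>replicate_pmf n p)"
    by (simp add: nn_integral_cmult_indicator)
  also have "\<dots> \<le> (\<integral>\<^sup>+xs. prod_list (map (\<lambda>x. ennreal (g x)) xs) \<partial>replicate_pmf n p)"
  proof (rule nn_integral_mono_AE, unfold AE_measure_pmf_iff, rule ballI)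
    fix xs assume xs: "xs \<in> set_pmf (replicate_pmf n p)"
    then have "length xs = n" by (simp add: set_replicate_pmf)
    moreover have "prod_list (map (\<lambda>x. ennreal (g x)) xs) = ennreal (prod_list (map g xs))"
      by (induction xs) (use g in \<open>auto simp: ennreal_mult intro!: ennreal_mult[symmetric] prod_list_nonneg\<close>)
    ultimately show "ennreal c * indicator E xs \<le> prod_list (map (\<lambda>x. ennreal (g x)) xs)"
      using E[of xs] by (auto simp: indicator_def ennreal_leI)
  qed
  also have "\<dots> = ennreal (measure_pmf.expectation p g) ^ n"
    unfolding nn_integral_replicate_pmf_prod using nn_integral_eq_integral[OF int] g by simp
  also have "\<dots> \<le> ennreal (M ^ n)"
    using M e0 by (simp add: ennreal_power power_mono ennreal_leI)
  finally have "c * measure_pmf.prob (replicate_pmf n p) E \<le> M ^ n"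
    using \<open>c > 0\<close> M0 by (simp add: measure_pmf.emeasure_eq_measure ennreal_mult[symmetric])
  then show ?thesis using \<open>c > 0\<close> by (simp add: field_simps)
qed

lemma prob_replicate_pmf_ex_le:
  "measure_pmf.prob (replicate_pmf n p) {xs. \<exists>x\<in>set xs. x \<in> H} \<le> n * measure_pmf.prob p H"
proof (induction n)
  case (Suc n)
  let ?E = "{xs. \<exists>x\<in>set xs. x \<in> H}"
  have "emeasure (replicate_pmf (Suc n) p) ?E \<le> (\<integral>\<^sup>+t. emeasure p H + indicator ?E t \<partial>replicate_pmf n p)"
    unfolding emeasure_replicate_pmf_Suc
  proof (rule nn_integral_mono)
    fix t
    show "emeasure (measure_pmf p) {x. x # t \<in> ?E} \<le> emeasure p H + indicator ?E t"
    proof (cases "t \<in> ?E")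
      case True
      then show ?thesis
        using order_trans[OF measure_pmf.emeasure_le_1[of p "{x. x # t \<in> ?E}"], of "emeasure p H + 1"] by simp
    next
      case False
      then have "{x. x # t \<in> ?E} = H" by auto
      then show ?thesis by simp
    qed
  qed
  also have "\<dots> = emeasure p H + emeasure (replicate_pmf n p) ?E"
    by (subst nn_integral_add) auto
  finally have "measure_pmf.prob (replicate_pmf (Suc n) p) ?E \<le>
      measure_pmf.prob p H + measure_pmf.prob (replicate_pmf n p) ?E"
    unfolding measure_pmf.emeasure_eq_measure by (simp add: ennreal_plus[symmetric] del: ennreal_plus)
  then show ?case using Suc by (simp add: algebra_simps)
qed simp

section \<open>Singling out one letter of a word with prescribed sum\<close>

lemma ex_rotate_Cons:
  fixes xs :: "nat list"
  assumes "x \<in> set xs"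
  obtains k t where "k < length xs" "rotate k xs = x # t"
    "sum_list xs = x + sum_list t" "set t \<subseteq> set xs" "length xs = Suc (length t)"
proof -
  obtain k where k: "k < length xs" "xs ! k = x" using assms by (auto simp: in_set_conv_nth)
  have "rotate k xs = drop k xs @ take k xs" using k by (simp add: rotate_drop_take)
  also have "\<dots> = x # (drop (Suc k) xs @ take k xs)" using k by (simp add: Cons_nth_drop_Suc[symmetric])
  finally have r: "rotate k xs = x # (drop (Suc k) xs @ take k xs)" .
  have "sum_list xs = sum_list (take k xs @ drop k xs)" by simp
  also have "\<dots> = x + sum_list (drop (Suc k) xs @ take k xs)"
    using k by (simp add: Cons_nth_drop_Suc[symmetric] del: append_take_drop_id)
  finally have s: "sum_list xs = x + sum_list (drop (Suc k) xs @ take k xs)" .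
  show ?thesis
    by (rule that[OF k(1) r s]) (use k in \<open>auto dest: in_set_dropD in_set_takeD\<close>)
qed

text \<open>If the sum is prescribed, the value of a distinguished entry is determined by the others:
  it costs at most the supremum of the weights of its possible values.\<close>

lemma prob_jump_le:
  fixes c :: real
  assumes H: "\<And>x. x \<in> H \<Longrightarrow> pmf \<mu> x \<le> c" and "c \<ge> 0"
  shows "measure_pmf.prob (replicate_pmf (Suc m) \<mu>)
      {xs. sum_list xs = m \<and> (\<exists>x\<in>set xs. x \<in> H) \<and> (\<forall>x\<in>set xs. x \<in> Y)}
    \<le> real (Suc m) * c * measure_pmf.prob (replicate_pmf m \<mu>)
        {t. sum_list t \<le> m \<and> m - sum_list t \<in> H \<and> (\<forall>x\<in>set t. x \<in> Y)}"
proof -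
  define E where "E = {x # t | x t. x \<in> H \<and> x + sum_list t = m \<and> (\<forall>y\<in>set t. y \<in> Y)}"
  define T where "T = {t. sum_list t \<le> m \<and> m - sum_list t \<in> H \<and> (\<forall>x\<in>set t. x \<in> Y)}"
  have "measure_pmf.prob (replicate_pmf (Suc m) \<mu>)
      {xs. sum_list xs = m \<and> (\<exists>x\<in>set xs. x \<in> H) \<and> (\<forall>x\<in>set xs. x \<in> Y)}
    \<le> measure_pmf.prob (replicate_pmf (Suc m) \<mu>) {xs. \<exists>k<Suc m. rotate k xs \<in> E}"
  proof (rule measure_pmf.finite_measure_mono_AE)
    show "AE xs in replicate_pmf (Suc m) \<mu>. xs \<in> {xs. sum_list xs = m \<and> (\<exists>x\<in>set xs. x \<in> H) \<and> (\<forall>x\<in>set xs. x \<in> Y)}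
      \<longrightarrow> xs \<in> {xs. \<exists>k<Suc m. rotate k xs \<in> E}"
      unfolding AE_measure_pmf_iff
    proof (intro ballI impI)
      fix xs assume "xs \<in> set_pmf (replicate_pmf (Suc m) \<mu>)"
      then have len: "length xs = Suc m" by (simp only: set_replicate_pmf) simp
      assume "xs \<in> {xs. sum_list xs = m \<and> (\<exists>x\<in>set xs. x \<in> H) \<and> (\<forall>x\<in>set xs. x \<in> Y)}"
      then obtain x where x: "x \<in> set xs" "x \<in> H" "sum_list xs = m" "\<forall>x\<in>set xs. x \<in> Y" by auto
      obtain k t where "k < length xs" "rotate k xs = x # t"
          "sum_list xs = x + sum_list t" "set t \<subseteq> set xs" "length xs = Suc (length t)"
        using ex_rotate_Cons[OF x(1)] by blast
      then have "k < Suc m" "rotate k xs \<in> E" using x len by (auto simp: E_def)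
      then show "xs \<in> {xs. \<exists>k<Suc m. rotate k xs \<in> E}" by blast
    qed
  qed simp
  also have "\<dots> \<le> real (Suc m) * measure_pmf.prob (replicate_pmf (Suc m) \<mu>) E"
    by (rule prob_ex_rotate_le)
  also have "measure_pmf.prob (replicate_pmf (Suc m) \<mu>) E \<le> c * measure_pmf.prob (replicate_pmf m \<mu>) T"
  proof -
    have "emeasure (replicate_pmf (Suc m) \<mu>) E \<le> (\<integral>\<^sup>+t. ennreal c * indicator T t \<partial>replicate_pmf m \<mu>)"
      unfolding emeasure_replicate_pmf_Suc
    proof (rule nn_integral_mono)
      fix t
      show "emeasure (measure_pmf \<mu>) {x. x # t \<in> E} \<le> ennreal c * indicator T t"
      proof (cases "t \<in> T")
        case True
        have "emeasure (measure_pmf \<mu>) {x. x # t \<in> E} \<le> emeasure (measure_pmf \<mu>) {m - sum_list t}"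
          by (rule emeasure_mono) (auto simp: E_def)
        also have "\<dots> \<le> ennreal c"
          using True H by (auto simp: T_def emeasure_pmf_single ennreal_leI)
        finally show ?thesis using True by simp
      next
        case False
        then have "{x. x # t \<in> E} = {}" by (auto simp: E_def T_def)
        then show ?thesis by simp
      qed
    qed
    also have "\<dots> = ennreal c * emeasure (replicate_pmf m \<mu>) T"
      by (simp add: nn_integral_cmult_indicator)
    finally show ?thesis
      using \<open>c \<ge> 0\<close> by (simp add: measure_pmf.emeasure_eq_measure ennreal_mult[symmetric] del: replicate_pmf.simps)
  qed
  finally show ?thesis by (simp add: T_def mult_left_mono mult.assoc del: replicate_pmf.simps of_nat_Suc)
qed

text \<open>Counterpart of the upper bound. Here the remaining letters avoid \<open>H\<close>, so
  the distinguished letter is unique and the positions it may occupy give disjoint events: the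
  factor \<open>Suc m\<close> is not lost to overlaps.\<close>

lemma prob_jump_ge:
  fixes c :: real
  assumes H: "\<And>x. x \<in> H \<Longrightarrow> c \<le> pmf \<mu> x" and "c \<ge> 0"
  shows "real (Suc m) * c * measure_pmf.prob (replicate_pmf m \<mu>)
        {t. sum_list t \<le> m \<and> m - sum_list t \<in> H \<and> (\<forall>x\<in>set t. x \<notin> H) \<and> t \<in> T}
     \<le> measure_pmf.prob (replicate_pmf (Suc m) \<mu>)
      {xs. sum_list xs = m \<and> (\<exists>k x t. rotate k xs = x # t \<and> x \<in> H \<and> (\<forall>x\<in>set t. x \<notin> H) \<and> t \<in> T)}"
proof -
  define E where "E = {x # t | x t. x \<in> H \<and> x + sum_list t = m \<and> (\<forall>y\<in>set t. y \<notin> H) \<and> t \<in> T}"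
  define F where "F = {t. sum_list t \<le> m \<and> m - sum_list t \<in> H \<and> (\<forall>x\<in>set t. x \<notin> H) \<and> t \<in> T}"
  have "c * measure_pmf.prob (replicate_pmf m \<mu>) F \<le> measure_pmf.prob (replicate_pmf (Suc m) \<mu>) E"
  proof -
    have "ennreal c * emeasure (replicate_pmf m \<mu>) F = (\<integral>\<^sup>+t. ennreal c * indicator F t \<partial>replicate_pmf m \<mu>)"
      by (simp add: nn_integral_cmult_indicator)
    also have "\<dots> \<le> emeasure (replicate_pmf (Suc m) \<mu>) E"
      unfolding emeasure_replicate_pmf_Suc
    proof (rule nn_integral_mono)
      fix t
      show "ennreal c * indicator F t \<le> emeasure (measure_pmf \<mu>) {x. x # t \<in> E}"
      proof (cases "t \<in> F")
        case True
        then have "{m - sum_list t} \<subseteq> {x. x # t \<in> E}" by (auto simp: E_def F_def)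
        then have "emeasure (measure_pmf \<mu>) {m - sum_list t} \<le> emeasure (measure_pmf \<mu>) {x. x # t \<in> E}"
          by (rule emeasure_mono) simp
        moreover have "ennreal c \<le> emeasure (measure_pmf \<mu>) {m - sum_list t}"
          using True H by (auto simp: F_def emeasure_pmf_single ennreal_leI)
        ultimately show ?thesis using True by simp
      qed simp
    qed
    finally show ?thesis
      using \<open>c \<ge> 0\<close> by (simp add: measure_pmf.emeasure_eq_measure ennreal_mult[symmetric] del: replicate_pmf.simps)
  qed
  then have "real (Suc m) * (c * measure_pmf.prob (replicate_pmf m \<mu>) F) \<le>
      real (Suc m) * measure_pmf.prob (replicate_pmf (Suc m) \<mu>) E"
    by (intro mult_left_mono) auto
  also have "\<dots> = measure_pmf.prob (replicate_pmf (Suc m) \<mu>) {xs. \<exists>k<Suc m. rotate k xs \<in> E}"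
  proof (rule prob_ex_rotate_eq[symmetric])
    fix xs :: "nat list" and j k
    assume len: "length xs = Suc m" and jk: "j < Suc m" "k < Suc m" and E: "rotate j xs \<in> E" "rotate k xs \<in> E"
    have hd: "rotate i xs ! 0 = xs ! i" if "i < Suc m" for i
      using that len nth_rotate[of 0 xs i] by simp
    have k: "xs ! k \<in> H" using E(2) hd[OF jk(2)] by (auto simp: E_def)
    \<comment> \<open>This is the position of the letter \<open>xs ! k\<close> in the word rotated
      by \<open>j\<close>. All letters of that word but the first avoid \<open>H\<close>, which
      forces the position 0.\<close>
    define i where "i = (k + Suc m - j) mod Suc m"
    have i: "i < Suc m" by (simp add: i_def)
    have "(j + i) mod Suc m = (j + (k + Suc m - j)) mod Suc m" unfolding i_def by (rule mod_add_right_eq)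
    also have "j + (k + Suc m - j) = k + Suc m" using jk by simp
    also have "(k + Suc m) mod Suc m = k" using jk by (metis mod_add_self2 mod_less)
    finally have nth: "rotate j xs ! i = xs ! k" using nth_rotate[of i xs j] len i by simp
    obtain x t where xt: "rotate j xs = x # t" "\<forall>y\<in>set t. y \<notin> H" using E(1) by (auto simp: E_def)
    have "i = 0"
    proof (rule ccontr)
      assume "i \<noteq> 0"
      then obtain i' where i': "i = Suc i'" using not0_implies_Suc by blast
      have "length t = m" using xt(1) len by (metis Suc_inject length_Cons length_rotate)
      then have "t ! i' \<in> set t" using i i' by simp
      then show False using xt nth k i' by auto
    qed
    then have "(j + 0) mod Suc m = k" using \<open>(k + Suc m) mod Suc m = k\<close> \<open>j + (k + Suc m - j) = k + Suc m\<close>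
        \<open>(j + i) mod Suc m = (j + (k + Suc m - j)) mod Suc m\<close> by metis
    then show "j = k" using jk by simp
  qed
  also have "\<dots> \<le> measure_pmf.prob (replicate_pmf (Suc m) \<mu>)
      {xs. sum_list xs = m \<and> (\<exists>k x t. rotate k xs = x # t \<and> x \<in> H \<and> (\<forall>x\<in>set t. x \<notin> H) \<and> t \<in> T)}"
  proof (rule measure_pmf.finite_measure_mono)
    have sum: "sum_list (rotate k xs) = sum_list xs" for k and xs :: "nat list"
      by (simp add: mset_rotate flip: sum_mset_sum_list)
    show "{xs. \<exists>k<Suc m. rotate k xs \<in> E} \<subseteq>
      {xs. sum_list xs = m \<and> (\<exists>k x t. rotate k xs = x # t \<and> x \<in> H \<and> (\<forall>x\<in>set t. x \<notin> H) \<and> t \<in> T)}"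
    proof
      fix xs assume "xs \<in> {xs. \<exists>k<Suc m. rotate k xs \<in> E}"
      then obtain k x t where k: "rotate k xs = x # t" "x \<in> H" "x + sum_list t = m" "\<forall>y\<in>set t. y \<notin> H" "t \<in> T"
        unfolding E_def by blast
      then have "sum_list xs = m" using sum[of k xs] by simp
      then show "xs \<in> {xs. sum_list xs = m \<and> (\<exists>k x t. rotate k xs = x # t \<and> x \<in> H \<and> (\<forall>x\<in>set t. x \<notin> H) \<and> t \<in> T)}"
        using k by blast
    qed
  qed simp
  finally show ?thesis by (simp add: F_def mult.assoc del: replicate_pmf.simps of_nat_Suc)
qed


section \<open>Coding trees by words\<close>

abbreviation forest_word :: "plane_tree list \<Rightarrow> nat list" where
  "forest_word ts \<equiv> concat (map outdegrees ts)"

text \<open>The word \<open>xs\<close> codes a forest of \<open>k\<close> trees: its walk with steps \<open>x - 1\<close>, started at \<open>k\<close>,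
  hits \<open>0\<close> for the first time at the end.\<close>

definition lukasiewicz :: "nat \<Rightarrow> nat list \<Rightarrow> bool" where
  "lukasiewicz k xs \<longleftrightarrow> sum_list xs + k = length xs \<and> (\<forall>j<length xs. j < sum_list (take j xs) + k)"

lemma lukasiewicz_0: "lukasiewicz 0 xs \<longleftrightarrow> xs = []"
  by (cases xs) (auto simp: lukasiewicz_def)

lemma lukasiewicz_Nil: "lukasiewicz k [] \<longleftrightarrow> k = 0"
  by (auto simp: lukasiewicz_def)

lemma lukasiewicz_Cons: "lukasiewicz (Suc k) (x # xs) \<longleftrightarrow> lukasiewicz (k + x) xs"
proof -
  have "(\<forall>j<length (x # xs). j < sum_list (take j (x # xs)) + Suc k) \<longleftrightarrow>
      (\<forall>j<length xs. j < sum_list (take j xs) + (k + x))"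
    by (auto simp: less_Suc_eq_0_disj)
  then show ?thesis unfolding lukasiewicz_def by auto
qed

text \<open>The first letter \<open>x\<close> is a root, and the first \<open>x\<close> trees coded
  by the remaining letters become its children. Even for a single tree the induction passes through
  forests, hence the general \<open>k\<close>.\<close>

lemma lukasiewicz_imp_forest_word:
  "lukasiewicz k xs \<Longrightarrow> \<exists>ts. length ts = k \<and> forest_word ts = xs"
proof (induction xs arbitrary: k)
  case Nil
  then show ?case by (simp add: lukasiewicz_Nil)
next
  case (Cons x xs)
  then obtain k' where k: "k = Suc k'"
    by (cases k) (auto simp: lukasiewicz_0)
  then have "lukasiewicz (k' + x) xs" using Cons.prems by (simp add: lukasiewicz_Cons)
  then obtain ts where ts: "length ts = k' + x" "forest_word ts = xs" using Cons.IH by blast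
  have "forest_word (Node (take x ts) # drop x ts) = x # forest_word (take x ts @ drop x ts)"
    using ts(1) by (simp del: append_take_drop_id)
  then show ?case using ts k by (intro exI[of _ "Node (take x ts) # drop x ts"]) simp
qed

text \<open>Deleting the first root and releasing its children into the forest shortens the word by
  one letter. As the new forest is not a part of the old one, the induction is on the length of the
  word.\<close>

lemma lukasiewicz_forest_word: "lukasiewicz (length ts) (forest_word ts)"
proof (induction "length (forest_word ts)" arbitrary: ts rule: less_induct)
  case less
  show ?case
  proof (cases ts)
    case Nil
    then show ?thesis by (simp add: lukasiewicz_Nil)
  next
    case (Cons t us)
    obtain as where t: "t = Node as" by (cases t)
    have w: "forest_word ts = length as # forest_word (as @ us)" by (simp add: Cons t)
    then have "lukasiewicz (length (as @ us)) (forest_word (as @ us))"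
      by (intro less) simp
    then show ?thesis unfolding w using Cons by (simp add: lukasiewicz_Cons add.commute)
  qed
qed

lemma forest_word_inject:
  "length ts = length us \<Longrightarrow> forest_word ts = forest_word us \<Longrightarrow> ts = us"
proof (induction "length (forest_word ts)" arbitrary: ts us rule: less_induct)
  case less
  show ?case
  proof (cases ts)
    case Nil
    then show ?thesis using less by simp
  next
    case (Cons t ts')
    then obtain u us' where us: "us = u # us'" using less.prems by (cases us) auto
    obtain as bs where t: "t = Node as" "u = Node bs" by (cases t; cases u)
    have w: "forest_word ts = length as # forest_word (as @ ts')"
        "forest_word us = length bs # forest_word (bs @ us')" by (simp_all add: Cons us t)
    then have *: "length as = length bs" "forest_word (as @ ts') = forest_word (bs @ us')"
      using less.prems by auto
    have "as @ ts' = bs @ us'"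
    proof (rule less.hyps)
      show "length (forest_word (as @ ts')) < length (forest_word ts)" using w by simp
      show "length (as @ ts') = length (bs @ us')" using * less.prems Cons us by simp
    qed (rule *)
    then show ?thesis using *(1) Cons us t by simp
  qed
qed

lemma inj_outdegrees: "inj outdegrees"
  using forest_word_inject[of "[_]" "[_]"] by (auto simp: inj_def)

lemma range_outdegrees: "range outdegrees = {xs. lukasiewicz 1 xs}"
proof (intro equalityI subsetI)
  fix xs assume "xs \<in> range outdegrees"
  then show "xs \<in> {xs. lukasiewicz 1 xs}" using lukasiewicz_forest_word[of "[_]"] by auto
next
  fix xs assume "xs \<in> {xs. lukasiewicz 1 xs}"
  then obtain ts where "length ts = 1" "forest_word ts = xs"
    using lukasiewicz_imp_forest_word by blast
  then show "xs \<in> range outdegrees" by (cases ts) auto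
qed

text \<open>A rotation of a bridge from \<open>0\<close> to \<open>-1\<close> is a first passage path iff it starts at the first
  minimum of the walk.\<close>

definition walk :: "nat list \<Rightarrow> nat \<Rightarrow> int" where
  "walk xs j = int (sum_list (take j xs)) - int j"

lemma lukasiewicz_rotate_iff:
  assumes len: "length xs = n" and sum: "Suc (sum_list xs) = n" and k: "k < n"
  shows "lukasiewicz 1 (rotate k xs) \<longleftrightarrow>
    (\<forall>i<n. walk xs k \<le> walk xs i) \<and> (\<forall>i<k. walk xs k < walk xs i)"
proof -
  have rot: "rotate k xs = drop k xs @ take k xs"
    using k len by (simp add: rotate_drop_take)
  have total: "sum_list (take k xs) + sum_list (drop k xs) = sum_list xs"
    by (metis append_take_drop_id sum_list_append)
  have low: "int (sum_list (take j (rotate k xs))) - int j = walk xs (k + j) - walk xs k" if "j \<le> n - k" for j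
  proof -
    have "take (k + j) xs = take k xs @ take j (drop k xs)" by (simp add: take_add)
    then show ?thesis using that len by (simp add: rot walk_def)
  qed
  \<comment> \<open>Past the end of \<open>xs\<close> the walk has completed a full period and lost
    1 in total. This unit turns the weak inequality into a strict one for the indices before
    \<open>k\<close>.\<close>
  have high: "int (sum_list (take (n - k + i) (rotate k xs))) - int (n - k + i) = walk xs i - walk xs k - 1"
    if "i \<le> k" for i
    using that len total sum k by (simp add: rot walk_def min_def)
  have "lukasiewicz 1 (rotate k xs) \<longleftrightarrow> (\<forall>j<n. 0 \<le> int (sum_list (take j (rotate k xs))) - int j)"
  proof -
    have "length (rotate k xs) = n" "sum_list (rotate k xs) + 1 = n"
      using len sum total by (simp_all add: rot)
    then show ?thesis unfolding lukasiewicz_def by (simp add: less_Suc_eq_le)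
  qed
  also have "\<dots> \<longleftrightarrow> (\<forall>i<n. walk xs k \<le> walk xs i) \<and> (\<forall>i<k. walk xs k < walk xs i)"
  proof safe
    fix i assume *: "\<forall>j<n. 0 \<le> int (sum_list (take j (rotate k xs))) - int j"
    {
      assume "i < k"
      then have "n - k + i < n" using k by simp
      then show "walk xs k < walk xs i" using high[of i] * \<open>i < k\<close> by force
    } note lt = this
    assume "i < n"
    show "walk xs k \<le> walk xs i"
    proof (cases "i < k")
      case False
      then show ?thesis using low[of "i - k"] *[rule_format, of "i - k"] \<open>i < n\<close> by auto
    qed (use lt in auto)
  next
    fix j assume *: "\<forall>i<n. walk xs k \<le> walk xs i" "\<forall>i<k. walk xs k < walk xs i" "j < n"
    show "0 \<le> int (sum_list (take j (rotate k xs))) - int j"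
    proof (cases "j < n - k")
      case True
      then show ?thesis using low[of j] *(1) by auto
    next
      case False
      then have "j = n - k + (j - (n - k))" "j - (n - k) < k" using \<open>j < n\<close> by auto
      then show ?thesis using high[of "j - (n - k)"] *(2)[rule_format, of "j - (n - k)"] by auto
    qed
  qed
  finally show ?thesis .
qed

lemma cycle_lemma:
  assumes len: "length xs = n" and "n \<ge> 1"
  shows "(\<exists>k<n. lukasiewicz 1 (rotate k xs)) \<longleftrightarrow> Suc (sum_list xs) = n"
proof
  assume "\<exists>k<n. lukasiewicz 1 (rotate k xs)"
  then obtain k where "k < n" "lukasiewicz 1 (rotate k xs)" by auto
  then have "sum_list (rotate k xs) + 1 = n" using len by (simp add: lukasiewicz_def)
  moreover have "sum_list (rotate k xs) = sum_list xs"
    using \<open>k < n\<close> len by (simp add: rotate_drop_take) (metis add.commute append_take_drop_id sum_list_append)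
  ultimately show "Suc (sum_list xs) = n" by simp
next
  assume sum: "Suc (sum_list xs) = n"
  define m where "m = Min (walk xs ` {..<n})"
  have fin: "finite (walk xs ` {..<n})" "walk xs ` {..<n} \<noteq> {}" using \<open>n \<ge> 1\<close> by (auto simp: lessThan_empty_iff)
  have "m \<in> walk xs ` {..<n}" unfolding m_def using fin by (rule Min_in)
  then have ex: "\<exists>k. k < n \<and> walk xs k = m" by auto
  \<comment> \<open>The minimum may be attained several times; the strict inequalities before
    \<open>k\<close> select its first occurrence.\<close>
  define k where "k = (LEAST k. k < n \<and> walk xs k = m)"
  have k: "k < n" "walk xs k = m" using LeastI_ex[OF ex] unfolding k_def by auto
  have min: "m \<le> walk xs i" if "i < n" for i unfolding m_def using that fin by simp
  have "m \<noteq> walk xs i" if "i < k" for i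
    using not_less_Least[of i "\<lambda>k. k < n \<and> walk xs k = m"] that k(1) unfolding k_def by auto
  then have "\<forall>i<k. walk xs k < walk xs i" using min k by (metis less_le less_trans)
  then show "\<exists>k<n. lukasiewicz 1 (rotate k xs)"
    using lukasiewicz_rotate_iff[OF len sum k(1)] k min by auto
qed

lemma cycle_lemma_unique:
  assumes len: "length xs = n" and jk: "j < n" "k < n"
    "lukasiewicz 1 (rotate j xs)" "lukasiewicz 1 (rotate k xs)"
  shows "j = k"
proof -
  have sum: "Suc (sum_list xs) = n" using cycle_lemma[OF len] jk by auto
  note iff = lukasiewicz_rotate_iff[OF len sum]
  show ?thesis
    using iff[OF jk(1)] iff[OF jk(2)] jk by (metis linorder_neqE_nat not_less)
qed

text \<open>Kemperman's formula: exactly one of the \<open>n\<close> rotations of a word with sum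
  \<open>n - 1\<close> codes a tree. Invariance of \<open>A\<close> lets the constraint pass from a
  word to that rotation.\<close>

lemma prob_lukasiewicz:
  assumes "n \<ge> 1" and A: "\<And>k xs. rotate k xs \<in> A \<longleftrightarrow> xs \<in> A"
  shows "n * measure_pmf.prob (replicate_pmf n p) {xs. lukasiewicz 1 xs \<and> xs \<in> A} =
     measure_pmf.prob (replicate_pmf n p) {xs. Suc (sum_list xs) = n \<and> xs \<in> A}"
proof -
  let ?E = "{xs. lukasiewicz 1 xs \<and> xs \<in> A}"
  have "n * measure_pmf.prob (replicate_pmf n p) ?E =
      measure_pmf.prob (replicate_pmf n p) {xs. \<exists>k<n. rotate k xs \<in> ?E}"
    by (rule prob_ex_rotate_eq[symmetric]) (auto intro: cycle_lemma_unique)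
  also have "\<dots> = measure_pmf.prob (replicate_pmf n p) {xs. Suc (sum_list xs) = n \<and> xs \<in> A}"
  proof (rule measure_pmf.finite_measure_eq_AE)
    show "AE xs in replicate_pmf n p. (xs \<in> {xs. \<exists>k<n. rotate k xs \<in> ?E}) =
        (xs \<in> {xs. Suc (sum_list xs) = n \<and> xs \<in> A})"
      using cycle_lemma[OF _ \<open>n \<ge> 1\<close>] A by (auto simp: AE_measure_pmf_iff set_replicate_pmf)
  qed auto
  finally show ?thesis .
qed

text \<open>A tree is determined by its word, and its weight is the probability of that word among
  words of its length; so the law of the tree is transported without any multiplicity.\<close>

lemma emeasure_BGW_num_vertices:
  "emeasure (BGW \<mu>) {\<tau>. num_vertices \<tau> = n \<and> outdegrees \<tau> \<in> A} =
     emeasure (replicate_pmf n \<mu>) {xs. lukasiewicz 1 xs \<and> xs \<in> A}"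
proof -
  have "emeasure (BGW \<mu>) {\<tau>. num_vertices \<tau> = n \<and> outdegrees \<tau> \<in> A} =
      (\<integral>\<^sup>+\<tau>. ennreal (prod_list (map (pmf \<mu>) (outdegrees \<tau>))) *
        indicator {\<tau>. num_vertices \<tau> = n \<and> outdegrees \<tau> \<in> A} \<tau> \<partial>count_space UNIV)"
    unfolding BGW_def by (subst emeasure_density) auto
  also have "\<dots> = (\<integral>\<^sup>+\<tau>. ennreal (pmf (replicate_pmf n \<mu>) (outdegrees \<tau>)) * indicator A (outdegrees \<tau>) \<partial>count_space UNIV)"
    by (intro nn_integral_cong) (auto simp: pmf_replicate_pmf num_vertices_def indicator_def)
  also have "\<dots> = (\<integral>\<^sup>+xs. ennreal (pmf (replicate_pmf n \<mu>) xs) * indicator A xs \<partial>count_space (range outdegrees))"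
    by (intro nn_integral_bij_count_space inj_on_imp_bij_betw inj_outdegrees)
  also have "\<dots> = (\<integral>\<^sup>+xs. ennreal (pmf (replicate_pmf n \<mu>) xs) * indicator A xs * indicator (range outdegrees) xs \<partial>count_space UNIV)"
    by (simp add: nn_integral_count_space_indicator)
  also have "\<dots> = (\<integral>\<^sup>+xs. indicator {xs. lukasiewicz 1 xs \<and> xs \<in> A} xs \<partial>replicate_pmf n \<mu>)"
    unfolding nn_integral_measure_pmf range_outdegrees
    by (intro nn_integral_cong) (auto simp: indicator_def)
  also have "\<dots> = emeasure (replicate_pmf n \<mu>) {xs. lukasiewicz 1 xs \<and> xs \<in> A}" by simp
  finally show ?thesis .
qed

lemma sets_BGW [simp]: "sets (BGW \<mu>) = UNIV" and space_BGW [simp]: "space (BGW \<mu>) = UNIV"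
  by (simp_all add: BGW_def)

lemma sets_conditioned_BGW [simp]: "sets (conditioned_BGW \<mu> n) = UNIV"
  and space_conditioned_BGW [simp]: "space (conditioned_BGW \<mu> n) = UNIV"
  by (simp_all add: conditioned_BGW_def)

text \<open>The factor \<open>n\<close> of the cycle lemma appears in numerator and denominator and
  cancels. Events about the ordered degrees are rotation invariant, so for them the conditioned tree
  may be replaced by a conditioned word of independent letters.\<close>

lemma conditioned_BGW_eq:
  assumes "n \<ge> 1" and A: "\<And>k xs. rotate k xs \<in> A \<longleftrightarrow> xs \<in> A"
    and pos: "measure_pmf.prob (replicate_pmf n \<mu>) {xs. Suc (sum_list xs) = n} > 0"
  shows "measure (conditioned_BGW \<mu> n) {\<tau>. outdegrees \<tau> \<in> A} =
     measure_pmf.prob (replicate_pmf n \<mu>) {xs. Suc (sum_list xs) = n \<and> xs \<in> A} /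
     measure_pmf.prob (replicate_pmf n \<mu>) {xs. Suc (sum_list xs) = n}"
    and "prob_space (conditioned_BGW \<mu> n)"
proof -
  let ?P = "measure_pmf.prob (replicate_pmf n \<mu>)"
  have l: "real n * ?P {xs. lukasiewicz 1 xs} = ?P {xs. Suc (sum_list xs) = n}"
    using prob_lukasiewicz[OF \<open>n \<ge> 1\<close>, of UNIV \<mu>] by simp
  then have lpos: "?P {xs. lukasiewicz 1 xs} > 0" using pos \<open>n \<ge> 1\<close>
    by (metis less_le measure_nonneg mult_zero_right)
  have E: "emeasure (BGW \<mu>) {\<tau>. num_vertices \<tau> = n} = ennreal (?P {xs. lukasiewicz 1 xs})"
    using emeasure_BGW_num_vertices[of \<mu> n UNIV] by (simp add: measure_pmf.emeasure_eq_measure)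
  have "emeasure (conditioned_BGW \<mu> n) {\<tau>. outdegrees \<tau> \<in> A} =
      emeasure (BGW \<mu>) ({\<tau>. num_vertices \<tau> = n} \<inter> {\<tau>. outdegrees \<tau> \<in> A}) / emeasure (BGW \<mu>) {\<tau>. num_vertices \<tau> = n}"
    unfolding conditioned_BGW_def by (subst emeasure_uniform_measure) auto
  also have "{\<tau>. num_vertices \<tau> = n} \<inter> {\<tau>. outdegrees \<tau> \<in> A} = {\<tau>. num_vertices \<tau> = n \<and> outdegrees \<tau> \<in> A}" by auto
  finally have "emeasure (conditioned_BGW \<mu> n) {\<tau>. outdegrees \<tau> \<in> A} =
      ennreal (?P {xs. lukasiewicz 1 xs \<and> xs \<in> A} / ?P {xs. lukasiewicz 1 xs})"
    using lpos unfolding E emeasure_BGW_num_vertices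
    by (simp add: measure_pmf.emeasure_eq_measure divide_ennreal)
  then have "measure (conditioned_BGW \<mu> n) {\<tau>. outdegrees \<tau> \<in> A} =
      ?P {xs. lukasiewicz 1 xs \<and> xs \<in> A} / ?P {xs. lukasiewicz 1 xs}"
    by (simp add: measure_def)
  also have "\<dots> = (real n * ?P {xs. lukasiewicz 1 xs \<and> xs \<in> A}) / (real n * ?P {xs. lukasiewicz 1 xs})"
    using \<open>n \<ge> 1\<close> by simp
  finally show "measure (conditioned_BGW \<mu> n) {\<tau>. outdegrees \<tau> \<in> A} =
     ?P {xs. Suc (sum_list xs) = n \<and> xs \<in> A} / ?P {xs. Suc (sum_list xs) = n}"
    unfolding l prob_lukasiewicz[OF \<open>n \<ge> 1\<close> A] .
  show "prob_space (conditioned_BGW \<mu> n)"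
    unfolding conditioned_BGW_def by (rule prob_space_uniform_measure) (use E lpos in auto)
qed


section \<open>The scaling constants\<close>

lemma tendsto_eventually_eq:
  "(f \<longlongrightarrow> l) F \<Longrightarrow> \<forall>\<^sub>F x in F. f x = g x \<Longrightarrow> l = l' \<Longrightarrow> (g \<longlongrightarrow> l') F"
  by (auto intro: Lim_transform_eventually)

lemma exp_power_divide_exp: "exp u ^ m / exp s = exp (real m * u - s :: real)"
  by (simp add: exp_of_nat_mult exp_diff)

lemma sqrt_divide_mult:
  assumes "x > 0" "y > (0 :: real)"
  shows "sqrt (y / x) * (x / y) = sqrt (x / y)"
proof -
  have "x / y = sqrt (x / y) * sqrt (x / y)" using assms by simp
  moreover have "sqrt (y / x) * sqrt (x / y) = 1"
    using assms by (simp add: real_sqrt_mult[symmetric])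
  ultimately show ?thesis by (metis mult.assoc mult_1)
qed

locale cauchy_scaling = critical_cauchy +
  fixes a :: "nat \<Rightarrow> real"
  assumes tail_a: "(\<lambda>n. real n * tail (a n + 1)) \<longlonglongrightarrow> 1"
begin

text \<open>The shift by 1 translates the bound \<open>a n\<close> on the step into a bound on the
  number of children.\<close>

definition B :: "nat \<Rightarrow> real" where "B n = real n * excess (a n + 1)"

lemma tail_pos: "tail x > 0"
proof -
  obtain x0 where x0: "x0 \<ge> 2" "\<And>x. x \<ge> x0 \<Longrightarrow> L x > 0"
    "\<And>k. x0 \<le> real k \<Longrightarrow> L k / (real k)\<^sup>2 \<le> 2 * pmf \<mu> k"
    using regular_constants by metis
  define k where "k = nat \<lceil>max x x0\<rceil>"
  have k: "real k \<ge> x" "real k \<ge> x0" by (auto simp: k_def) linarith+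
  have "0 < L k / (real k)\<^sup>2" using k x0 by auto
  also have "\<dots> \<le> 2 * pmf \<mu> k" using x0 k by auto
  finally have "0 < pmf \<mu> k" by simp
  also have "pmf \<mu> k = measure_pmf.prob \<mu> {k}" by (simp add: measure_pmf_single)
  also have "\<dots> \<le> tail x" unfolding tail_def
    using k by (intro measure_pmf.finite_measure_mono) auto
  finally show ?thesis .
qed

lemma tail_antimono: "x \<le> y \<Longrightarrow> tail y \<le> tail x"
  unfolding tail_def by (intro measure_pmf.finite_measure_mono) auto

text \<open>Were \<open>a n\<close> below a fixed level, \<open>n * tail (a n + 1)\<close> would be
  at least \<open>n\<close> times a positive constant and could not stay near 1.\<close>

lemma a_at_top: "filterlim a at_top sequentially"
  unfolding filterlim_at_top
proof
  fix Z :: real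
  have "filterlim (\<lambda>n. tail (Z + 1) * real n) at_top sequentially"
    by (rule filterlim_tendsto_pos_mult_at_top[OF tendsto_const tail_pos filterlim_real_sequentially])
  then have "\<forall>\<^sub>F n in sequentially. tail (Z + 1) * real n \<ge> 2"
    by (simp add: filterlim_at_top)
  moreover have "\<forall>\<^sub>F n in sequentially. real n * tail (a n + 1) < 2"
    using order_tendstoD(2)[OF tail_a] by simp
  ultimately show "\<forall>\<^sub>F n in sequentially. Z \<le> a n"
  proof eventually_elim
    case (elim n)
    show ?case
    proof (rule ccontr)
      assume "\<not> Z \<le> a n"
      then have "tail (Z + 1) \<le> tail (a n + 1)" by (intro tail_antimono) auto
      then have "real n * tail (Z + 1) \<le> real n * tail (a n + 1)" by (intro mult_left_mono) auto
      then show False using elim by (simp add: mult.commute)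
    qed
  qed
qed

lemma a1_at_top: "filterlim (\<lambda>n. a n + 1) at_top sequentially"
  using filterlim_tendsto_add_at_top[OF tendsto_const[of 1] a_at_top] by (simp add: add.commute)

lemma a_ratio: "(\<lambda>n. (a n + 1) / a n) \<longlonglongrightarrow> 1"
proof -
  have "(\<lambda>n. 1 + inverse (a n)) \<longlonglongrightarrow> 1 + 0"
    by (intro tendsto_add tendsto_const tendsto_inverse_0_at_top a_at_top)
  then show ?thesis
  proof (rule tendsto_eventually_eq)
    show "\<forall>\<^sub>F n in sequentially. 1 + inverse (a n) = (a n + 1) / a n"
      using filterlim_at_top_dense[THEN iffD1, OF a_at_top, rule_format, of 0]
      by eventually_elim (simp add: field_simps)
  qed simp
qed

lemma nL_a: "(\<lambda>n. real n * L (a n + 1) / (a n + 1)) \<longlonglongrightarrow> 1"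
proof -
  have "(\<lambda>n. real n * tail (a n + 1) / (tail (a n + 1) * (a n + 1) / L (a n + 1))) \<longlonglongrightarrow> 1 / 1"
    by (intro tendsto_divide tail_a filterlim_compose[OF tail_asymp a1_at_top]) auto
  then show ?thesis using tail_pos by (simp add: less_imp_neq[symmetric])
qed

lemma eventually_L_a_pos: "\<forall>\<^sub>F n in sequentially. L (a n + 1) > 0"
  using slowly_varying_pos[OF slowly_varying] a1_at_top by (rule eventually_compose_filterlim)

lemma eventually_a_gt: "\<forall>\<^sub>F n in sequentially. c < a n"
  using a_at_top by (simp add: filterlim_at_top_dense)

text \<open>The dilation by \<open>x\<close> is slow variation itself, while the shift by 1 is a
  dilation by a factor depending on \<open>n\<close> and therefore calls for uniform
  convergence.\<close>

lemma L_ratio_a: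
  assumes "x > 0"
  shows "(\<lambda>n. L (x * a n) / L (a n + 1)) \<longlonglongrightarrow> 1"
proof -
  have 1: "(\<lambda>n. L (x * a n) / L (a n)) \<longlonglongrightarrow> 1"
    using filterlim_compose[OF _ a_at_top, of "\<lambda>y. L (x * y) / L y"] assms slowly_varying
    by (auto simp: slowly_varying_def)
  have 2: "(\<lambda>n. L (a n + 1) / L (a n)) \<longlonglongrightarrow> 1"
  proof (rule tendstoI)
    fix e :: real assume "e > 0"
    have "\<forall>\<^sub>F n in sequentially. \<forall>y\<in>{a n / 2..2 * a n}. \<bar>L y / L (a n) - 1\<bar> < e"
      by (rule eventually_compose_filterlim[OF slowly_varying_uniform_ratio[OF slowly_varying _ \<open>e > 0\<close>] a_at_top]) simp
    then show "\<forall>\<^sub>F n in sequentially. dist (L (a n + 1) / L (a n)) 1 < e"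
      using eventually_a_gt[of 1] by eventually_elim (auto simp: dist_real_def)
  qed
  have "(\<lambda>n. (L (x * a n) / L (a n)) / (L (a n + 1) / L (a n))) \<longlonglongrightarrow> 1 / 1"
    by (intro tendsto_divide 1 2) auto
  then show ?thesis
  proof (rule tendsto_eventually_eq)
    have "\<forall>\<^sub>F n in sequentially. L (a n) > 0"
      using slowly_varying_pos[OF slowly_varying] a_at_top by (rule eventually_compose_filterlim)
    then show "\<forall>\<^sub>F n in sequentially. (L (x * a n) / L (a n)) / (L (a n + 1) / L (a n)) = L (x * a n) / L (a n + 1)"
      by eventually_elim simp
  qed simp
qed

lemma mult_at_top: "filterlim f at_top F \<Longrightarrow> c > 0 \<Longrightarrow> filterlim (\<lambda>x. c * f x :: real) at_top F"
  by (rule filterlim_tendsto_pos_mult_at_top[OF tendsto_const])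

text \<open>The mean number of letters above \<open>x * a n\<close> among \<open>n\<close> letters
  converges to the mass of the half-line above \<open>x\<close> under the intensity of the
  limit.\<close>

lemma tail_scaled:
  assumes "x > 0"
  shows "(\<lambda>n. real n * tail (x * a n)) \<longlonglongrightarrow> 1 / x"
proof -
  have "(\<lambda>n. (tail (x * a n) * (x * a n) / L (x * a n)) * (real n * L (a n + 1) / (a n + 1)) *
      (L (x * a n) / L (a n + 1)) * ((a n + 1) / a n) / x) \<longlonglongrightarrow> 1 * 1 * 1 * 1 / x"
    using assms by (intro tendsto_intros nL_a L_ratio_a a_ratio
        filterlim_compose[OF tail_asymp mult_at_top[OF a_at_top]]) auto
  then show ?thesis
  proof (rule tendsto_eventually_eq)
    have "\<forall>\<^sub>F n in sequentially. L (x * a n) > 0"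
      using slowly_varying_pos[OF slowly_varying] mult_at_top[OF a_at_top assms]
      by (rule eventually_compose_filterlim)
    then show "\<forall>\<^sub>F n in sequentially. (tail (x * a n) * (x * a n) / L (x * a n)) * (real n * L (a n + 1) / (a n + 1)) *
      (L (x * a n) / L (a n + 1)) * ((a n + 1) / a n) / x = real n * tail (x * a n)"
      using eventually_L_a_pos eventually_a_gt[of 0]
    proof eventually_elim
      case (elim n)
      then have "a n + 1 > 0" by simp
      then show ?case using elim assms by (simp add: divide_simps)
    qed
  qed simp
qed

text \<open>The quotient factors into \<open>n * L (a n + 1) / (a n + 1)\<close>, which tends to 1,
  and the divergent ratio of \<open>excess\<close> to \<open>L\<close>.\<close>

lemma B_ratio_at_top: "filterlim (\<lambda>n. B n / (a n + 1)) at_top sequentially"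
proof -
  have "filterlim (\<lambda>n. (real n * L (a n + 1) / (a n + 1)) * (excess (a n + 1) / L (a n + 1))) at_top sequentially"
    by (rule filterlim_tendsto_pos_mult_at_top[OF nL_a _ filterlim_compose[OF excess_ratio_at_top a1_at_top]]) simp
  then show ?thesis
  proof (rule filterlim_mono_eventually)
    show "\<forall>\<^sub>F n in sequentially. (real n * L (a n + 1) / (a n + 1)) * (excess (a n + 1) / L (a n + 1)) = B n / (a n + 1)"
      using eventually_L_a_pos by eventually_elim (simp add: B_def)
  qed auto
qed

lemma eventually_B_ge: "\<forall>\<^sub>F n in sequentially. a n + 1 \<le> B n"
  using filterlim_at_top[THEN iffD1, OF B_ratio_at_top, rule_format, of 1] eventually_a_gt[of 0]
  by eventually_elim (auto simp: field_simps)

lemma B_at_top: "filterlim B at_top sequentially"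
  using eventually_B_ge by (rule filterlim_at_top_mono[OF a1_at_top])

lemma eventually_B_gt: "\<forall>\<^sub>F n in sequentially. c < B n"
  using B_at_top by (simp add: filterlim_at_top_dense)

lemma eventually_L_B_pos: "\<forall>\<^sub>F n in sequentially. L (B n) > 0"
  using slowly_varying_pos[OF slowly_varying] B_at_top by (rule eventually_compose_filterlim)

lemma a_over_B: "(\<lambda>n. (a n + 1) / B n) \<longlonglongrightarrow> 0"
  using tendsto_inverse_0_at_top[OF B_ratio_at_top] by simp

lemma sqrt_a_over_B: "(\<lambda>n. sqrt ((a n + 1) / B n)) \<longlonglongrightarrow> 0"
  using tendsto_real_sqrt[OF a_over_B] by simp

text \<open>The drift is asymptotically the same for truncation at \<open>B n\<close> as for
  truncation at \<open>a n + 1\<close>: relative to \<open>B n\<close>, the difference is bounded by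
  a multiple of \<open>sqrt ((a n + 1) / B n)\<close>. The exponential bounds at scale
  \<open>B n\<close> are thus centred correctly.\<close>

lemma excess_B: "(\<lambda>n. real n * excess (B n) / B n) \<longlonglongrightarrow> 1"
proof -
  have "(\<lambda>n. 1 - real n * excess (B n) / B n) \<longlonglongrightarrow> 0"
  proof (rule tendsto_sandwich[OF _ _ tendsto_const])
    show "\<forall>\<^sub>F n in sequentially. 0 \<le> 1 - real n * excess (B n) / B n"
      using eventually_B_ge eventually_a_gt[of 0] eventually_gt_at_top[of 0]
    proof eventually_elim
      case (elim n)
      then have "excess (B n) \<le> excess (a n + 1)" by (intro excess_antimono) auto
      then have "real n * excess (B n) \<le> B n" unfolding B_def by (intro mult_left_mono) auto
      then show ?case using elim by simp
    qed
    show "\<forall>\<^sub>F n in sequentially. 1 - real n * excess (B n) / B n \<le>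
        8 * (real n * L (a n + 1) / (a n + 1)) * sqrt ((a n + 1) / B n)"
      using eventually_B_ge eventually_a_gt[of 0] eventually_gt_at_top[of 0]
        eventually_compose_filterlim[OF eventually_excess_diff_le a1_at_top]
    proof eventually_elim
      case (elim n)
      have p: "a n + 1 > 0" "B n > 0" using elim by auto
      have "excess (a n + 1) - excess (B n) \<le> 8 * L (a n + 1) * sqrt (B n / (a n + 1))" using elim by auto
      then have "real n * (excess (a n + 1) - excess (B n)) \<le> real n * (8 * L (a n + 1) * sqrt (B n / (a n + 1)))"
        by (rule mult_left_mono) simp
      then have "B n - real n * excess (B n) \<le> real n * (8 * L (a n + 1) * sqrt (B n / (a n + 1)))"
        by (simp add: B_def right_diff_distrib)
      then have "(B n - real n * excess (B n)) / B n \<le> real n * (8 * L (a n + 1) * sqrt (B n / (a n + 1))) / B n"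
        using p by (intro divide_right_mono) auto
      also have "\<dots> = 8 * (real n * L (a n + 1) / (a n + 1)) * ((sqrt (B n / (a n + 1))) * ((a n + 1) / B n))"
        using p by simp
      also have "sqrt (B n / (a n + 1)) * ((a n + 1) / B n) = sqrt ((a n + 1) / B n)"
        using p by (intro sqrt_divide_mult) auto
      finally show ?case using p by (simp add: diff_divide_distrib)
    qed
    show "(\<lambda>n. 8 * (real n * L (a n + 1) / (a n + 1)) * sqrt ((a n + 1) / B n)) \<longlonglongrightarrow> 0"
      by (rule tendsto_eq_intros nL_a sqrt_a_over_B | simp)+
  qed
  then have "(\<lambda>n. 1 - (1 - real n * excess (B n) / B n)) \<longlonglongrightarrow> 1 - 0"
    by (intro tendsto_diff tendsto_const)
  then show ?thesis by simp
qed

text \<open>Potter's bound compares the level \<open>B n\<close> with the level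
  \<open>a n + 1\<close>, where the same expression tends to 1, and gains the square root of their
  ratio.\<close>

lemma nL_B: "(\<lambda>n. real n * L (B n) / B n) \<longlonglongrightarrow> 0"
proof -
  obtain x0 where x0: "x0 \<ge> 2" "\<And>x. x \<ge> x0 \<Longrightarrow> L x > 0"
    "\<And>x y. x0 \<le> x \<Longrightarrow> x \<le> y \<Longrightarrow> L y \<le> 2 * L x * sqrt (y / x)"
    using regular_constants by metis
  show ?thesis
  proof (rule tendsto_sandwich[OF _ _ tendsto_const])
    show "\<forall>\<^sub>F n in sequentially. 0 \<le> real n * L (B n) / B n"
      using eventually_L_B_pos eventually_B_gt[of 0] by eventually_elim simp
    show "\<forall>\<^sub>F n in sequentially. real n * L (B n) / B n \<le>
        2 * (real n * L (a n + 1) / (a n + 1)) * sqrt ((a n + 1) / B n)"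
      using eventually_B_ge eventually_a_gt[of x0]
    proof eventually_elim
      case (elim n)
      have p: "a n + 1 > 0" "B n > 0" using elim x0 by auto
      have "L (B n) \<le> 2 * L (a n + 1) * sqrt (B n / (a n + 1))" using elim x0 by auto
      then have "real n * L (B n) / B n \<le> real n * (2 * L (a n + 1) * sqrt (B n / (a n + 1))) / B n"
        using p by (intro divide_right_mono mult_left_mono) auto
      also have "\<dots> = 2 * (real n * L (a n + 1) / (a n + 1)) * ((sqrt (B n / (a n + 1))) * ((a n + 1) / B n))"
        using p by simp
      also have "sqrt (B n / (a n + 1)) * ((a n + 1) / B n) = sqrt ((a n + 1) / B n)"
        using p by (intro sqrt_divide_mult) auto
      finally show ?case .
    qed
    show "(\<lambda>n. 2 * (real n * L (a n + 1) / (a n + 1)) * sqrt ((a n + 1) / B n)) \<longlonglongrightarrow> 0"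
      by (rule tendsto_eq_intros nL_a sqrt_a_over_B | simp)+
  qed
qed

lemma nV_B: "(\<lambda>n. real n * trunc_var (B n) / (B n)\<^sup>2) \<longlonglongrightarrow> 0"
proof (rule tendsto_sandwich[OF _ _ tendsto_const])
  show "\<forall>\<^sub>F n in sequentially. 0 \<le> real n * trunc_var (B n) / (B n)\<^sup>2"
    by (simp add: trunc_var_nonneg)
  show "\<forall>\<^sub>F n in sequentially. real n * trunc_var (B n) / (B n)\<^sup>2 \<le> 9 * (real n * L (B n) / B n)"
    using eventually_compose_filterlim[OF eventually_trunc_var_le B_at_top] eventually_B_gt[of 0]
  proof eventually_elim
    case (elim n)
    then have "real n * trunc_var (B n) / (B n)\<^sup>2 \<le> real n * (9 * (B n * L (B n))) / (B n)\<^sup>2"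
      by (intro divide_right_mono mult_left_mono) auto
    also have "\<dots> = 9 * (real n * L (B n) / B n)" using elim by (simp add: power2_eq_square)
    finally show ?case .
  qed
  show "(\<lambda>n. 9 * (real n * L (B n) / B n)) \<longlonglongrightarrow> 0"
    using tendsto_mult[OF tendsto_const[of 9] nL_B] by simp
qed

text \<open>Among \<open>n\<close> unconditioned letters, one of order \<open>B n\<close> is already
  improbable. Hence truncation at \<open>B n\<close> costs nothing in the limit and a second big
  jump can be excluded.\<close>

lemma tail_B:
  assumes "c > 0"
  shows "(\<lambda>n. real n * tail (c * B n)) \<longlonglongrightarrow> 0"
proof -
  have 1: "(\<lambda>n. L (c * B n) / L (B n)) \<longlonglongrightarrow> 1"
    using filterlim_compose[OF _ B_at_top, of "\<lambda>y. L (c * y) / L y"] assms slowly_varying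
    by (auto simp: slowly_varying_def)
  have "(\<lambda>n. (tail (c * B n) * (c * B n) / L (c * B n)) * (real n * L (B n) / B n) *
      (L (c * B n) / L (B n)) / c) \<longlonglongrightarrow> 1 * 0 * 1 / c"
    using assms by (intro tendsto_intros nL_B 1
        filterlim_compose[OF tail_asymp mult_at_top[OF B_at_top]]) auto
  then show ?thesis
  proof (rule tendsto_eventually_eq)
    have "\<forall>\<^sub>F n in sequentially. L (c * B n) > 0"
      using slowly_varying_pos[OF slowly_varying] mult_at_top[OF B_at_top assms]
      by (rule eventually_compose_filterlim)
    then show "\<forall>\<^sub>F n in sequentially. (tail (c * B n) * (c * B n) / L (c * B n)) * (real n * L (B n) / B n) *
      (L (c * B n) / L (B n)) / c = real n * tail (c * B n)"
      using eventually_L_B_pos eventually_B_gt[of 0]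
    proof eventually_elim
      case (elim n)
      then show ?case using assms by (simp add: divide_simps)
    qed
  qed simp
qed

end

section \<open>Exponential bounds for sums of steps\<close>

context critical_cauchy
begin

lemma integrable_sq_trunc: "integrable \<mu> (\<lambda>k. (real k - 1)\<^sup>2 * indicator {k. real k \<le> y} k)"
proof (rule measure_pmf.integrable_const_bound[of _ "(\<bar>y\<bar> + 1)\<^sup>2"])
  show "AE k in \<mu>. norm ((real k - 1)\<^sup>2 * indicator {k. real k \<le> y} k) \<le> (\<bar>y\<bar> + 1)\<^sup>2"
  proof (rule AE_pmfI)
    fix k
    have "(real k - 1)\<^sup>2 \<le> (\<bar>y\<bar> + 1)\<^sup>2" if "real k \<le> y"
      using that by (intro abs_le_square_iff[THEN iffD1]) auto
    then show "norm ((real k - 1)\<^sup>2 * indicator {k. real k \<le> y} k) \<le> (\<bar>y\<bar> + 1)\<^sup>2"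
      by (auto simp: indicator_def)
  qed
qed simp

text \<open>Common core of the two tail bounds, with \<open>l\<close> of either sign: the quadratic
  majorant is expressed by the truncated mean, which is \<open>- excess y\<close>, and the truncated
  second moment, and then \<open>1 + x \<le> exp x\<close> is applied.\<close>

lemma expectation_quadratic_le:
  fixes g :: "nat \<Rightarrow> real"
  assumes g: "\<And>k. 0 \<le> g k"
    and le: "\<And>k. g k \<le> 1 + l * ((real k - 1) * indicator {k. real k \<le> y} k) +
      c * ((real k - 1)\<^sup>2 * indicator {k. real k \<le> y} k)"
  shows "measure_pmf.expectation \<mu> g \<le> exp (- l * excess y + c * trunc_var y)"
proof -
  let ?h = "\<lambda>k. 1 + l * ((real k - 1) * indicator {k. real k \<le> y} k) +
      c * ((real k - 1)\<^sup>2 * indicator {k. real k \<le> y} k)"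
  have int: "integrable \<mu> ?h"
    by (intro Bochner_Integration.integrable_add integrable_mult_right integrable_step_indicator integrable_sq_trunc) auto
  have "integrable \<mu> g"
    by (rule Bochner_Integration.integrable_bound[OF int])
       (use g le in \<open>auto intro!: AE_pmfI order_trans[OF le abs_ge_self]\<close>)
  then have "measure_pmf.expectation \<mu> g \<le> measure_pmf.expectation \<mu> ?h"
    by (rule integral_mono[OF _ int]) (rule le)
  also have "\<dots> = 1 + l * (- excess y) + c * trunc_var y"
    unfolding excess_eq[symmetric] trunc_var_def
    by (subst Bochner_Integration.integral_add Bochner_Integration.integral_mult_right_zero;
        (intro Bochner_Integration.integrable_add integrable_mult_right integrable_step_indicator integrable_sq_trunc)?; simp)+
  also have "\<dots> \<le> exp (- l * excess y + c * trunc_var y)"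
    using exp_ge_add_one_self[of "- l * excess y + c * trunc_var y"] by (simp only: algebra_simps)
  finally show ?thesis .
qed

abbreviation steps :: "nat list \<Rightarrow> real" where
  "steps xs \<equiv> (\<Sum>x\<leftarrow>xs. real x - 1)"

lemma steps_eq: "steps xs = real (sum_list xs) - real (length xs)"
  by (induction xs) auto

text \<open>Chernoff's bound for letters cut off at \<open>y\<close>. The parameter
  \<open>K / y\<close> is the natural one: it keeps the exponent of a single letter at most
  \<open>K\<close>, so that the quadratic bound for the exponential applies.\<close>

lemma prob_steps_ge:
  assumes "y \<ge> 1" "K \<ge> 0"
  shows "measure_pmf.prob (replicate_pmf m \<mu>) {xs. s \<le> steps xs \<and> (\<forall>x\<in>set xs. real x \<le> y)} \<le>
    exp (- (K / y * s) + real m * (- (K / y) * excess y + (K / y)\<^sup>2 * exp K * trunc_var y))"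
proof -
  define l where "l = K / y"
  have l: "l \<ge> 0" using assms by (simp add: l_def)
  define g where "g k = exp (l * (real k - 1)) * indicator {k. real k \<le> y} k" for k :: nat
  let ?E = "{xs. s \<le> steps xs \<and> (\<forall>x\<in>set xs. real x \<le> y)}"
  have lk: "l * (real k - 1) \<le> K" if "real k \<le> y" for k
  proof -
    have "l * (real k - 1) \<le> l * y" using that l by (intro mult_left_mono) auto
    then show ?thesis using assms by (simp add: l_def)
  qed
  have "measure_pmf.prob (replicate_pmf m \<mu>) ?E \<le> exp (- l * excess y + l\<^sup>2 * exp K * trunc_var y) ^ m / exp (l * s)"
  proof (rule prob_replicate_pmf_le_prod)
    show "g x \<ge> 0" for x by (simp add: g_def)
    show "g x \<le> exp K" for x using lk by (auto simp: g_def indicator_def)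
    show "measure_pmf.expectation \<mu> g \<le> exp (- l * excess y + l\<^sup>2 * exp K * trunc_var y)"
    proof (rule expectation_quadratic_le)
      fix k
      show "g k \<le> 1 + l * ((real k - 1) * indicator {k. real k \<le> y} k) +
        l\<^sup>2 * exp K * ((real k - 1)\<^sup>2 * indicator {k. real k \<le> y} k)"
        using exp_le_quadratic[OF lk, of k] assms
        by (auto simp: g_def indicator_def power_mult_distrib mult_ac)
    qed (simp add: g_def)
    fix xs assume "xs \<in> ?E"
    then have xs: "s \<le> steps xs" "\<forall>x\<in>set xs. real x \<le> y" by auto
    have "exp (l * s) \<le> exp (l * steps xs)" using xs l by (simp add: mult_left_mono)
    also have "\<dots> = prod_list (map g xs)"
      using xs(2) by (induction xs) (auto simp: g_def exp_add distrib_left)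
    finally show "exp (l * s) \<le> prod_list (map g xs)" .
  qed simp
  also have "\<dots> = exp (real m * (- l * excess y + l\<^sup>2 * exp K * trunc_var y) - l * s)"
    by (rule exp_power_divide_exp)
  finally show ?thesis by (simp add: l_def)
qed

text \<open>For the lower tail the letters need no cut-off: a letter above \<open>y\<close> enters
  with an exponential of at most 1, which the constant term of the quadratic majorant
  covers.\<close>

lemma prob_steps_le:
  assumes "y \<ge> 1" "K \<ge> 0"
  shows "measure_pmf.prob (replicate_pmf m \<mu>) {xs. steps xs \<le> s} \<le>
    exp (K / y * s + real m * (K / y * excess y + (K / y)\<^sup>2 * exp K * trunc_var y))"
proof -
  define l where "l = K / y"
  have l: "l \<ge> 0" "l \<le> K"
    using assms mult_left_mono[of 1 y K] by (auto simp: l_def field_simps)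
  define g where "g k = exp (- l * (real k - 1))" for k :: nat
  have lk: "- l * (real k - 1) \<le> K" for k
  proof -
    have "- l * (real k - 1) \<le> l" using l by (simp add: algebra_simps)
    then show ?thesis using l by simp
  qed
  have "measure_pmf.prob (replicate_pmf m \<mu>) {xs. steps xs \<le> s} \<le>
      exp (- (- l) * excess y + l\<^sup>2 * exp K * trunc_var y) ^ m / exp (- l * s)"
  proof (rule prob_replicate_pmf_le_prod)
    show "g x \<ge> 0" for x by (simp add: g_def)
    show "g x \<le> exp K" for x using lk unfolding g_def by simp
    show "measure_pmf.expectation \<mu> g \<le> exp (- (- l) * excess y + l\<^sup>2 * exp K * trunc_var y)"
    proof (rule expectation_quadratic_le)
      fix k
      show "g k \<le> 1 + - l * ((real k - 1) * indicator {k. real k \<le> y} k) +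
        l\<^sup>2 * exp K * ((real k - 1)\<^sup>2 * indicator {k. real k \<le> y} k)"
      proof (cases "real k \<le> y")
        case True
        then show ?thesis
          using exp_le_quadratic[OF lk, of k] assms by (auto simp: g_def power_mult_distrib mult_ac)
      next
        case False
        then have "- l * (real k - 1) \<le> 0" using l assms by (simp add: mult_nonneg_nonneg)
        then show ?thesis using False by (simp add: g_def)
      qed
    qed (simp add: g_def)
    fix xs assume "xs \<in> {xs. steps xs \<le> s}"
    then have "exp (- l * s) \<le> exp (- l * steps xs)" using l by (simp add: mult_left_mono)
    also have "\<dots> = prod_list (map g xs)"
    proof (induction xs)
      case (Cons x xs)
      have "exp (- l * steps (x # xs)) = exp (- l * (real x - 1)) * exp (- l * steps xs)"
        unfolding exp_add[symmetric] by (simp add: algebra_simps)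
      then show ?case using Cons by (simp add: g_def)
    qed simp
    finally show "exp (- l * s) \<le> prod_list (map g xs)" .
  qed simp
  also have "\<dots> = exp (real m * (- (- l) * excess y + l\<^sup>2 * exp K * trunc_var y) - - l * s)"
    by (rule exp_power_divide_exp)
  finally show ?thesis by (simp add: l_def add.commute)
qed

end


section \<open>The sum of the degrees\<close>

context critical_cauchy
begin

text \<open>Compares the weight of a letter with the reference level \<open>y\<close>. For a letter
  below \<open>y\<close>, the square in the denominator and Potter's square root, bounded by its
  argument, combine to the cube; above \<open>y\<close> the reference weight itself suffices up to a
  constant.\<close>

lemma pmf_le_scaled:
  obtains y1 where "y1 \<ge> 2" "\<And>x. x \<ge> y1 \<Longrightarrow> L x > 0"
    "\<And>k y. y1 \<le> real k \<Longrightarrow> y1 \<le> y \<Longrightarrow> pmf \<mu> k \<le> 4 * (L y / y\<^sup>2) * max 1 ((y / real k) ^ 3)"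
proof -
  obtain x0 where x0: "x0 \<ge> 2" "\<And>x. x \<ge> x0 \<Longrightarrow> L x > 0"
    "\<And>x y. x0 \<le> x \<Longrightarrow> x \<le> y \<Longrightarrow> L y \<le> 2 * L x * sqrt (y / x)"
    "\<And>x y. x0 \<le> x \<Longrightarrow> x \<le> y \<Longrightarrow> L x \<le> 2 * L y * sqrt (y / x)"
    "\<And>k. x0 \<le> real k \<Longrightarrow> pmf \<mu> k \<le> 2 * (L k / (real k)\<^sup>2)"
    using regular_constants by metis
  show ?thesis
  proof (rule that[OF x0(1,2)])
    fix k y assume k: "x0 \<le> real k" "x0 \<le> y"
    define u where "u = y / real k"
    have p: "real k > 0" "y > 0" "L y > 0" using k x0 by force+
    then have u: "u > 0" by (simp add: u_def)
    have sq: "sqrt v \<le> v" if "v \<ge> 1" for v :: real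
      using that by (intro real_le_lsqrt) (auto simp: power2_eq_square)
    have LL: "L k / (real k)\<^sup>2 \<le> 2 * (L y / y\<^sup>2) * (if u \<ge> 1 then u ^ 3 else 1)"
    proof (cases "u \<ge> 1")
      case True
      then have "real k \<le> y" using p by (simp add: u_def field_simps)
      then have "L k \<le> 2 * L y * sqrt u" using x0(4) k by (simp add: u_def)
      also have "\<dots> \<le> 2 * L y * u" using p sq[OF True] by (intro mult_left_mono) auto
      finally have "L k / (real k)\<^sup>2 \<le> 2 * L y * u / (real k)\<^sup>2" by (intro divide_right_mono) auto
      also have "\<dots> = 2 * (L y / y\<^sup>2) * u ^ 3"
        using p by (simp add: u_def power2_eq_square power3_eq_cube)
      finally show ?thesis using True by simp
    next
      case False
      then have ku: "y \<le> real k" "1 \<le> 1 / u" using p u by (simp_all add: u_def field_simps)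
      have "L k \<le> 2 * L y * sqrt (1 / u)" using x0(3)[OF k(2) ku(1)] by (simp add: u_def)
      also have "\<dots> \<le> 2 * L y * (1 / u)" using p sq[OF ku(2)] by (intro mult_left_mono) auto
      finally have "L k / (real k)\<^sup>2 \<le> 2 * L y * (1 / u) / (real k)\<^sup>2" by (intro divide_right_mono) auto
      also have "\<dots> = 2 * (L y / y\<^sup>2) * u"
        using p by (simp add: u_def power2_eq_square)
      also have "\<dots> \<le> 2 * (L y / y\<^sup>2) * 1" using False p by (intro mult_left_mono) auto
      finally show ?thesis using False by simp
    qed
    have "2 * (L y / y\<^sup>2) * (if u \<ge> 1 then u ^ 3 else 1) \<le> 2 * (L y / y\<^sup>2) * max 1 (u ^ 3)"
      using p by (intro mult_left_mono) auto
    with LL have "L k / (real k)\<^sup>2 \<le> 2 * (L y / y\<^sup>2) * max 1 (u ^ 3)" by linarith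
    then show "pmf \<mu> k \<le> 4 * (L y / y\<^sup>2) * max 1 ((y / real k) ^ 3)"
      using x0(5)[OF k(1)] unfolding u_def by linarith
  qed
qed

text \<open>Chernoff's bound with \<open>K = 1\<close>. Since \<open>excess y / L y\<close> diverges
  while \<open>trunc_var y\<close> is at most \<open>9 * (y * L y)\<close>, the quadratic term
  consumes at most half of the drift beyond a fixed level; the constant \<open>18 * exp 1\<close> is
  what this requires.\<close>

lemma prob_steps_ge_excess:
  obtains y1 where "y1 \<ge> 2" "\<And>y m s. y1 \<le> y \<Longrightarrow>
    measure_pmf.prob (replicate_pmf m \<mu>) {xs. s \<le> steps xs \<and> (\<forall>x\<in>set xs. real x \<le> y)}
      \<le> exp (- (s / y) - real m * excess y / (2 * y))"
proof -
  have "\<forall>\<^sub>F y in at_top. trunc_var y \<le> 9 * (y * L y) \<and> 18 * exp 1 \<le> excess y / L y \<and> L y > 0 \<and> y \<ge> 2"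
    using eventually_trunc_var_le filterlim_at_top[THEN iffD1, OF excess_ratio_at_top, rule_format, of "18 * exp 1"]
      slowly_varying_pos[OF slowly_varying] eventually_ge_at_top[of 2]
    by (intro eventually_conj)
  then obtain y1 where y1: "\<And>y. y \<ge> y1 \<Longrightarrow> trunc_var y \<le> 9 * (y * L y) \<and> 18 * exp 1 \<le> excess y / L y \<and> L y > 0 \<and> y \<ge> 2"
    unfolding eventually_at_top_linorder by auto
  show ?thesis
  proof (rule that[of y1])
    show "y1 \<ge> 2" using y1 by auto
    fix y m s assume "y1 \<le> y"
    then have y: "trunc_var y \<le> 9 * (y * L y)" "18 * exp 1 \<le> excess y / L y" "L y > 0" "y \<ge> 2" using y1 by auto
    have "18 * exp 1 * L y \<le> excess y" using y by (simp add: field_simps)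
    have "exp 1 * trunc_var y \<le> exp 1 * (9 * (y * L y))" using y by (intro mult_left_mono) auto
    also have "\<dots> = (18 * exp 1 * L y) * (y / 2)" by simp
    also have "\<dots> \<le> excess y * (y / 2)" using y \<open>18 * exp 1 * L y \<le> excess y\<close> by (intro mult_right_mono) auto
    finally have "exp 1 * trunc_var y / (y * y) \<le> excess y * (y / 2) / (y * y)"
      using y by (intro divide_right_mono) auto
    then have V: "exp 1 * trunc_var y / (y * y) \<le> excess y / (2 * y)" using y by simp
    have eq: "- (1 / y) * excess y + (1 / y)\<^sup>2 * exp 1 * trunc_var y = exp 1 * trunc_var y / (y * y) - excess y / y"
      by (simp add: power2_eq_square)
    have "measure_pmf.prob (replicate_pmf m \<mu>) {xs. s \<le> steps xs \<and> (\<forall>x\<in>set xs. real x \<le> y)}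
      \<le> exp (- (1 / y * s) + real m * (- (1 / y) * excess y + (1 / y)\<^sup>2 * exp 1 * trunc_var y))"
      by (rule prob_steps_ge) (use y in auto)
    also have "\<dots> \<le> exp (- (s / y) + real m * (- (excess y / (2 * y))))"
    proof (subst exp_le_cancel_iff, rule add_mono)
      show "real m * (- (1 / y) * excess y + (1 / y)\<^sup>2 * exp 1 * trunc_var y) \<le> real m * (- (excess y / (2 * y)))"
      proof (rule mult_left_mono)
        have "excess y / y = 2 * (excess y / (2 * y))" using y by simp
        then show "- (1 / y) * excess y + (1 / y)\<^sup>2 * exp 1 * trunc_var y \<le> - (excess y / (2 * y))"
          unfolding eq using V by linarith
      qed simp
    qed simp
    finally show "measure_pmf.prob (replicate_pmf m \<mu>) {xs. s \<le> steps xs \<and> (\<forall>x\<in>set xs. real x \<le> y)}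
      \<le> exp (- (s / y) - real m * excess y / (2 * y))" by simp
  qed
qed

lemma length_replicate_pmf: "AE xs in replicate_pmf n \<mu>. length xs = n"
  by (auto simp: AE_measure_pmf_iff set_replicate_pmf)

end

context cauchy_scaling
begin

lemma pred_ratio: "(\<lambda>n. real (n - 1) / real n) \<longlonglongrightarrow> 1"
proof -
  have "(\<lambda>n. 1 - inverse (real n)) \<longlonglongrightarrow> 1 - 0"
    by (intro tendsto_diff tendsto_const tendsto_inverse_0_at_top filterlim_real_sequentially)
  then show ?thesis
  proof (rule tendsto_eventually_eq)
    show "\<forall>\<^sub>F n in sequentially. 1 - inverse (real n) = real (n - 1) / real n"
      using eventually_gt_at_top[of 0] by eventually_elim (auto simp: of_nat_diff field_simps)
  qed simp
qed

text \<open>With parameter \<open>K / B n\<close> both Chernoff bounds converge to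
  \<open>exp (- K * d)\<close>, because the scaled drift tends to 1 and the scaled truncated
  variance to 0; \<open>K\<close> is then at our disposal. The upper tail also needs that, with high
  probability, no letter reaches \<open>B n\<close>.\<close>

lemma steps_concentration:
  assumes "d > 0"
  shows "(\<lambda>n. measure_pmf.prob (replicate_pmf (n - 1) \<mu>) {xs. d * B n < \<bar>steps xs + B n\<bar>}) \<longlonglongrightarrow> 0"
proof (rule LIMSEQ_I)
  fix r :: real assume "r > 0"
  \<comment> \<open>Makes \<open>exp (- K * d)\<close> smaller than \<open>r / 4\<close>; the upper
    tail, the lower tail and the presence of a large letter then each have probability below
    \<open>r / 4\<close>.\<close>
  define K where "K = \<bar>ln (r / 4)\<bar> / d + 1"
  have K: "K > 0" "exp (- K * d) < r / 4"
  proof -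
    show "K > 0" using \<open>d > 0\<close> by (simp add: K_def add_nonneg_pos)
    have "K * d = \<bar>ln (r / 4)\<bar> + d" using \<open>d > 0\<close> by (simp add: K_def distrib_right)
    then have "- K * d < ln (r / 4)" using \<open>d > 0\<close> by simp
    then have "exp (- K * d) < exp (ln (r / 4))" by (simp only: exp_less_cancel_iff)
    then show "exp (- K * d) < r / 4" using \<open>r > 0\<close> by simp
  qed
  define X where "X n = real (n - 1) / real n * (real n * excess (B n) / B n)" for n
  define Y where "Y n = real (n - 1) / real n * (real n * trunc_var (B n) / (B n)\<^sup>2)" for n
  have X: "X \<longlonglongrightarrow> 1 * 1" unfolding X_def by (intro tendsto_mult pred_ratio excess_B)
  have Y: "Y \<longlonglongrightarrow> 1 * 0" unfolding Y_def by (intro tendsto_mult pred_ratio nV_B)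
  have eq1: "K * (1 - d) - K * (1 * 1) + K\<^sup>2 * exp K * (1 * 0) = - K * d" by (simp add: algebra_simps)
  have "(\<lambda>n. exp (K * (1 - d) - K * X n + K\<^sup>2 * exp K * Y n)) \<longlonglongrightarrow> exp (K * (1 - d) - K * (1 * 1) + K\<^sup>2 * exp K * (1 * 0))"
    by (intro tendsto_intros X Y)
  note U = order_tendstoD(2)[OF this[unfolded eq1] K(2)]
  have eq2: "- K * (1 + d) + K * (1 * 1) + K\<^sup>2 * exp K * (1 * 0) = - K * d" by (simp add: algebra_simps)
  have "(\<lambda>n. exp (- K * (1 + d) + K * X n + K\<^sup>2 * exp K * Y n)) \<longlonglongrightarrow> exp (- K * (1 + d) + K * (1 * 1) + K\<^sup>2 * exp K * (1 * 0))"
    by (intro tendsto_intros X Y)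
  note D = order_tendstoD(2)[OF this[unfolded eq2] K(2)]
  have exponent:
    "- (K / b * (- (1 - d) * b)) + N * (- (K / b) * X + (K / b)\<^sup>2 * E * V) = K * (1 - d) - K * (N * X / b) + K\<^sup>2 * E * (N * V / b\<^sup>2)"
    "K / b * (- (1 + d) * b) + N * (K / b * X + (K / b)\<^sup>2 * E * V) = - K * (1 + d) + K * (N * X / b) + K\<^sup>2 * E * (N * V / b\<^sup>2)"
    if "b > 0" for b N X E V :: real
    using that by (simp_all add: field_simps power2_eq_square)
  have T: "\<forall>\<^sub>F n in sequentially. real n * tail (1 * B n) < r / 4"
    using order_tendstoD(2)[OF tail_B[of 1], of "r / 4"] \<open>r > 0\<close> by simp
  have "\<forall>\<^sub>F n in sequentially. measure_pmf.prob (replicate_pmf (n - 1) \<mu>) {xs. d * B n < \<bar>steps xs + B n\<bar>} < r"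
    using U D T eventually_B_gt[of 1] eventually_gt_at_top[of 0]
  proof eventually_elim
    case (elim n)
    let ?P = "measure_pmf.prob (replicate_pmf (n - 1) \<mu>)"
    have Bp: "B n > 0" "real n > 0" using elim by auto
    have XY: "real (n - 1) * excess (B n) / B n = X n" "real (n - 1) * trunc_var (B n) / (B n)\<^sup>2 = Y n"
      using Bp by (simp_all add: X_def Y_def)
    have 1: "?P {xs. - (1 - d) * B n \<le> steps xs \<and> (\<forall>x\<in>set xs. real x \<le> B n)} < r / 4"
    proof -
      have "?P {xs. - (1 - d) * B n \<le> steps xs \<and> (\<forall>x\<in>set xs. real x \<le> B n)} \<le>
        exp (- (K / B n * (- (1 - d) * B n)) + real (n - 1) * (- (K / B n) * excess (B n) + (K / B n)\<^sup>2 * exp K * trunc_var (B n)))"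
        by (rule prob_steps_ge) (use elim K in auto)
      also have "- (K / B n * (- (1 - d) * B n)) + real (n - 1) * (- (K / B n) * excess (B n) + (K / B n)\<^sup>2 * exp K * trunc_var (B n))
        = K * (1 - d) - K * (real (n - 1) * excess (B n) / B n) + K\<^sup>2 * exp K * (real (n - 1) * trunc_var (B n) / (B n)\<^sup>2)"
        by (rule exponent) (use Bp in simp)
      finally show ?thesis using elim(1) unfolding XY by linarith
    qed
    have 2: "?P {xs. steps xs \<le> - (1 + d) * B n} < r / 4"
    proof -
      have "?P {xs. steps xs \<le> - (1 + d) * B n} \<le>
        exp (K / B n * (- (1 + d) * B n) + real (n - 1) * (K / B n * excess (B n) + (K / B n)\<^sup>2 * exp K * trunc_var (B n)))"
        by (rule prob_steps_le) (use elim K in auto)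
      also have "K / B n * (- (1 + d) * B n) + real (n - 1) * (K / B n * excess (B n) + (K / B n)\<^sup>2 * exp K * trunc_var (B n))
        = - K * (1 + d) + K * (real (n - 1) * excess (B n) / B n) + K\<^sup>2 * exp K * (real (n - 1) * trunc_var (B n) / (B n)\<^sup>2)"
        by (rule exponent) (use Bp in simp)
      finally show ?thesis using elim(2) unfolding XY by linarith
    qed
    have 3: "?P {xs. \<exists>x\<in>set xs. x \<in> {k. B n \<le> real k}} < r / 4"
    proof -
      have "?P {xs. \<exists>x\<in>set xs. x \<in> {k. B n \<le> real k}} \<le> real (n - 1) * tail (B n)"
        unfolding tail_def by (rule prob_replicate_pmf_ex_le)
      also have "\<dots> \<le> real n * tail (B n)" using tail_pos[of "B n"] by (intro mult_right_mono) auto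
      finally show ?thesis using elim(3) by simp
    qed
    have "?P {xs. d * B n < \<bar>steps xs + B n\<bar>} \<le>
      ?P (({xs. - (1 - d) * B n \<le> steps xs \<and> (\<forall>x\<in>set xs. real x \<le> B n)} \<union> {xs. steps xs \<le> - (1 + d) * B n})
        \<union> {xs. \<exists>x\<in>set xs. x \<in> {k. B n \<le> real k}})"
    proof (rule measure_pmf.finite_measure_mono)
      show "{xs. d * B n < \<bar>steps xs + B n\<bar>} \<subseteq>
       ({xs. - (1 - d) * B n \<le> steps xs \<and> (\<forall>x\<in>set xs. real x \<le> B n)} \<union> {xs. steps xs \<le> - (1 + d) * B n})
        \<union> {xs. \<exists>x\<in>set xs. x \<in> {k. B n \<le> real k}}"
      proof
        fix xs assume "xs \<in> {xs. d * B n < \<bar>steps xs + B n\<bar>}"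
        then have "d * B n < steps xs + B n \<or> steps xs + B n < - (d * B n)" by auto
        then have "- (1 - d) * B n \<le> steps xs \<or> steps xs \<le> - (1 + d) * B n"
          by (auto simp: left_diff_distrib distrib_right)
        moreover have "(\<forall>x\<in>set xs. real x \<le> B n) \<or> (\<exists>x\<in>set xs. x \<in> {k. B n \<le> real k})"
          by (auto simp: not_le less_imp_le)
        ultimately show "xs \<in> ({xs. - (1 - d) * B n \<le> steps xs \<and> (\<forall>x\<in>set xs. real x \<le> B n)} \<union> {xs. steps xs \<le> - (1 + d) * B n})
          \<union> {xs. \<exists>x\<in>set xs. x \<in> {k. B n \<le> real k}}" by blast
      qed
    qed simp
    also have "\<dots> \<le> ?P {xs. - (1 - d) * B n \<le> steps xs \<and> (\<forall>x\<in>set xs. real x \<le> B n)} + ?P {xs. steps xs \<le> - (1 + d) * B n}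
        + ?P {xs. \<exists>x\<in>set xs. x \<in> {k. B n \<le> real k}}"
      by (intro order_trans[OF measure_Un_le] add_mono measure_Un_le) auto
    finally show ?case using 1 2 3 \<open>r > 0\<close> by linarith
  qed
  then show "\<exists>no. \<forall>n\<ge>no. norm (measure_pmf.prob (replicate_pmf (n - 1) \<mu>) {xs. d * B n < \<bar>steps xs + B n\<bar>} - 0) < r"
    by (auto simp: eventually_sequentially)
qed

text \<open>The order of magnitude of the probability that the sum of \<open>n\<close> degrees is \<open>n - 1\<close>.\<close>

definition rate :: "nat \<Rightarrow> real" where
  "rate n = real n * (L (B n) / (B n)\<^sup>2)"

lemma eventually_rate_pos: "\<forall>\<^sub>F n in sequentially. rate n > 0"
  using eventually_L_B_pos eventually_B_gt[of 0] eventually_gt_at_top[of 0]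
  by eventually_elim (simp add: rate_def)

text \<open>Near \<open>B n\<close> the weight is constant up to a factor
  \<open>1 \<plusminus> e\<close>, which is why the exact size of the big jump does not influence
  its cost. The width \<open>e / 16\<close> leaves room for three errors: in \<open>L\<close>, in
  the square, and in the equivalence of \<open>pmf \<mu> k\<close> with
  \<open>L k / k^2\<close>.\<close>

lemma eventually_pmf_window:
  assumes e: "0 < e" "e < 1"
  shows "\<forall>\<^sub>F n in sequentially. \<forall>k. \<bar>real k - B n\<bar> \<le> e / 16 * B n \<longrightarrow>
    (1 - e) * (L (B n) / (B n)\<^sup>2) \<le> pmf \<mu> k \<and> pmf \<mu> k \<le> (1 + e) * (L (B n) / (B n)\<^sup>2)"
proof -
  define d where "d = e / 16"
  have d: "0 < d" "d < 1/16" "16 * d = e" using e by (auto simp: d_def)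
  have two: "(2::real) > 1" by simp
  have half: "filterlim (\<lambda>n. 1/2 * B n) at_top sequentially" by (rule mult_at_top[OF B_at_top]) simp
  show ?thesis
    using eventually_compose_filterlim[OF slowly_varying_uniform_ratio[OF slowly_varying two d(1)] B_at_top]
      eventually_compose_filterlim[OF eventually_pmf_bounds[OF d(1)] half] eventually_L_B_pos eventually_B_gt[of 0]
  proof eventually_elim
    case (elim n)
    show ?case
    proof (intro allI impI)
      fix k assume "\<bar>real k - B n\<bar> \<le> e / 16 * B n"
      then have "\<bar>real k - B n\<bar> \<le> d * B n" by (simp add: d_def)
      then have k: "(1 - d) * B n \<le> real k" "real k \<le> (1 + d) * B n"
        unfolding left_diff_distrib distrib_right by linarith+
      have "1 / 2 * B n \<le> (1 - d) * B n" "(1 + d) * B n \<le> 2 * B n"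
        using d elim by (intro mult_right_mono; simp)+
      then have k2: "B n / 2 \<le> real k" "real k \<le> 2 * B n" using k by linarith+
      then have k0: "real k > 0" using elim by linarith
      define q where "q = L (B n) / (B n)\<^sup>2"
      have q: "q > 0" using elim by (simp add: q_def)
      have "\<bar>L k / L (B n) - 1\<bar> < d" using elim(1) k2 by auto
      then have "L k / L (B n) \<le> 1 + d" "L k / L (B n) \<ge> 1 - d" by linarith+
      then have Lk: "L k \<le> (1 + d) * L (B n)" "L k \<ge> (1 - d) * L (B n)" using elim by (auto simp: field_simps)
      define v where "v = B n / real k"
      have qk: "L (B n) / (real k)\<^sup>2 = q * v\<^sup>2" using elim by (simp add: q_def v_def power_divide)
      have p: "(1 - d) * (L k / (real k)\<^sup>2) \<le> pmf \<mu> k" "pmf \<mu> k \<le> (1 + d) * (L k / (real k)\<^sup>2)"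
        using elim(2) k2 by auto
      have "(1 - d) * v \<le> 1" "1 \<le> (1 + d) * v" using k k0 by (auto simp: v_def field_simps)
      have "pmf \<mu> k \<le> (1 + d) * ((1 + d) * L (B n) / (real k)\<^sup>2)"
        using Lk d by (intro order_trans[OF p(2)] mult_left_mono divide_right_mono) auto
      also have "\<dots> = (1 + d)\<^sup>2 * (L (B n) / (real k)\<^sup>2)" by (simp add: power2_eq_square)
      also have "\<dots> = q * ((1 + d) * v)\<^sup>2" unfolding qk by (simp add: power_mult_distrib)
      also have "\<dots> \<le> q * (1 + e)"
      proof (rule mult_left_mono)
        have "(1 + d) * v \<le> (1 + 4 * d) * (1 - d) * v"
        proof (rule mult_right_mono)
          have "d * (2 - 4 * d) \<ge> 0" using d by (intro mult_nonneg_nonneg) auto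
          then show "1 + d \<le> (1 + 4 * d) * (1 - d)" by (simp add: algebra_simps)
        qed (use k0 elim in \<open>simp add: v_def\<close>)
        also have "\<dots> \<le> (1 + 4 * d) * 1" unfolding mult.assoc
          using \<open>(1 - d) * v \<le> 1\<close> d by (intro mult_left_mono) auto
        finally have "((1 + d) * v)\<^sup>2 \<le> (1 + 4 * d)\<^sup>2"
          using d k0 elim by (intro power_mono) (auto simp: v_def)
        also have "\<dots> \<le> 1 + e"
        proof -
          have "d * (8 - 16 * d) \<ge> 0" using d by (intro mult_nonneg_nonneg) auto
          then show ?thesis unfolding d(3)[symmetric] by (simp add: power2_eq_square algebra_simps)
        qed
        finally show "((1 + d) * v)\<^sup>2 \<le> 1 + e" .
      qed (use q in auto)
      finally have up: "pmf \<mu> k \<le> (1 + e) * q" by (simp add: mult.commute)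
      have "q * (1 - e) \<le> q * ((1 - d) * v)\<^sup>2"
      proof (rule mult_left_mono)
        have "1 - 2 * d \<le> (1 - d) * v"
        proof -
          have "(1 - 2 * d) * 1 \<le> (1 - 2 * d) * ((1 + d) * v)"
            using d \<open>1 \<le> (1 + d) * v\<close> by (intro mult_left_mono) auto
          also have "\<dots> = ((1 - 2 * d) * (1 + d)) * v" by simp
          also have "\<dots> \<le> (1 - d) * v"
            using d k0 elim by (intro mult_right_mono) (auto simp: v_def algebra_simps)
          finally show ?thesis by simp
        qed
        then have "(1 - 2 * d)\<^sup>2 \<le> ((1 - d) * v)\<^sup>2" using d by (intro power_mono) auto
        moreover have "1 - e \<le> (1 - 2 * d)\<^sup>2"
        proof -
          have "d * d \<ge> 0" by simp
          then show ?thesis unfolding d(3)[symmetric] using d(1) by (simp add: power2_eq_square algebra_simps)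
        qed
        ultimately show "1 - e \<le> ((1 - d) * v)\<^sup>2" by linarith
      qed (use q in auto)
      also have "\<dots> = (1 - d)\<^sup>2 * (L (B n) / (real k)\<^sup>2)" unfolding qk by (simp add: power_mult_distrib)
      also have "\<dots> = (1 - d) * ((1 - d) * L (B n) / (real k)\<^sup>2)" by (simp add: power2_eq_square)
      also have "\<dots> \<le> (1 - d) * (L k / (real k)\<^sup>2)"
        using Lk d by (intro mult_left_mono divide_right_mono) auto
      also have "\<dots> \<le> pmf \<mu> k" by (rule p)
      finally have lo: "(1 - e) * q \<le> pmf \<mu> k" by (simp add: mult.commute)
      show "(1 - e) * (L (B n) / (B n)\<^sup>2) \<le> pmf \<mu> k \<and> pmf \<mu> k \<le> (1 + e) * (L (B n) / (B n)\<^sup>2)"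
        using up lo by (simp add: q_def)
    qed
  qed
qed

text \<open>Words are sorted by the dyadic range \<open>(y / 2, y]\<close> of their largest letter.
  With \<open>u = B n / y\<close> such a range contributes a constant times
  \<open>rate n * u^3 * exp (- u / 8)\<close>, hence at most a constant times
  \<open>rate n / u\<close>. The sum over the ranges below \<open>e * B n\<close> is geometric and
  dominated by its top term, which produces the factor \<open>e\<close>.\<close>

lemma prob_small_jumps_le:
  obtains C where "C > 0" "\<And>e. 0 < e \<Longrightarrow> e \<le> 1 \<Longrightarrow> \<forall>\<^sub>F n in sequentially.
    measure_pmf.prob (replicate_pmf n \<mu>) {xs. Suc (sum_list xs) = n \<and> (\<forall>x\<in>set xs. real x \<le> e * B n)}
      \<le> C * e * rate n"
proof -
  obtain y2 where y2: "y2 \<ge> 2" "\<And>x. x \<ge> y2 \<Longrightarrow> L x > 0"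
    "\<And>k y. y2 \<le> real k \<Longrightarrow> y2 \<le> y \<Longrightarrow> pmf \<mu> k \<le> 4 * (L y / y\<^sup>2) * max 1 ((y / real k) ^ 3)"
    using pmf_le_scaled by blast
  obtain y3 where y3: "y3 \<ge> 2" "\<And>y m s. y3 \<le> y \<Longrightarrow>
    measure_pmf.prob (replicate_pmf m \<mu>) {xs. s \<le> steps xs \<and> (\<forall>x\<in>set xs. real x \<le> y)}
      \<le> exp (- (s / y) - real m * excess y / (2 * y))"
    using prob_steps_ge_excess by blast
  define y1 where "y1 = max y2 y3"
  have y1: "y1 \<ge> 2" "y1 \<ge> y2" "y1 \<ge> y3" using y2(1) by (auto simp: y1_def)
  \<comment> \<open>The factors come from the weight of the largest letter (\<open>4 * 8\<close>),
    from \<open>exp 1\<close> in the large deviation bound, and from the maximal size of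
    \<open>u ^ 4 * exp (- u / 8)\<close>.\<close>
  define D :: real where "D = 32 * exp 1 * 32 ^ 4"
  define F where "F n y = measure_pmf.prob (replicate_pmf n \<mu>)
      {xs. Suc (sum_list xs) = n \<and> (\<forall>x\<in>set xs. real x \<le> y)}" for n y
  have power4_le: "u ^ 4 * exp (- u / 8) \<le> 32 ^ 4" if "u > 0" for u :: real
  proof -
    have "u / 32 \<le> exp (u / 32)" using exp_ge_add_one_self[of "u/32"] by linarith
    then have "(u / 32) ^ 4 \<le> exp (u / 32) ^ 4" using that by (intro power_mono) auto
    also have "\<dots> = exp (u / 8)" by (simp add: exp_of_nat_mult[symmetric])
    finally have "u ^ 4 \<le> 32 ^ 4 * exp (u / 8)" by (simp add: power_divide)
    then have "u ^ 4 * exp (- u / 8) \<le> 32 ^ 4 * exp (u / 8) * exp (- u / 8)" by (intro mult_right_mono) auto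
    also have "\<dots> = 32 ^ 4" by (simp add: exp_minus)
    finally show ?thesis .
  qed
  have good: "\<forall>\<^sub>F n in sequentially. n \<ge> 2 \<and> B n \<ge> 2 * y1 \<and> real n * excess (B n) \<ge> B n / 2"
  proof -
    have "\<forall>\<^sub>F n in sequentially. real n * excess (B n) / B n > 1 / 2"
      using order_tendstoD(1)[OF excess_B, of "1/2"] by simp
    then show ?thesis using eventually_ge_at_top[of 2] eventually_B_gt[of "2 * y1"] eventually_B_gt[of 0]
      by eventually_elim (auto simp: field_simps)
  qed
  \<comment> \<open>The drift of \<open>m\<close> letters, with \<open>m\<close> at least
    \<open>n - 1\<close>, is at least half that of \<open>n\<close> letters; the latter is at least
    \<open>B n / 2\<close> already for truncation at \<open>B n\<close>, and \<open>excess\<close>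
    only grows when the level is lowered to \<open>y\<close>.\<close>
  have tail_exp: "real m * excess y / (2 * y) \<ge> B n / (8 * y)"
    if n: "n \<ge> 2" "B n \<ge> 2 * y1" "real n * excess (B n) \<ge> B n / 2" and y: "1 \<le> y" "y \<le> B n" and m: "n \<le> Suc m" for n m y
  proof -
    have ex: "excess y \<ge> excess (B n)" using excess_antimono[OF y] .
    have "real m \<ge> real n / 2" using n(1) m by linarith
    moreover have "0 < real n * excess (B n)" using n y1 by linarith
    then have "excess (B n) > 0" using n by (simp add: zero_less_mult_iff)
    ultimately have "real n / 2 * excess (B n) \<le> real m * excess y"
      using ex by (intro mult_mono) auto
    then have "B n / 4 \<le> real m * excess y" using n by linarith
    then have "B n / 4 / (2 * y) \<le> real m * excess y / (2 * y)" using y by (intro divide_right_mono) auto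
    then show ?thesis by simp
  qed
  have step: "F n y \<le> F n (y / 2) + D * rate n * (y / B n)"
    if n: "n \<ge> 2" "B n \<ge> 2 * y1" "real n * excess (B n) \<ge> B n / 2" and y: "2 * y1 \<le> y" "y \<le> B n" for n y
  proof -
    define m where "m = n - 1"
    have nm: "n = Suc m" using n by (simp add: m_def)
    have yp: "y > 0" "B n > 0" "y1 \<le> B n" using y y1 n by auto
    define u where "u = B n / y"
    have u: "u \<ge> 1" using yp y by (simp add: u_def)
    define q where "q = L (B n) / (B n)\<^sup>2"
    have q: "q > 0" using y2(2)[of "B n"] yp y1 by (simp add: q_def)
    define H where "H = {k. y / 2 < real k \<and> real k \<le> y}"
    define Y where "Y = {k. real k \<le> y}"
    define c where "c = 32 * q * u ^ 3"
    have c: "pmf \<mu> k \<le> c" if "k \<in> H" for k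
    proof -
      have k: "y / 2 < real k" "real k > 0" "y2 \<le> real k" using that y y1 yp by (auto simp: H_def)
      have "B n / real k \<le> B n / (y / 2)" using k yp by (intro divide_left_mono) auto
      also have "\<dots> = 2 * u" by (simp add: u_def)
      finally have "(B n / real k) ^ 3 \<le> (2 * u) ^ 3" using k yp by (intro power_mono) auto
      also have "\<dots> = 8 * u ^ 3" by (simp add: power_mult_distrib)
      finally have "max 1 ((B n / real k) ^ 3) \<le> 8 * u ^ 3" using one_le_power[OF u, of 3] by auto
      then have "4 * q * max 1 ((B n / real k) ^ 3) \<le> 4 * q * (8 * u ^ 3)" using q by (intro mult_left_mono) auto
      then show ?thesis using y2(3)[of k "B n"] k yp y1 unfolding q_def[symmetric] c_def by linarith
    qed
    have c0: "c \<ge> 0" using q u by (simp add: c_def)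
    have "F n y \<le> measure_pmf.prob (replicate_pmf n \<mu>)
      ({xs. Suc (sum_list xs) = n \<and> (\<forall>x\<in>set xs. real x \<le> y / 2)} \<union>
       {xs. sum_list xs = m \<and> (\<exists>x\<in>set xs. x \<in> H) \<and> (\<forall>x\<in>set xs. x \<in> Y)})"
      unfolding F_def
    proof (rule measure_pmf.finite_measure_mono)
      show "{xs. Suc (sum_list xs) = n \<and> (\<forall>x\<in>set xs. real x \<le> y)} \<subseteq>
       {xs. Suc (sum_list xs) = n \<and> (\<forall>x\<in>set xs. real x \<le> y / 2)} \<union>
       {xs. sum_list xs = m \<and> (\<exists>x\<in>set xs. x \<in> H) \<and> (\<forall>x\<in>set xs. x \<in> Y)}"
        by (auto simp: nm H_def Y_def not_le)
    qed simp
    also have "\<dots> \<le> F n (y / 2) + measure_pmf.prob (replicate_pmf n \<mu>)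
        {xs. sum_list xs = m \<and> (\<exists>x\<in>set xs. x \<in> H) \<and> (\<forall>x\<in>set xs. x \<in> Y)}"
      unfolding F_def by (intro measure_Un_le) auto
    also have "measure_pmf.prob (replicate_pmf n \<mu>)
        {xs. sum_list xs = m \<and> (\<exists>x\<in>set xs. x \<in> H) \<and> (\<forall>x\<in>set xs. x \<in> Y)} \<le>
        real n * c * measure_pmf.prob (replicate_pmf m \<mu>)
        {t. sum_list t \<le> m \<and> m - sum_list t \<in> H \<and> (\<forall>x\<in>set t. x \<in> Y)}"
      unfolding nm by (rule prob_jump_le[OF c c0])
    also have "\<dots> \<le> real n * c * exp (1 - B n / (8 * y))"
    proof (rule mult_left_mono)
      have "measure_pmf.prob (replicate_pmf m \<mu>)
        {t. sum_list t \<le> m \<and> m - sum_list t \<in> H \<and> (\<forall>x\<in>set t. x \<in> Y)} \<le>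
        measure_pmf.prob (replicate_pmf m \<mu>) {t. - y \<le> steps t \<and> (\<forall>x\<in>set t. real x \<le> y)}"
      proof (rule measure_pmf.finite_measure_mono_AE)
        show "AE t in replicate_pmf m \<mu>. t \<in> {t. sum_list t \<le> m \<and> m - sum_list t \<in> H \<and> (\<forall>x\<in>set t. x \<in> Y)} \<longrightarrow>
           t \<in> {t. - y \<le> steps t \<and> (\<forall>x\<in>set t. real x \<le> y)}"
          using length_replicate_pmf[of m]
          by eventually_elim (auto simp: steps_eq H_def Y_def of_nat_diff)
      qed simp
      also have "\<dots> \<le> exp (- (- y / y) - real m * excess y / (2 * y))"
        by (rule y3(2)) (use y y1 in auto)
      also have "\<dots> \<le> exp (1 - B n / (8 * y))"
        using tail_exp[OF n _ y(2), of m] nm y y1 yp by simp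
      finally show "measure_pmf.prob (replicate_pmf m \<mu>)
        {t. sum_list t \<le> m \<and> m - sum_list t \<in> H \<and> (\<forall>x\<in>set t. x \<in> Y)} \<le> exp (1 - B n / (8 * y))" .
    qed (use c0 in auto)
    also have "real n * c * exp (1 - B n / (8 * y)) = 32 * exp 1 * rate n * (u ^ 4 * exp (- u / 8)) * (1 / u)"
    proof -
      have "exp (1 - B n / (8 * y)) = exp 1 * exp (- u / 8)"
        unfolding exp_add[symmetric] by (simp add: u_def)
      then show ?thesis using u by (simp add: rate_def q_def[symmetric] c_def power4_eq_xxxx power3_eq_cube)
    qed
    also have "\<dots> \<le> 32 * exp 1 * rate n * 32 ^ 4 * (1 / u)"
    proof (intro mult_right_mono mult_left_mono power4_le)
      show "0 \<le> 32 * exp 1 * rate n"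
        using q unfolding rate_def q_def by (intro mult_nonneg_nonneg) auto
    qed (use u in auto)
    finally show ?thesis by (simp add: D_def u_def mult_ac)
  qed
  have iter: "F n y \<le> F n (2 * y1) + 2 * D * rate n * (y / B n)"
    if n: "n \<ge> 2" "B n \<ge> 2 * y1" "real n * excess (B n) \<ge> B n / 2" and y: "0 < y" "y \<le> B n" "y \<le> 2 ^ k * (2 * y1)" for n y k
    using y
  proof (induction k arbitrary: y)
    case 0
    have "rate n \<ge> 0" using y2(2)[of "B n"] n y1 by (simp add: rate_def)
    then have "0 \<le> 2 * D * rate n * (y / B n)" using 0 by (intro mult_nonneg_nonneg divide_nonneg_nonneg) (auto simp: D_def)
    moreover have "F n y \<le> F n (2 * y1)"
      unfolding F_def using 0 by (intro measure_pmf.finite_measure_mono) auto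
    ultimately show ?case by simp
  next
    case (Suc k)
    have r: "rate n \<ge> 0" using y2(2)[of "B n"] n y1 by (simp add: rate_def)
    show ?case
    proof (cases "2 * y1 \<le> y")
      case True
      have "F n y \<le> F n (y / 2) + D * rate n * (y / B n)" by (rule step[OF n True Suc.prems(2)])
      moreover have "F n (y / 2) \<le> F n (2 * y1) + 2 * D * rate n * (y / 2 / B n)"
        by (rule Suc.IH) (use Suc.prems in auto)
      ultimately show ?thesis by simp
    next
      case False
      have "0 \<le> 2 * D * rate n * (y / B n)" using Suc r by (intro mult_nonneg_nonneg divide_nonneg_nonneg) (auto simp: D_def)
      moreover have "F n y \<le> F n (2 * y1)"
        unfolding F_def using False by (intro measure_pmf.finite_measure_mono) auto
      ultimately show ?thesis by simp
    qed
  qed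
  \<comment> \<open>Letters bounded by a constant force a deviation whose probability decays
    exponentially in \<open>B n\<close>, hence faster than \<open>B n ^ 4\<close>, whereas
    \<open>rate n\<close> is at least \<open>1 / B n ^ 3\<close> because
    \<open>B n * L (B n) \<ge> 1\<close>. The spare factor \<open>B n\<close> beats any
    constant.\<close>
  have base: "\<forall>\<^sub>F n in sequentially. F n (2 * y1) \<le> e * rate n" if "e > 0" for e :: real
  proof -
    define M where "M = exp 1 * (2 * y1) ^ 4 * 32 ^ 4"
    have M: "M > 0" using y1 by (simp add: M_def)
    have "\<forall>\<^sub>F n in sequentially. 1 \<le> B n * L (B n)"
      using eventually_compose_filterlim[OF filterlim_at_top[THEN iffD1, OF xL_at_top, rule_format, of 1] B_at_top] .
    then show ?thesis using good eventually_B_gt[of "M / e"]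
    proof eventually_elim
      case (elim n)
      have n: "n \<ge> 2" "B n \<ge> 2 * y1" "real n * excess (B n) \<ge> B n / 2" using elim by auto
      define u where "u = B n / (2 * y1)"
      have u: "u > 0" "B n > 0" using n y1 by (auto simp: u_def)
      have "F n (2 * y1) \<le> measure_pmf.prob (replicate_pmf n \<mu>) {t. - 1 \<le> steps t \<and> (\<forall>x\<in>set t. real x \<le> 2 * y1)}"
        unfolding F_def
      proof (rule measure_pmf.finite_measure_mono_AE)
        show "AE t in replicate_pmf n \<mu>. t \<in> {xs. Suc (sum_list xs) = n \<and> (\<forall>x\<in>set xs. real x \<le> 2 * y1)} \<longrightarrow>
            t \<in> {t. - 1 \<le> steps t \<and> (\<forall>x\<in>set t. real x \<le> 2 * y1)}"
          using length_replicate_pmf[of n] by eventually_elim (auto simp: steps_eq)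
      qed simp
      also have "\<dots> \<le> exp (- (- 1 / (2 * y1)) - real n * excess (2 * y1) / (2 * (2 * y1)))"
        by (rule y3(2)) (use y1 in auto)
      also have "\<dots> \<le> exp (1 - u / 8)"
      proof -
        have "real n * excess (2 * y1) / (2 * (2 * y1)) \<ge> B n / (8 * (2 * y1))"
          by (rule tail_exp[OF n]) (use y1 n in auto)
        moreover have "1 / (2 * y1) \<le> 1" using y1 by simp
        ultimately show ?thesis by (simp add: u_def)
      qed
      also have "\<dots> = exp 1 * (u ^ 4 * exp (- u / 8)) / u ^ 4" 
      proof -
        have "exp (1 - u / 8) = exp 1 * exp (- u / 8)" by (simp flip: exp_add)
        then show ?thesis using u by simp
      qed
      also have "\<dots> \<le> exp 1 * 32 ^ 4 / u ^ 4"
        using power4_le[OF u(1)] u by (intro divide_right_mono mult_left_mono) auto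
      also have "\<dots> = M / (B n ^ 3 * B n)" using u y1 by (simp add: M_def u_def power_divide power4_eq_xxxx power3_eq_cube)
      also have "\<dots> \<le> e / B n ^ 3"
      proof -
        have "M \<le> e * B n" using elim that by (simp add: field_simps)
        then have "M / (B n ^ 3 * B n) \<le> e * B n / (B n ^ 3 * B n)" using u by (intro divide_right_mono) auto
        then show ?thesis using u by simp
      qed
      also have "\<dots> \<le> e * rate n"
      proof -
        have "1 / B n ^ 3 \<le> (B n * L (B n)) / B n ^ 3" using elim u by (intro divide_right_mono) auto
        also have "\<dots> = 1 * (L (B n) / (B n)\<^sup>2)" using u by (simp add: power2_eq_square power3_eq_cube)
        also have "\<dots> \<le> rate n" unfolding rate_def
          using n y2(2)[of "B n"] y1 by (intro mult_right_mono) auto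
        finally have "e * (1 / B n ^ 3) \<le> e * rate n" using that by (intro mult_left_mono) auto
        then show ?thesis by simp
      qed
      finally show ?case .
    qed
  qed
  show ?thesis
  proof (rule that[of "2 * D + 1"])
    show "2 * D + 1 > 0" by (simp add: D_def add_pos_pos)
    fix e :: real assume e: "0 < e" "e \<le> 1"
    show "\<forall>\<^sub>F n in sequentially.
      measure_pmf.prob (replicate_pmf n \<mu>) {xs. Suc (sum_list xs) = n \<and> (\<forall>x\<in>set xs. real x \<le> e * B n)}
        \<le> (2 * D + 1) * e * rate n"
      using good base[OF e(1)]
    proof eventually_elim
      case (elim n)
      have n: "n \<ge> 2" "B n \<ge> 2 * y1" "real n * excess (B n) \<ge> B n / 2" using elim by auto
      have Bp: "B n > 0" using n y1 by linarith
      obtain k where "e * B n / (2 * y1) < 2 ^ k" using real_arch_pow[of 2 "e * B n / (2 * y1)"] by auto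
      then have "e * B n \<le> 2 ^ k * (2 * y1)" using y1 by (simp add: field_simps)
      then have "F n (e * B n) \<le> F n (2 * y1) + 2 * D * rate n * (e * B n / B n)"
        using e Bp mult_right_mono[of e 1 "B n"] by (intro iter[OF n]) auto
      then have "F n (e * B n) \<le> (2 * D + 1) * e * rate n" using elim Bp by (simp add: algebra_simps)
      then show ?case by (simp add: F_def)
    qed
  qed
qed

text \<open>Three kinds of words: without a letter above \<open>s * B n\<close>; with a letter in a
  narrow window around \<open>B n\<close>, where the weight is almost constant; with a letter above
  \<open>s * B n\<close> outside the window. In the last case the remaining letters must violate the
  concentration of their sum, which makes up for the larger weight.\<close>

lemma prob_sum_le:
  assumes e: "0 < e" "e < 1"
  shows "\<forall>\<^sub>F n in sequentially.
    measure_pmf.prob (replicate_pmf n \<mu>) {xs. Suc (sum_list xs) = n} \<le> (1 + e) * rate n"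
proof -
  obtain C where C: "C > 0" "\<And>e. 0 < e \<Longrightarrow> e \<le> 1 \<Longrightarrow> \<forall>\<^sub>F n in sequentially.
    measure_pmf.prob (replicate_pmf n \<mu>) {xs. Suc (sum_list xs) = n \<and> (\<forall>x\<in>set xs. real x \<le> e * B n)}
      \<le> C * e * rate n"
    using prob_small_jumps_le by blast
  obtain y2 where y2: "y2 \<ge> 2" "\<And>x. x \<ge> y2 \<Longrightarrow> L x > 0"
    "\<And>k y. y2 \<le> real k \<Longrightarrow> y2 \<le> y \<Longrightarrow> pmf \<mu> k \<le> 4 * (L y / y\<^sup>2) * max 1 ((y / real k) ^ 3)"
    using pmf_le_scaled by blast
  \<comment> \<open>Keeps the contribution of the words with small letters only below
    \<open>e / 4 * rate n\<close>; \<open>M\<close> below then bounds the weight of a letter above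
    \<open>s * B n\<close> in units of the weight at \<open>B n\<close>.\<close>
  define s where "s = min 1 (e / (4 * C))"
  have s: "0 < s" "s \<le> 1" "C * s \<le> e / 4"
  proof -
    show "0 < s" "s \<le> 1" using e C by (auto simp: s_def)
    have "C * s \<le> C * (e / (4 * C))" using C by (intro mult_left_mono) (auto simp: s_def)
    then show "C * s \<le> e / 4" using C by simp
  qed
  define d where "d = e / 4 / 16"
  have d: "d > 0" using e by (simp add: d_def)
  define M where "M = 4 * (1 / s) ^ 3"
  have M: "M > 0" using s by (simp add: M_def)
  have e4: "0 < e / 4" "e / 4 < 1" using e by auto
  have conc: "\<forall>\<^sub>F n in sequentially.
      measure_pmf.prob (replicate_pmf (n - 1) \<mu>) {xs. d * B n < \<bar>steps xs + B n\<bar>} < e / (4 * M)"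
    using order_tendstoD(2)[OF steps_concentration[OF d], of "e / (4 * M)"] e M by simp
  have "\<forall>\<^sub>F n in sequentially. y2 \<le> s * B n"
    using filterlim_at_top[THEN iffD1, OF mult_at_top[OF B_at_top s(1)]] by simp
  then show ?thesis
    using C(2)[OF s(1,2)] eventually_pmf_window[OF e4] conc eventually_gt_at_top[of 0] eventually_B_gt[of 0]
  proof eventually_elim
    case (elim n)
    define m where "m = n - 1"
    have nm: "n = Suc m" using elim by (simp add: m_def)
    have sB: "s * B n \<le> B n" using s elim mult_right_mono[of s 1 "B n"] by simp
    define q where "q = L (B n) / (B n)\<^sup>2"
    have q: "q > 0" using y2(2)[of "B n"] elim sB by (simp add: q_def)
    have rate: "rate n = real n * q" by (simp add: rate_def q_def)
    define H1 where "H1 = {k. \<bar>real k - B n\<bar> \<le> d * B n}"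
    define H2 where "H2 = {k. s * B n < real k} - H1"
    let ?P = "measure_pmf.prob (replicate_pmf n \<mu>)"
    have c1: "pmf \<mu> k \<le> (1 + e / 4) * q" if "k \<in> H1" for k
      using elim(3) that by (auto simp: H1_def q_def d_def)
    have c2: "pmf \<mu> k \<le> M * q" if "k \<in> H2" for k
    proof -
      have k: "s * B n < real k" using that by (simp add: H2_def)
      then have k0: "real k > 0" "y2 \<le> real k" using elim y2(1) by linarith+
      have "B n / real k \<le> B n / (s * B n)" using k k0 elim s by (intro divide_left_mono) auto
      also have "\<dots> = 1 / s" using elim by simp
      finally have "(B n / real k) ^ 3 \<le> (1 / s) ^ 3" using elim k0 by (intro power_mono) auto
      moreover have "1 \<le> (1 / s) ^ 3" using s by (intro one_le_power) simp
      ultimately have "max 1 ((B n / real k) ^ 3) \<le> (1 / s) ^ 3" by simp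
      then have "4 * q * max 1 ((B n / real k) ^ 3) \<le> 4 * q * (1 / s) ^ 3" using q by (intro mult_left_mono) auto
      also have "\<dots> = M * q" by (simp add: M_def)
      finally show ?thesis using y2(3)[OF k0(2), of "B n"] elim(1) sB unfolding q_def[symmetric] by linarith
    qed
    have "?P {xs. Suc (sum_list xs) = n} \<le> ?P (({xs. Suc (sum_list xs) = n \<and> (\<forall>x\<in>set xs. real x \<le> s * B n)}
        \<union> {xs. sum_list xs = m \<and> (\<exists>x\<in>set xs. x \<in> H1) \<and> (\<forall>x\<in>set xs. x \<in> UNIV)})
        \<union> {xs. sum_list xs = m \<and> (\<exists>x\<in>set xs. x \<in> H2) \<and> (\<forall>x\<in>set xs. x \<in> UNIV)})"
      by (rule measure_pmf.finite_measure_mono) (auto simp: nm H2_def not_le)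
    also have "\<dots> \<le> ?P {xs. Suc (sum_list xs) = n \<and> (\<forall>x\<in>set xs. real x \<le> s * B n)}
        + ?P {xs. sum_list xs = m \<and> (\<exists>x\<in>set xs. x \<in> H1) \<and> (\<forall>x\<in>set xs. x \<in> UNIV)}
        + ?P {xs. sum_list xs = m \<and> (\<exists>x\<in>set xs. x \<in> H2) \<and> (\<forall>x\<in>set xs. x \<in> UNIV)}"
      by (intro order_trans[OF measure_Un_le] add_mono measure_Un_le) auto
    also have "?P {xs. Suc (sum_list xs) = n \<and> (\<forall>x\<in>set xs. real x \<le> s * B n)} \<le> e / 4 * rate n"
      using s(3) q by (intro order_trans[OF elim(2)] mult_right_mono) (auto simp: rate)
    also have "?P {xs. sum_list xs = m \<and> (\<exists>x\<in>set xs. x \<in> H1) \<and> (\<forall>x\<in>set xs. x \<in> UNIV)} \<le> real n * ((1 + e / 4) * q) * 1"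
    proof -
      have "?P {xs. sum_list xs = m \<and> (\<exists>x\<in>set xs. x \<in> H1) \<and> (\<forall>x\<in>set xs. x \<in> UNIV)} \<le> real n * ((1 + e / 4) * q) *
        measure_pmf.prob (replicate_pmf m \<mu>) {t. sum_list t \<le> m \<and> m - sum_list t \<in> H1 \<and> (\<forall>x\<in>set t. x \<in> UNIV)}"
        unfolding nm by (rule prob_jump_le[OF c1[unfolded nm]]) (use q e nm in auto)
      also have "\<dots> \<le> real n * ((1 + e / 4) * q) * 1"
        using q e by (intro mult_left_mono measure_pmf.prob_le_1) auto
      finally show ?thesis .
    qed
    also have "?P {xs. sum_list xs = m \<and> (\<exists>x\<in>set xs. x \<in> H2) \<and> (\<forall>x\<in>set xs. x \<in> UNIV)} \<le> real n * (M * q) * (e / (4 * M))"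
    proof -
      have "?P {xs. sum_list xs = m \<and> (\<exists>x\<in>set xs. x \<in> H2) \<and> (\<forall>x\<in>set xs. x \<in> UNIV)} \<le> real n * (M * q) *
        measure_pmf.prob (replicate_pmf m \<mu>) {t. sum_list t \<le> m \<and> m - sum_list t \<in> H2 \<and> (\<forall>x\<in>set t. x \<in> UNIV)}"
        unfolding nm by (rule prob_jump_le[OF c2[unfolded nm]]) (use q M nm in auto)
      also have "\<dots> \<le> real n * (M * q) * (e / (4 * M))"
      proof (rule mult_left_mono)
        have "measure_pmf.prob (replicate_pmf m \<mu>) {t. sum_list t \<le> m \<and> m - sum_list t \<in> H2 \<and> (\<forall>x\<in>set t. x \<in> UNIV)}
          \<le> measure_pmf.prob (replicate_pmf m \<mu>) {xs. d * B n < \<bar>steps xs + B n\<bar>}"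
        proof (rule measure_pmf.finite_measure_mono_AE)
          show "AE t in replicate_pmf m \<mu>. t \<in> {t. sum_list t \<le> m \<and> m - sum_list t \<in> H2 \<and> (\<forall>x\<in>set t. x \<in> UNIV)}
              \<longrightarrow> t \<in> {xs. d * B n < \<bar>steps xs + B n\<bar>}"
            using length_replicate_pmf[of m]
            by eventually_elim (auto simp: steps_eq H2_def H1_def of_nat_diff abs_if split: if_splits)
        qed simp
        then show "measure_pmf.prob (replicate_pmf m \<mu>) {t. sum_list t \<le> m \<and> m - sum_list t \<in> H2 \<and> (\<forall>x\<in>set t. x \<in> UNIV)}
          \<le> e / (4 * M)" using elim(4) by (simp add: m_def)
      qed (use q M in auto)
      finally show ?thesis .
    qed
    also have "e / 4 * rate n + real n * ((1 + e / 4) * q) * 1 + real n * (M * q) * (e / (4 * M)) = (1 + 3 / 4 * e) * rate n"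
      using M by (simp add: rate field_simps)
    also have "\<dots> \<le> (1 + e) * rate n" using q e by (intro mult_right_mono) (auto simp: rate)
    finally show ?case by simp
  qed
qed

text \<open>The big letter has to complete the sum of the others to \<open>n - 1\<close>, and by
  concentration it then falls into the window with high probability. The loss \<open>e\<close>
  covers a failure of concentration and the presence of a second large letter. Quantifying over
  \<open>T\<close> inside makes the bound uniform, so that \<open>T\<close> may depend on
  \<open>n\<close>.\<close>

lemma prob_big_jump_ge:
  assumes e: "0 < e" "e < 1" and d: "0 < d" "d \<le> e / 16"
  shows "\<forall>\<^sub>F n in sequentially. \<forall>T.
    (1 - e) * rate n * (measure_pmf.prob (replicate_pmf (n - 1) \<mu>) T - e) \<le>
    measure_pmf.prob (replicate_pmf n \<mu>) {xs. Suc (sum_list xs) = n \<and> (\<exists>k x t. rotate k xs = x # t \<and>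
      \<bar>real x - B n\<bar> \<le> d * B n \<and> (\<forall>y\<in>set t. real y < (1 - d) * B n) \<and> t \<in> T)}"
proof -
  have d1: "1 - d > 0" using e d by linarith
  have conc: "\<forall>\<^sub>F n in sequentially.
      measure_pmf.prob (replicate_pmf (n - 1) \<mu>) {xs. d * B n < \<bar>steps xs + B n\<bar>} < e / 2"
    using order_tendstoD(2)[OF steps_concentration[OF d(1)], of "e / 2"] e by simp
  have tl: "\<forall>\<^sub>F n in sequentially. real n * tail ((1 - d) * B n) < e / 2"
    using order_tendstoD(2)[OF tail_B[OF d1], of "e / 2"] e by simp
  show ?thesis
    using eventually_pmf_window[OF e] conc tl eventually_gt_at_top[of 0] eventually_B_gt[of 0] eventually_L_B_pos
  proof eventually_elim
    case (elim n)
    define m where "m = n - 1"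
    have nm: "n = Suc m" using elim by (simp add: m_def)
    define q where "q = L (B n) / (B n)\<^sup>2"
    have q: "q > 0" using elim by (simp add: q_def)
    define H where "H = {k. \<bar>real k - B n\<bar> \<le> d * B n}"
    have c: "(1 - e) * q \<le> pmf \<mu> k" if "k \<in> H" for k
    proof -
      have "d * B n \<le> e / 16 * B n" using d elim by (intro mult_right_mono) auto
      then show ?thesis using elim(1) that by (auto simp: H_def q_def)
    qed
    show ?case
    proof
      fix T
      let ?P = "measure_pmf.prob (replicate_pmf m \<mu>)"
      \<comment> \<open>Besides keeping the other letters out of \<open>H\<close>, this bound also
        excludes letters above the window, so the distinguished letter is the largest one.\<close>
      define T' where "T' = {t \<in> T. \<forall>y\<in>set t. real y < (1 - d) * B n}"
      define G where "G = {t. sum_list t \<le> m \<and> m - sum_list t \<in> H \<and> (\<forall>x\<in>set t. x \<notin> H) \<and> t \<in> T'}"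
      have "?P T \<le> ?P ((G \<union> {xs. d * B n < \<bar>steps xs + B n\<bar>}) \<union> {xs. \<exists>x\<in>set xs. x \<in> {k. (1 - d) * B n \<le> real k}})"
      proof (rule measure_pmf.finite_measure_mono_AE)
        show "AE t in replicate_pmf m \<mu>. t \<in> T \<longrightarrow>
          t \<in> (G \<union> {xs. d * B n < \<bar>steps xs + B n\<bar>}) \<union> {xs. \<exists>x\<in>set xs. x \<in> {k. (1 - d) * B n \<le> real k}}"
          using length_replicate_pmf[of m]
        proof eventually_elim
          case (elim t)
          show ?case
          proof
            assume "t \<in> T"
            have "t \<in> G" if s: "\<bar>steps t + B n\<bar> \<le> d * B n" and small: "\<forall>y\<in>set t. real y < (1 - d) * B n"
            proof -
              have "d * B n < B n" using d1 \<open>0 < B n\<close> by (simp add: left_diff_distrib)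
              then have "steps t < 0" using s by linarith
              then have le: "sum_list t \<le> m" using elim by (simp add: steps_eq)
              then have "m - sum_list t \<in> H" using s elim by (simp add: H_def steps_eq of_nat_diff abs_if split: if_splits)
              moreover have "x \<notin> H" if "x \<in> set t" for x
                using small that \<open>0 < B n\<close> by (force simp: H_def left_diff_distrib)
              ultimately show ?thesis using le small \<open>t \<in> T\<close> by (simp add: G_def T'_def)
            qed
            then show "t \<in> (G \<union> {xs. d * B n < \<bar>steps xs + B n\<bar>}) \<union> {xs. \<exists>x\<in>set xs. x \<in> {k. (1 - d) * B n \<le> real k}}"
              by (cases "\<bar>steps t + B n\<bar> \<le> d * B n"; cases "\<forall>y\<in>set t. real y < (1 - d) * B n")
                 (auto simp only: not_le not_less mem_Collect_eq Un_iff ball_simps)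
          qed
        qed
      qed simp
      also have "\<dots> \<le> ?P G + ?P {xs. d * B n < \<bar>steps xs + B n\<bar>} + ?P {xs. \<exists>x\<in>set xs. x \<in> {k. (1 - d) * B n \<le> real k}}"
        by (intro order_trans[OF measure_Un_le] add_mono measure_Un_le) auto
      also have "?P {xs. \<exists>x\<in>set xs. x \<in> {k. (1 - d) * B n \<le> real k}} \<le> real m * tail ((1 - d) * B n)"
        unfolding tail_def by (rule prob_replicate_pmf_ex_le)
      also have "real m * tail ((1 - d) * B n) \<le> real n * tail ((1 - d) * B n)"
        using tail_pos[of "(1 - d) * B n"] nm by (intro mult_right_mono) auto
      finally have "?P T - e \<le> ?P G" using elim(2,3) by (simp add: m_def)
      then have "(1 - e) * rate n * (?P T - e) \<le> (1 - e) * rate n * ?P G"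
        using e q by (intro mult_left_mono) (auto simp: rate_def q_def[symmetric])
      also have "\<dots> = real n * ((1 - e) * q) * ?P G" by (simp add: rate_def q_def)
      also have "\<dots> \<le> measure_pmf.prob (replicate_pmf n \<mu>)
          {xs. sum_list xs = m \<and> (\<exists>k x t. rotate k xs = x # t \<and> x \<in> H \<and> (\<forall>x\<in>set t. x \<notin> H) \<and> t \<in> T')}"
        unfolding nm G_def by (rule prob_jump_ge) (use c q e nm in auto)
      also have "\<dots> \<le> measure_pmf.prob (replicate_pmf n \<mu>) {xs. Suc (sum_list xs) = n \<and> (\<exists>k x t. rotate k xs = x # t \<and>
          \<bar>real x - B n\<bar> \<le> d * B n \<and> (\<forall>y\<in>set t. real y < (1 - d) * B n) \<and> t \<in> T)}"
        by (intro measure_pmf.finite_measure_mono) (auto simp: nm H_def T'_def)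
      finally show "(1 - e) * rate n * (measure_pmf.prob (replicate_pmf (n - 1) \<mu>) T - e) \<le>
        measure_pmf.prob (replicate_pmf n \<mu>) {xs. Suc (sum_list xs) = n \<and> (\<exists>k x t. rotate k xs = x # t \<and>
          \<bar>real x - B n\<bar> \<le> d * B n \<and> (\<forall>y\<in>set t. real y < (1 - d) * B n) \<and> t \<in> T)}"
        by (simp add: m_def)
    qed
  qed
qed

end


section \<open>Poisson limit for the counts\<close>

lemma map_replicate_pmf: "map_pmf (map f) (replicate_pmf n p) = replicate_pmf n (map_pmf f p)"
proof (induction n)
  case (Suc n)
  then show ?case
    by (simp add: map_bind_pmf bind_map_pmf Suc[symmetric] map_pmf_def[symmetric])
       (simp add: map_pmf_def bind_assoc_pmf bind_return_pmf)
qed simp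

lemma prod_mset_sum_replicate_mset:
  "finite A \<Longrightarrow> prod_mset (image_mset f (\<Sum>j\<in>A. replicate_mset (d j) j)) = (\<Prod>j\<in>A. f j ^ d j)"
  by (induction A rule: finite_induct) auto

lemma prob_mset_replicate_pmf:
  "measure_pmf.prob (replicate_pmf (size M) p) {xs. mset xs = M} =
     real (card (permutations_of_multiset M)) * prod_mset (image_mset (pmf p) M)"
proof -
  have "measure_pmf.prob (replicate_pmf (size M) p) {xs. mset xs = M} =
      (\<Sum>xs\<in>permutations_of_multiset M. pmf (replicate_pmf (size M) p) xs)"
    unfolding permutations_of_multiset_def[symmetric] by (rule measure_measure_pmf_finite) simp
  also have "\<dots> = (\<Sum>xs\<in>permutations_of_multiset M. prod_mset (image_mset (pmf p) M))"
  proof (rule sum.cong)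
    fix xs assume "xs \<in> permutations_of_multiset M"
    then have "mset xs = M" by (simp add: permutations_of_multiset_def)
    then show "pmf (replicate_pmf (size M) p) xs = prod_mset (image_mset (pmf p) M)"
      by (auto simp: pmf_replicate_pmf prod_mset_prod_list[symmetric])
  qed simp
  finally show ?thesis by simp
qed

text \<open>The letter 0 stands for everything that is not counted. Given the length, the counts of
  the letters \<open>1..R\<close> determine that of 0 and hence the multiset of the word, so the
  multinomial formula applies.\<close>

lemma prob_counts_replicate_pmf:
  fixes p :: "nat pmf" and d :: "nat \<Rightarrow> nat"
  assumes R: "set_pmf p \<subseteq> {..R}" and s: "(\<Sum>j=1..R. d j) \<le> n"
  shows "measure_pmf.prob (replicate_pmf n p) {xs. \<forall>j\<in>{1..R}. count (mset xs) j = d j} =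
    fact n / fact (n - (\<Sum>j=1..R. d j)) * (\<Prod>j=1..R. pmf p j ^ d j / fact (d j)) *
    (1 - (\<Sum>j=1..R. pmf p j)) ^ (n - (\<Sum>j=1..R. d j))"
proof -
  define s where "s = (\<Sum>j=1..R. d j)"
  define d' where "d' = d(0 := n - s)"
  define M where "M = (\<Sum>j\<in>{..R}. replicate_mset (d' j) j)"
  have ins: "{..R} = insert 0 {1..R}" by auto
  have cnt: "count M j = (if j \<le> R then d' j else 0)" for j
    unfolding M_def by (auto simp: count_sum)
  have d'_pos: "d' j = d j" if "j \<in> {1..R}" for j using that by (auto simp: d'_def)
  have sum_pos: "(\<Sum>j=1..R. d' j) = s" unfolding s_def by (intro sum.cong) (auto simp: d'_pos)
  have size: "size M = n"
  proof -
    have "size M = (\<Sum>j\<in>{..R}. d' j)" by (simp add: M_def size_multiset_sum)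
    also have "\<dots> = d' 0 + s" unfolding ins by (subst sum.insert) (use sum_pos in auto)
    finally show ?thesis using s by (simp add: d'_def s_def)
  qed
  have iff: "(\<forall>j\<in>{1..R}. count (mset xs) j = d j) \<longleftrightarrow> mset xs = M"
    if xs: "length xs = n" "set xs \<subseteq> {..R}" for xs
  proof
    assume *: "\<forall>j\<in>{1..R}. count (mset xs) j = d j"
    have pos: "count (mset xs) j = count M j" if "j \<noteq> 0" for j
    proof (cases "j \<le> R")
      case True
      then show ?thesis using * that d'_pos[of j] by (simp add: cnt)
    next
      case False
      then have "j \<notin> set xs" using xs by auto
      then show ?thesis using False by (simp add: cnt count_eq_zero_iff)
    qed
    have "n = (\<Sum>j\<in>{..R}. count (mset xs) j)"
      using xs by (simp flip: size_mset add: size_multiset_overloaded_eq)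
         (auto intro!: sum.mono_neutral_left simp: not_in_iff)
    also have "\<dots> = count (mset xs) 0 + (\<Sum>j=1..R. d' j)"
      unfolding ins using * by (subst sum.insert) (auto intro!: sum.cong simp: d'_pos)
    finally have "n = count (mset xs) 0 + s" by (simp only: sum_pos)
    then have "count (mset xs) 0 = d' 0" by (simp add: d'_def)
    then show "mset xs = M" using pos by (intro multiset_eqI) (metis cnt le0)
  next
    assume "mset xs = M"
    then show "\<forall>j\<in>{1..R}. count (mset xs) j = d j" by (auto simp: cnt d'_def)
  qed
  have "measure_pmf.prob (replicate_pmf n p) {xs. \<forall>j\<in>{1..R}. count (mset xs) j = d j} =
      measure_pmf.prob (replicate_pmf (size M) p) {xs. mset xs = M}"
    unfolding size
  proof (rule measure_pmf.finite_measure_eq_AE)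
    show "AE xs in replicate_pmf n p. (xs \<in> {xs. \<forall>j\<in>{1..R}. count (mset xs) j = d j}) = (xs \<in> {xs. mset xs = M})"
    proof (rule AE_pmfI)
      fix xs assume "xs \<in> set_pmf (replicate_pmf n p)"
      then have "length xs = n" "set xs \<subseteq> {..R}" using R by (auto simp: set_replicate_pmf)
      then show "(xs \<in> {xs. \<forall>j\<in>{1..R}. count (mset xs) j = d j}) = (xs \<in> {xs. mset xs = M})"
        using iff by simp
    qed
  qed auto
  also have "\<dots> = real (card (permutations_of_multiset M)) * prod_mset (image_mset (pmf p) M)"
    by (rule prob_mset_replicate_pmf)
  also have "prod_mset (image_mset (pmf p) M) = (\<Prod>j\<in>{..R}. pmf p j ^ d' j)"
    unfolding M_def by (rule prod_mset_sum_replicate_mset) simp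
  also have "\<dots> = pmf p 0 ^ (n - s) * (\<Prod>j=1..R. pmf p j ^ d j)"
    unfolding ins by (subst prod.insert) (auto simp: d'_def)
  also have "pmf p 0 = 1 - (\<Sum>j=1..R. pmf p j)"
  proof -
    have "(\<Sum>j\<in>{..R}. pmf p j) = 1" using R by (intro sum_pmf_eq_1) auto
    then show ?thesis unfolding ins by (subst (asm) sum.insert) auto
  qed
  also have "real (card (permutations_of_multiset M)) = fact n / (fact (n - s) * (\<Prod>j=1..R. fact (d j)))"
  proof -
    have "(\<Prod>x\<in>set_mset M. fact (count M x)) = (\<Prod>j\<in>{..R}. fact (d' j) :: nat)"
      by (rule prod.mono_neutral_cong_left) (auto simp: cnt set_mset_def intro!: gr0I)
    also have "\<dots> = fact (n - s) * (\<Prod>j=1..R. fact (d j))"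
      unfolding ins by (subst prod.insert) (auto simp: d'_def)
    finally have "card (permutations_of_multiset M) * (fact (n - s) * (\<Prod>j=1..R. fact (d j))) = fact n"
      using card_permutations_of_multiset_aux[of M] by (simp add: size)
    then have "real (card (permutations_of_multiset M) * (fact (n - s) * (\<Prod>j=1..R. fact (d j)))) = real (fact n)"
      by (simp only:)
    then have "real (card (permutations_of_multiset M)) * (fact (n - s) * (\<Prod>j=1..R. fact (d j))) = fact n"
      by simp
    then show ?thesis by (simp add: field_simps)
  qed
  finally show ?thesis unfolding s_def[symmetric] by (simp add: prod_dividef)
qed

lemma fact_ratio_tendsto: "(\<lambda>n. fact n / (fact (n - s) * real n ^ s)) \<longlonglongrightarrow> (1::real)"
proof (induction s)
  case 0
  then show ?case by simp
next
  case (Suc s)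
  have "(\<lambda>n. 1 - real s * inverse (real n)) \<longlonglongrightarrow> 1 - real s * 0"
    by (intro tendsto_intros tendsto_inverse_0_at_top filterlim_real_sequentially)
  then have "(\<lambda>n. fact n / (fact (n - s) * real n ^ s) * (1 - real s * inverse (real n))) \<longlonglongrightarrow> 1 * (1 - real s * 0)"
    by (intro tendsto_mult Suc)
  then have lim: "(\<lambda>n. fact n / (fact (n - s) * real n ^ s) * (1 - real s * inverse (real n))) \<longlonglongrightarrow> (1::real)" by simp
  have "\<forall>\<^sub>F n in sequentially. fact n / (fact (n - s) * real n ^ s) * (1 - real s * inverse (real n)) =
      fact n / (fact (n - Suc s) * real n ^ Suc s)"
    using eventually_gt_at_top[of s]
  proof eventually_elim
    case (elim n)
    then obtain k where k: "n = Suc (k + s)" using less_imp_Suc_add by (metis add.commute)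
    have "1 - real s * inverse (real n) = real (n - s) / real n"
      using elim by (simp add: field_simps of_nat_diff)
    moreover have "fact (n - s) = real (n - s) * fact (n - Suc s)" by (simp add: k)
    ultimately show ?case using elim by simp
  qed
  then show ?case using lim by (rule Lim_transform_eventually[rotated])
qed

lemma power_tendsto_exp:
  fixes c :: "nat \<Rightarrow> real"
  assumes N: "filterlim N at_top sequentially" and c0: "\<And>n. c n \<ge> 0" and c: "(\<lambda>n. real (N n) * c n) \<longlonglongrightarrow> l"
  shows "(\<lambda>n. (1 - c n) ^ (N n - s)) \<longlonglongrightarrow> exp (- l)"
proof -
  have N': "filterlim (\<lambda>n. real (N n)) at_top sequentially"
    by (rule filterlim_compose[OF filterlim_real_sequentially N])
  have inv: "(\<lambda>n. inverse (real (N n))) \<longlonglongrightarrow> 0" by (rule tendsto_inverse_0_at_top[OF N'])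
  note Npos = eventually_compose_filterlim[OF eventually_gt_at_top[of s] N]
  have "(\<lambda>n. real (N n) * c n * inverse (real (N n))) \<longlonglongrightarrow> l * 0" by (intro tendsto_mult c inv)
  then have "(\<lambda>n. real (N n) * c n * inverse (real (N n))) \<longlonglongrightarrow> 0" by simp
  moreover have "\<forall>\<^sub>F n in sequentially. real (N n) * c n * inverse (real (N n)) = c n"
    using Npos by eventually_elim simp
  ultimately have c_lim: "c \<longlonglongrightarrow> 0" by (rule Lim_transform_eventually)
  have small: "\<forall>\<^sub>F n in sequentially. c n < 1/2" using order_tendstoD(2)[OF c_lim, of "1/2"] by simp
  have Nc: "(\<lambda>n. real (N n - s) * c n) \<longlonglongrightarrow> l"
  proof -
    have "(\<lambda>n. real (N n) * c n - real s * c n) \<longlonglongrightarrow> l - real s * 0"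
      by (intro tendsto_intros c c_lim)
    then have "(\<lambda>n. real (N n) * c n - real s * c n) \<longlonglongrightarrow> l" by simp
    moreover have "\<forall>\<^sub>F n in sequentially. real (N n) * c n - real s * c n = real (N n - s) * c n"
      using Npos by eventually_elim (simp add: of_nat_diff left_diff_distrib)
    ultimately show ?thesis by (rule Lim_transform_eventually)
  qed
  have "(\<lambda>n. real (N n - s) * ln (1 - c n)) \<longlonglongrightarrow> - l"
  proof (rule tendsto_sandwich)
    show "\<forall>\<^sub>F n in sequentially. - (real (N n - s) * c n) - 2 * (real (N n - s) * c n) * c n \<le> real (N n - s) * ln (1 - c n)"
      using small
    proof eventually_elim
      case (elim n)
      have "real (N n - s) * (- c n - 2 * (c n)\<^sup>2) \<le> real (N n - s) * ln (1 - c n)"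
        using elim c0[of n] by (intro mult_left_mono ln_one_minus_pos_lower_bound) auto
      then show ?case by (simp add: power2_eq_square algebra_simps)
    qed
    show "\<forall>\<^sub>F n in sequentially. real (N n - s) * ln (1 - c n) \<le> - (real (N n - s) * c n)"
      using small
    proof eventually_elim
      case (elim n)
      have "ln (1 - c n) \<le> - c n" using ln_add_one_self_le_self2[of "- c n"] elim by simp
      then have "real (N n - s) * ln (1 - c n) \<le> real (N n - s) * (- c n)" by (intro mult_left_mono) auto
      then show ?case by simp
    qed
    have "(\<lambda>n. - (real (N n - s) * c n) - 2 * (real (N n - s) * c n) * c n) \<longlonglongrightarrow> - l - 2 * l * 0"
      by (intro tendsto_intros Nc c_lim)
    then show "(\<lambda>n. - (real (N n - s) * c n) - 2 * (real (N n - s) * c n) * c n) \<longlonglongrightarrow> - l" by simp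
    show "(\<lambda>n. - (real (N n - s) * c n)) \<longlonglongrightarrow> - l" by (intro tendsto_intros Nc)
  qed
  then have "(\<lambda>n. exp (real (N n - s) * ln (1 - c n))) \<longlonglongrightarrow> exp (- l)" by (rule tendsto_exp)
  moreover have "\<forall>\<^sub>F n in sequentially. exp (real (N n - s) * ln (1 - c n)) = (1 - c n) ^ (N n - s)"
    using small by eventually_elim (simp add: exp_of_nat_mult)
  ultimately show ?thesis by (rule Lim_transform_eventually)
qed

text \<open>The multinomial formula splits into three factors: the falling factorial over
  \<open>N n ^ s\<close> tends to 1, the scaled weights converge termwise, and the probability of
  the uncounted letter yields the product of the exponentials.\<close>

lemma multinomial_tendsto_poisson:
  fixes p :: "nat \<Rightarrow> nat pmf" and d :: "nat \<Rightarrow> nat" and l :: "nat \<Rightarrow> real"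
  assumes R: "\<And>n. set_pmf (p n) \<subseteq> {..R}" and N: "filterlim N at_top sequentially"
    and l: "\<And>j. j \<in> {1..R} \<Longrightarrow> (\<lambda>n. real (N n) * pmf (p n) j) \<longlonglongrightarrow> l j"
  shows "(\<lambda>n. measure_pmf.prob (replicate_pmf (N n) (p n)) {xs. \<forall>j\<in>{1..R}. count (mset xs) j = d j})
    \<longlonglongrightarrow> (\<Prod>j=1..R. exp (- l j) * l j ^ d j / fact (d j))"
proof -
  define s where "s = (\<Sum>j=1..R. d j)"
  have "(\<lambda>n. fact (N n) / (fact (N n - s) * real (N n) ^ s)) \<longlonglongrightarrow> (1::real)"
    by (rule filterlim_compose[OF fact_ratio_tendsto N])
  moreover have "(\<lambda>n. \<Prod>j=1..R. (real (N n) * pmf (p n) j) ^ d j / fact (d j)) \<longlonglongrightarrow> (\<Prod>j=1..R. l j ^ d j / fact (d j))"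
    by (intro tendsto_prod tendsto_divide tendsto_power l tendsto_const) auto
  moreover have "(\<lambda>n. (1 - (\<Sum>j=1..R. pmf (p n) j)) ^ (N n - s)) \<longlonglongrightarrow> exp (- (\<Sum>j=1..R. l j))"
  proof (rule power_tendsto_exp[OF N])
    show "(\<lambda>n. real (N n) * (\<Sum>j=1..R. pmf (p n) j)) \<longlonglongrightarrow> (\<Sum>j=1..R. l j)"
      unfolding sum_distrib_left by (intro tendsto_sum l) auto
  qed (auto intro: sum_nonneg)
  ultimately have lim: "(\<lambda>n. fact (N n) / (fact (N n - s) * real (N n) ^ s) *
      (\<Prod>j=1..R. (real (N n) * pmf (p n) j) ^ d j / fact (d j)) *
      (1 - (\<Sum>j=1..R. pmf (p n) j)) ^ (N n - s)) \<longlonglongrightarrow>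
      1 * (\<Prod>j=1..R. l j ^ d j / fact (d j)) * exp (- (\<Sum>j=1..R. l j))"
    by (intro tendsto_mult)
  have eq: "1 * (\<Prod>j=1..R. l j ^ d j / fact (d j)) * exp (- (\<Sum>j=1..R. l j)) =
      (\<Prod>j=1..R. exp (- l j) * l j ^ d j / fact (d j))"
    by (simp add: sum_negf[symmetric] exp_sum prod.distrib[symmetric] mult.commute)
  have ev: "\<forall>\<^sub>F n in sequentially. fact (N n) / (fact (N n - s) * real (N n) ^ s) *
      (\<Prod>j=1..R. (real (N n) * pmf (p n) j) ^ d j / fact (d j)) *
      (1 - (\<Sum>j=1..R. pmf (p n) j)) ^ (N n - s) =
      measure_pmf.prob (replicate_pmf (N n) (p n)) {xs. \<forall>j\<in>{1..R}. count (mset xs) j = d j}"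
    using eventually_compose_filterlim[OF eventually_gt_at_top[of s] N]
  proof eventually_elim
    case (elim n)
    have "(\<Prod>j=1..R. (real (N n) * pmf (p n) j) ^ d j / fact (d j)) =
        real (N n) ^ s * (\<Prod>j=1..R. pmf (p n) j ^ d j / fact (d j))"
      by (simp add: power_mult_distrib prod.distrib power_sum s_def prod_dividef)
    moreover note prob_counts_replicate_pmf[OF R, where d = d and n = "N n", folded s_def, OF less_imp_le[OF elim]]
    ultimately show ?case using elim by simp
  qed
  show ?thesis using Lim_transform_eventually[OF lim ev] unfolding eq .
qed

text \<open>The index of the interval of length \<open>2\<^sup>-\<^sup>m\<close> containing \<open>y\<close>, cut off at height \<open>m\<close>.\<close>

definition cell :: "nat \<Rightarrow> real \<Rightarrow> nat" where
  "cell m y = min (m * 2 ^ m) (nat \<lfloor>y * 2 ^ m\<rfloor>)"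

text \<open>For \<open>j\<close> between 1 and \<open>m * 2 ^ m\<close>, this is the integral of
  \<open>1 / x^2\<close> over the cell: an interval of length \<open>1 / 2 ^ m\<close>, except for
  the last cell, which is the half-line starting at \<open>m\<close>.\<close>

definition cell_rate :: "nat \<Rightarrow> nat \<Rightarrow> real" where
  "cell_rate m j = 2 ^ m / j - (if j < m * 2 ^ m then 2 ^ m / Suc j else 0)"

lemma cell_le [simp]: "cell m y \<le> m * 2 ^ m"
  by (simp add: cell_def)

lemma cell_ge_iff:
  assumes "1 \<le> j" "j \<le> m * 2 ^ m"
  shows "j \<le> cell m y \<longleftrightarrow> real j / 2 ^ m \<le> y"
proof -
  have "j \<le> cell m y \<longleftrightarrow> j \<le> nat \<lfloor>y * 2 ^ m\<rfloor>" using assms by (simp add: cell_def)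
  also have "\<dots> \<longleftrightarrow> int j \<le> \<lfloor>y * 2 ^ m\<rfloor>" using assms by linarith
  also have "\<dots> \<longleftrightarrow> real j \<le> y * 2 ^ m" by (simp add: le_floor_iff)
  finally show ?thesis by (simp add: field_simps)
qed

lemma cell_eq_iff:
  assumes "1 \<le> j" "j \<le> m * 2 ^ m"
  shows "cell m y = j \<longleftrightarrow> real j / 2 ^ m \<le> y \<and> (j < m * 2 ^ m \<longrightarrow> \<not> real (Suc j) / 2 ^ m \<le> y)"
proof -
  have "cell m y = j \<longleftrightarrow> j \<le> cell m y \<and> (j < m * 2 ^ m \<longrightarrow> \<not> Suc j \<le> cell m y)"
  proof -
    have "c = j \<longleftrightarrow> j \<le> c \<and> (j < r \<longrightarrow> \<not> Suc j \<le> c)" if "c \<le> r" "j \<le> r" for c r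
      using that by auto
    then show ?thesis using cell_le assms(2) by blast
  qed
  then show ?thesis using cell_ge_iff[OF assms] cell_ge_iff[of "Suc j" m y] by auto
qed

lemma measurable_cell [measurable]: "cell m \<in> measurable borel (count_space UNIV)"
  unfolding cell_def by measurable

lemma sum_count_cell_ge:
  fixes c :: "'a \<Rightarrow> nat"
  assumes "\<And>x. x \<in> set xs \<Longrightarrow> c x \<le> R" "j \<le> R"
  shows "(\<Sum>l=j..R. count (mset (map c xs)) l) = length (filter (\<lambda>x. j \<le> c x) xs)"
  using assms(1)
proof (induction xs)
  case (Cons x xs)
  have "(\<Sum>l=j..R. count (mset (map c (x # xs))) l) =
      (\<Sum>l=j..R. count (mset (map c xs)) l) + (\<Sum>l=j..R. if l = c x then 1 else 0)"
    by (subst sum.distrib[symmetric]) (auto intro!: sum.cong)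
  also have "(\<Sum>l=j..R. if l = c x then 1 else 0 :: nat) = (if j \<le> c x then 1 else 0)"
    using Cons.prems[of x] by (subst sum.delta) auto
  finally show ?case using Cons by simp
qed simp

section \<open>The Poisson measure on horizontal strips\<close>

lemma sets_limit_intensity [simp, measurable_cong]: "sets limit_intensity = sets borel"
  by (simp add: limit_intensity_def)

lemma sets_borel_strip [measurable (raw)]:
  assumes "A \<in> sets borel"
  shows "{z :: real \<times> real. snd z \<in> A} \<in> sets borel"
proof -
  have "snd -` A \<inter> space (borel \<Otimes>\<^sub>M borel) \<in> sets (borel \<Otimes>\<^sub>M borel :: (real \<times> real) measure)"
    by (rule measurable_sets[OF measurable_snd assms])
  then show ?thesis unfolding borel_prod by (simp add: vimage_def)
qed

lemma sets_borel_cell: "{z :: real \<times> real. cell m (snd z) = j} \<in> sets borel"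
  using sets_borel_strip[of "{y. cell m y = j}"] by simp

text \<open>By Tonelli; the time coordinate runs over an interval of length 1 and integrates
  out.\<close>

lemma emeasure_limit_intensity_strip:
  assumes [measurable]: "A \<in> sets borel"
  shows "emeasure limit_intensity {z. snd z \<in> A} =
    (\<integral>\<^sup>+x. ennreal (1 / x\<^sup>2) * indicator ({0<..} \<inter> A) x \<partial>lborel)"
proof -
  have "emeasure limit_intensity {z. snd z \<in> A} =
     (\<integral>\<^sup>+z. (case z of (t, x) \<Rightarrow> indicator ({0..1} \<times> {0<..}) (t, x) * ennreal (1 / x\<^sup>2)) * indicator {z. snd z \<in> A} z
       \<partial>(lborel \<Otimes>\<^sub>M lborel :: (real \<times> real) measure))"
  proof -
    have "{z :: real \<times> real. snd z \<in> A} \<in> sets (lborel \<Otimes>\<^sub>M lborel)"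
      unfolding lborel_prod using sets_borel_strip[OF assms] by simp
    then show ?thesis
      unfolding limit_intensity_def lborel_prod[symmetric] by (subst emeasure_density) simp_all
  qed
  also have "\<dots> = (\<integral>\<^sup>+z. (case z of (t, x) \<Rightarrow> indicator {0..1} t * (ennreal (1 / x\<^sup>2) * indicator ({0<..} \<inter> A) x))
       \<partial>(lborel \<Otimes>\<^sub>M lborel :: (real \<times> real) measure))"
    by (intro nn_integral_cong) (auto simp: indicator_def)
  also have "\<dots> = (\<integral>\<^sup>+x. \<integral>\<^sup>+(t::real). indicator {0..1} t * (ennreal (1 / x\<^sup>2) * indicator ({0<..} \<inter> A) x) \<partial>lborel \<partial>lborel)"
    by (subst lborel_pair.nn_integral_snd[symmetric]) auto
  also have "\<dots> = (\<integral>\<^sup>+x. ennreal (1 / x\<^sup>2) * indicator ({0<..} \<inter> A) x \<partial>lborel)"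
    by (intro nn_integral_cong) (simp add: nn_integral_multc)
  finally show ?thesis .
qed

lemma emeasure_limit_intensity_tail:
  assumes "u > 0"
  shows "emeasure limit_intensity {z. u \<le> snd z} = ennreal (1 / u)"
proof -
  have "emeasure limit_intensity {z. snd z \<in> {u..}} =
      (\<integral>\<^sup>+x. ennreal (1 / x\<^sup>2) * indicator ({0<..} \<inter> {u..}) x \<partial>lborel)"
    by (rule emeasure_limit_intensity_strip) simp
  also have "{0<..} \<inter> {u..} = {u..}" using assms by auto
  also have "(\<integral>\<^sup>+x. ennreal (1 / x\<^sup>2) * indicator {u..} x \<partial>lborel) = ennreal (0 - (- (1 / u)))"
  proof (rule nn_integral_FTC_atLeast)
    show "((\<lambda>x. - (1 / x)) \<longlongrightarrow> (0::real)) at_top"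
      using tendsto_minus[OF tendsto_inverse_0_at_top[OF filterlim_ident]] by (simp add: divide_inverse)
    fix x assume "u \<le> x"
    then show "DERIV (\<lambda>x. - (1 / x)) x :> 1 / x\<^sup>2"
      using assms by (auto intro!: derivative_eq_intros simp: power2_eq_square)
  qed auto
  finally show ?thesis by simp
qed

lemma limit_intensity_nonpos: "emeasure limit_intensity {z. snd z \<le> 0} = 0"
proof -
  have "emeasure limit_intensity {z. snd z \<in> {..0}} =
      (\<integral>\<^sup>+x. ennreal (1 / x\<^sup>2) * indicator ({0<..} \<inter> {..0}) x \<partial>lborel)"
    by (rule emeasure_limit_intensity_strip) simp
  also have "{0<..} \<inter> {..0::real} = {}" by auto
  finally show ?thesis by simp
qed

lemma emeasure_limit_intensity_cell:
  assumes j: "1 \<le> j" "j \<le> m * 2 ^ m"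
  shows "emeasure limit_intensity {z. cell m (snd z) = j} = ennreal (cell_rate m j)"
    and "cell_rate m j \<ge> 0"
proof -
  define Y where "Y k = {z :: real \<times> real. real k / 2 ^ m \<le> snd z}" for k
  have t: "emeasure limit_intensity (Y k) = ennreal (2 ^ m / k)" if "k \<ge> 1" for k
    using emeasure_limit_intensity_tail[of "real k / 2 ^ m"] that by (simp add: Y_def)
  have Y: "Y k \<in> sets limit_intensity" for k
    using sets_borel_strip[of "{real k / 2 ^ m..}"] by (simp add: Y_def)
  have "2 ^ m / real (Suc j) \<le> 2 ^ m / real j" using j by (intro divide_left_mono) auto
  then show "cell_rate m j \<ge> 0" by (auto simp: cell_rate_def)
  show "emeasure limit_intensity {z. cell m (snd z) = j} = ennreal (cell_rate m j)"
  proof (cases "j < m * 2 ^ m")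
    case True
    have "{z. cell m (snd z) = j} = Y j - Y (Suc j)"
      unfolding Y_def using True by (auto simp only: cell_eq_iff[OF j])
    then have "emeasure limit_intensity {z. cell m (snd z) = j} = emeasure limit_intensity (Y j - Y (Suc j))"
      by (rule arg_cong)
    also have "\<dots> = emeasure limit_intensity (Y j) - emeasure limit_intensity (Y (Suc j))"
    proof (rule emeasure_Diff)
      show "emeasure limit_intensity (Y (Suc j)) \<noteq> \<infinity>" by (subst t) auto
      have "real j / 2 ^ m \<le> real (Suc j) / 2 ^ m" by (intro divide_right_mono) auto
      then show "Y (Suc j) \<subseteq> Y j" unfolding Y_def by (auto simp only: mem_Collect_eq intro: order_trans)
    qed (rule Y)+
    also have "\<dots> = ennreal (2 ^ m / j) - ennreal (2 ^ m / Suc j)"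
      using t[of j] t[of "Suc j"] j(1) by simp
    also have "\<dots> = ennreal (2 ^ m / j - 2 ^ m / Suc j)"
      by (rule ennreal_minus) simp
    finally show ?thesis using True by (simp add: cell_rate_def)
  next
    case False
    then have "{z. cell m (snd z) = j} = Y j"
      unfolding Y_def by (simp only: cell_eq_iff[OF j]) simp
    then show ?thesis using t[of j] j False by (simp add: cell_rate_def)
  qed
qed

lemma
  assumes "poisson_random_measure P \<nu> N"
  shows poisson_random_measure_prob_space: "prob_space P"
    and poisson_random_measure_measurable:
      "A \<in> sets \<nu> \<Longrightarrow> (\<lambda>\<omega>. emeasure (N \<omega>) A) \<in> borel_measurable P"
    and poisson_random_measure_prob: "A \<in> sets \<nu> \<Longrightarrow> emeasure \<nu> A < \<infinity> \<Longrightarrow>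
      measure P {\<omega>\<in>space P. emeasure (N \<omega>) A = of_nat k} = exp (- measure \<nu> A) * measure \<nu> A ^ k / fact k"
    and poisson_random_measure_indep: "range A' \<subseteq> sets \<nu> \<Longrightarrow> disjoint_family A' \<Longrightarrow>
      prob_space.indep_vars P (\<lambda>_. borel) (\<lambda>i \<omega>. emeasure (N \<omega>) (A' i)) (UNIV :: nat set)"
  using assms unfolding poisson_random_measure_def by simp_all

text \<open>The cells with positive index are disjoint strips of finite mass, so their counts are
  independent Poisson variables. The case \<open>m = 0\<close> is separate because there are then no
  such cells, and independence is used for a nonempty index set.\<close>

lemma poisson_random_measure_cells:
  assumes N: "poisson_random_measure P limit_intensity N"
  shows "measure P {\<omega>\<in>space P. \<forall>j\<in>{1..m * 2 ^ m}. emeasure (N \<omega>) {z. cell m (snd z) = j} = of_nat (d j)} =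
     (\<Prod>j=1..m * 2 ^ m. exp (- cell_rate m j) * cell_rate m j ^ d j / fact (d j))"
proof (cases "m = 0")
  case True
  interpret prob_space P using N by (rule poisson_random_measure_prob_space)
  show ?thesis using True by (simp add: prob_space)
next
  case False
  interpret prob_space P using N by (rule poisson_random_measure_prob_space)
  define A where "A j = {z :: real \<times> real. cell m (snd z) = j}" for j
  have A: "A j \<in> sets limit_intensity" for j unfolding A_def using sets_borel_cell by simp
  have "disjoint_family A" by (auto simp: A_def disjoint_family_on_def)
  then have ind: "indep_vars (\<lambda>_. borel) (\<lambda>i \<omega>. emeasure (N \<omega>) (A i)) UNIV"
    using A by (intro poisson_random_measure_indep[OF N]) auto
  let ?J = "{1..m * 2 ^ m}"
  have ne: "?J \<noteq> {}" using False by auto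
  have "{\<omega>\<in>space P. \<forall>j\<in>?J. emeasure (N \<omega>) (A j) = of_nat (d j)} =
      (\<Inter>j\<in>?J. (\<lambda>\<omega>. emeasure (N \<omega>) (A j)) -` {of_nat (d j)} \<inter> space P)"
    using ne by auto
  also have "prob \<dots> = (\<Prod>j\<in>?J. prob ((\<lambda>\<omega>. emeasure (N \<omega>) (A j)) -` {of_nat (d j)} \<inter> space P))"
    by (rule indep_varsD[OF ind]) (use ne in auto)
  also have "\<dots> = (\<Prod>j\<in>?J. exp (- cell_rate m j) * cell_rate m j ^ d j / fact (d j))"
  proof (rule prod.cong)
    fix j assume "j \<in> ?J"
    then have j: "1 \<le> j" "j \<le> m * 2 ^ m" by auto
    note e = emeasure_limit_intensity_cell[OF j, folded A_def]
    have m: "measure limit_intensity (A j) = cell_rate m j" using e by (simp add: measure_def)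
    have "emeasure limit_intensity (A j) < \<infinity>" using e by simp
    then have "prob {\<omega>\<in>space P. emeasure (N \<omega>) (A j) = of_nat (d j)} =
        exp (- cell_rate m j) * cell_rate m j ^ d j / fact (d j)"
      using poisson_random_measure_prob[OF N A, of j "d j"] unfolding m by simp
    moreover have "(\<lambda>\<omega>. emeasure (N \<omega>) (A j)) -` {of_nat (d j)} \<inter> space P =
        {\<omega>\<in>space P. emeasure (N \<omega>) (A j) = of_nat (d j)}" by auto
    ultimately show "prob ((\<lambda>\<omega>. emeasure (N \<omega>) (A j)) -` {of_nat (d j)} \<inter> space P) =
        exp (- cell_rate m j) * cell_rate m j ^ d j / fact (d j)" by simp
  qed simp
  finally show ?thesis by (simp add: A_def)
qed

text \<open>The probabilities of the values \<open>0, 1, ...\<close> sum to 1 by the exponential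
  series, which leaves no mass for the value infinity.\<close>

lemma poisson_random_measure_AE_finite:
  assumes N: "poisson_random_measure P \<nu> N" and A: "A \<in> sets \<nu>" "emeasure \<nu> A < \<infinity>"
  shows "AE \<omega> in P. \<exists>k. emeasure (N \<omega>) A = of_nat k"
proof -
  interpret prob_space P using N by (rule poisson_random_measure_prob_space)
  have [measurable]: "(\<lambda>\<omega>. emeasure (N \<omega>) A) \<in> borel_measurable P"
    using A by (intro poisson_random_measure_measurable[OF N])
  define E where "E k = {\<omega>\<in>space P. emeasure (N \<omega>) A = of_nat k}" for k
  have E: "prob (E k) = exp (- measure \<nu> A) * measure \<nu> A ^ k / fact k" for k
    unfolding E_def by (rule poisson_random_measure_prob[OF N A])
  have "(\<lambda>k. prob (E k)) sums prob (\<Union>k. E k)"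
    by (rule finite_measure_UNION) (auto simp: E_def disjoint_family_on_def)
  moreover have "(\<lambda>k. exp (- measure \<nu> A) * (measure \<nu> A ^ k / fact k)) sums (exp (- measure \<nu> A) * exp (measure \<nu> A))"
    using exp_converges[of "measure \<nu> A"] by (intro sums_mult) (simp add: divide_inverse mult.commute)
  then have "(\<lambda>k. prob (E k)) sums 1" by (simp add: E exp_minus)
  ultimately have "prob (\<Union>k. E k) = 1" by (rule sums_unique2)
  then have "AE \<omega> in P. \<omega> \<in> (\<Union>k. E k)" by (subst AE_in_set_eq_1) (auto simp: E_def)
  then show ?thesis by eventually_elim (auto simp: E_def)
qed

lemma poisson_random_measure_AE_zero:
  assumes N: "poisson_random_measure P \<nu> N" and A: "A \<in> sets \<nu>" "emeasure \<nu> A = 0"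
  shows "AE \<omega> in P. emeasure (N \<omega>) A = 0"
proof -
  interpret prob_space P using N by (rule poisson_random_measure_prob_space)
  have [measurable]: "(\<lambda>\<omega>. emeasure (N \<omega>) A) \<in> borel_measurable P"
    using A by (intro poisson_random_measure_measurable[OF N])
  have "emeasure \<nu> A < \<infinity>" using A by simp
  then have "prob {\<omega>\<in>space P. emeasure (N \<omega>) A = of_nat 0} = exp (- measure \<nu> A) * measure \<nu> A ^ 0 / fact 0"
    by (rule poisson_random_measure_prob[OF N A(1)])
  then have "prob {\<omega>\<in>space P. emeasure (N \<omega>) A = 0} = 1" using A by (simp add: measure_def)
  then have "AE \<omega> in P. \<omega> \<in> {\<omega>\<in>space P. emeasure (N \<omega>) A = 0}" by (subst AE_in_set_eq_1) auto
  then show ?thesis by eventually_elim auto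
qed

lemma initial_segment_eq:
  fixes U :: "nat set"
  assumes "finite U" "0 \<notin> U" and down: "\<And>i j. 1 \<le> i \<Longrightarrow> i \<le> j \<Longrightarrow> j \<in> U \<Longrightarrow> i \<in> U"
  shows "U = {1..card U}"
proof (cases "U = {}")
  case False
  have "U = {1..Max U}"
  proof (intro equalityI subsetI)
    fix i assume "i \<in> U"
    then show "i \<in> {1..Max U}" using assms by (cases "i = 0") auto
  next
    fix i assume "i \<in> {1..Max U}"
    then show "i \<in> U" using down[of i "Max U"] Max_in[OF assms(1) False] by auto
  qed
  then show ?thesis by (metis card_atLeastAtMost diff_Suc_1)
qed simp

text \<open>By monotonicity the indices \<open>i\<close> with \<open>d i\<close> above a dyadic
  level form an initial segment of the positive integers, and its length is the number of atoms in
  the cells above that level. So the cell counts locate every \<open>d i\<close> up to the mesh of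
  the dyadic grid.\<close>

lemma decreasing_rearrangement_cells:
  assumes dr: "decreasing_rearrangement M d" and zero: "emeasure M {z. snd z \<le> 0} = 0"
    and c: "\<And>l. l \<in> {1..m * 2 ^ m} \<Longrightarrow> emeasure M {z. cell m (snd z) = l} = of_nat (c l)"
  shows "\<And>i. 1 \<le> i \<Longrightarrow> d i > 0"
    and "\<And>i j. 1 \<le> i \<Longrightarrow> j \<in> {1..m * 2 ^ m} \<Longrightarrow>
      real j / 2 ^ m \<le> d i \<longleftrightarrow> i \<le> (\<Sum>l=j..m * 2 ^ m. c l)"
proof -
  obtain p :: "nat \<Rightarrow> real \<times> real" where p: "M = distr (count_space {1..}) borel p"
      "\<And>i. i \<ge> 1 \<Longrightarrow> d i = snd (p i)" "\<And>i j. 1 \<le> i \<Longrightarrow> i \<le> j \<Longrightarrow> d j \<le> d i"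
    using dr unfolding decreasing_rearrangement_def by blast
  have em: "emeasure M {z. Q (snd z)} = emeasure (count_space {1..}) {i. 1 \<le> i \<and> Q (d i)}"
    if "{z :: real \<times> real. Q (snd z)} \<in> sets borel" for Q
  proof -
    have "p -` {z. Q (snd z)} \<inter> space (count_space {1..}) = {i. 1 \<le> i \<and> Q (d i)}" using p(2) by auto
    then show ?thesis unfolding p(1) by (subst emeasure_distr) (use that in auto)
  qed
  show "d i > 0" if "1 \<le> i" for i
  proof -
    have "emeasure (count_space {1..}) {i. 1 \<le> i \<and> d i \<le> 0} = 0"
      using zero sets_borel_strip[of "{..0}"] by (subst em[symmetric]) auto
    then have "{i. 1 \<le> i \<and> d i \<le> 0} = {}" by (subst (asm) emeasure_count_space_eq_0) auto
    then have "\<not> d i \<le> 0" using that by blast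
    then show ?thesis by simp
  qed
  show "real j / 2 ^ m \<le> d i \<longleftrightarrow> i \<le> (\<Sum>l=j..m * 2 ^ m. c l)" if i: "1 \<le> i" and j: "j \<in> {1..m * 2 ^ m}" for i j
  proof -
    define S where "S l = {i. 1 \<le> i \<and> cell m (d i) = l}" for l
    have S: "finite (S l) \<and> card (S l) = c l" if "l \<in> {j..m * 2 ^ m}" for l
    proof -
      have "emeasure (count_space {1..}) (S l) = of_nat (c l)"
        unfolding S_def using c[of l] that j sets_borel_cell[of m l] by (subst em[symmetric]) auto
      moreover have "S l \<subseteq> {1..}" by (auto simp: S_def)
      ultimately show ?thesis
        by (cases "finite (S l)") (auto simp: emeasure_count_space ennreal_of_nat_eq_real_of_nat)
    qed
    define U where "U = {i. 1 \<le> i \<and> real j / 2 ^ m \<le> d i}"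
    have "U = {i. 1 \<le> i \<and> j \<le> cell m (d i)}"
      unfolding U_def using cell_ge_iff[of j m] j by simp
    also have "\<dots> = (\<Union>l\<in>{j..m * 2 ^ m}. S l)"
      by (auto simp: S_def)
    finally have U: "U = (\<Union>l\<in>{j..m * 2 ^ m}. S l)" .
    have "finite U" unfolding U using S by auto
    have "card U = (\<Sum>l=j..m * 2 ^ m. c l)"
    proof -
      have "card U = (\<Sum>l=j..m * 2 ^ m. card (S l))"
        unfolding U by (rule card_UN_disjoint) (use S in \<open>auto simp: S_def\<close>)
      then show ?thesis using S by simp
    qed
    moreover have "U = {1..card U}"
      by (rule initial_segment_eq[OF \<open>finite U\<close>]) (use p(3) in \<open>auto simp: U_def intro: order_trans\<close>)
    ultimately have "i \<in> U \<longleftrightarrow> i \<le> (\<Sum>l=j..m * 2 ^ m. c l)" using i by (metis atLeastAtMost_iff)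
    then show ?thesis using i by (simp add: U_def)
  qed
qed


section \<open>Convergence of the ordered degrees\<close>

lemma nth_ge_iff_of_sorted_wrt_ge:
  assumes "sorted_wrt (\<ge>) zs" "i < length zs"
  shows "t \<le> real (zs ! i) \<longleftrightarrow> i < length (filter (\<lambda>x. t \<le> real x) zs)"
  using assms
proof (induction zs arbitrary: i)
  case (Cons z zs)
  show ?case
  proof (cases "t \<le> real z")
    case True
    then show ?thesis using Cons by (cases i) auto
  next
    case False
    have le: "z' \<le> z" if "z' \<in> set (z # zs)" for z' using Cons.prems that by auto
    then have "filter (\<lambda>x. t \<le> real x) (z # zs) = []"
      using False by (auto simp: filter_empty_conv not_le) (meson le_less_trans of_nat_le_iff)
    moreover have "\<not> t \<le> real ((z # zs) ! i)"
      using le[of "(z # zs) ! i"] Cons.prems(2) nth_mem[of i "z # zs"] False by linarith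
    ultimately show ?thesis by simp
  qed
qed simp

text \<open>Ranks are turned into counts, which do not depend on the order of the letters. A
  positive \<open>t\<close> rules out the dummy value 0 beyond the number of vertices.\<close>

lemma ordered_degree_ge_iff:
  assumes "t > 0"
  shows "t \<le> real (ordered_degree \<tau> i) \<longleftrightarrow> i < length (filter (\<lambda>x. t \<le> real x) (outdegrees \<tau>))"
proof -
  define zs where "zs = rev (sort (outdegrees \<tau>))"
  have "sorted_wrt (\<ge>) zs" by (simp add: zs_def sorted_wrt_rev)
  have "mset (filter (\<lambda>x. t \<le> real x) zs) = mset (filter (\<lambda>x. t \<le> real x) (outdegrees \<tau>))"
    by (simp add: zs_def)
  then have len: "length (filter (\<lambda>x. t \<le> real x) zs) = length (filter (\<lambda>x. t \<le> real x) (outdegrees \<tau>))"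
    by (metis size_mset)
  have lz: "length zs = num_vertices \<tau>" by (simp add: zs_def num_vertices_def)
  show ?thesis
  proof (cases "i < num_vertices \<tau>")
    case True
    then have "ordered_degree \<tau> i = zs ! i" by (simp add: ordered_degree_def zs_def)
    then show ?thesis
      using nth_ge_iff_of_sorted_wrt_ge[OF \<open>sorted_wrt (\<ge>) zs\<close>, of i t] True len lz by simp
  next
    case False
    have "length (filter (\<lambda>x. t \<le> real x) (outdegrees \<tau>)) \<le> num_vertices \<tau>"
      by (simp add: num_vertices_def)
    then show ?thesis using False assms by (simp add: ordered_degree_def)
  qed
qed

context cauchy_scaling
begin

definition degree_cell :: "nat \<Rightarrow> nat \<Rightarrow> nat \<Rightarrow> nat" where
  "degree_cell m n k = cell m (real k / a n)"

lemma degree_cell_ge_iff: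
  assumes "a n > 0" "1 \<le> j" "j \<le> m * 2 ^ m"
  shows "j \<le> degree_cell m n k \<longleftrightarrow> real j / 2 ^ m * a n \<le> real k"
  using assms by (simp add: degree_cell_def cell_ge_iff field_simps)

lemma pmf_degree_cell:
  assumes "a n > 0" and j: "1 \<le> j" "j \<le> m * 2 ^ m"
  shows "pmf (map_pmf (degree_cell m n) \<mu>) j =
    tail (real j / 2 ^ m * a n) - (if j < m * 2 ^ m then tail (real (Suc j) / 2 ^ m * a n) else 0)"
proof -
  define G where "G i = {k. real i / 2 ^ m * a n \<le> real k}" for i
  have "pmf (map_pmf (degree_cell m n) \<mu>) j = measure_pmf.prob \<mu> {k. degree_cell m n k = j}"
    by (simp add: pmf_map vimage_def)
  also have "{k. degree_cell m n k = j} = G j - (if j < m * 2 ^ m then G (Suc j) else {})"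
  proof -
    have "degree_cell m n k = j \<longleftrightarrow> j \<le> degree_cell m n k \<and> (j < m * 2 ^ m \<longrightarrow> \<not> Suc j \<le> degree_cell m n k)" for k
    proof -
      have "c = j \<longleftrightarrow> j \<le> c \<and> (j < r \<longrightarrow> \<not> Suc j \<le> c)" if "c \<le> r" "j \<le> r" for c r
        using that by auto
      moreover have "degree_cell m n k \<le> m * 2 ^ m" unfolding degree_cell_def by (rule cell_le)
      ultimately show ?thesis using j by blast
    qed
    then show ?thesis
      using degree_cell_ge_iff[OF assms] degree_cell_ge_iff[OF assms(1), of "Suc j" m]
      by (auto simp: G_def simp del: of_nat_Suc)
  qed
  also have "measure_pmf.prob \<mu> \<dots> = measure_pmf.prob \<mu> (G j) - measure_pmf.prob \<mu> (if j < m * 2 ^ m then G (Suc j) else {})"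
  proof (rule measure_pmf.finite_measure_Diff)
    have "real j / 2 ^ m * a n \<le> real (Suc j) / 2 ^ m * a n"
      using assms by (intro mult_right_mono divide_right_mono) auto
    then show "(if j < m * 2 ^ m then G (Suc j) else {}) \<subseteq> G j"
      by (auto simp: G_def simp del: of_nat_Suc)
  qed auto
  finally show ?thesis by (simp add: G_def tail_def del: of_nat_Suc)
qed

lemma pmf_degree_cell_tendsto:
  assumes j: "1 \<le> j" "j \<le> m * 2 ^ m"
  shows "(\<lambda>n. real (n - 1) * pmf (map_pmf (degree_cell m n) \<mu>) j) \<longlonglongrightarrow> cell_rate m j"
proof -
  have t: "(\<lambda>n. real n * tail (real i / 2 ^ m * a n)) \<longlonglongrightarrow> 2 ^ m / i" if "i \<ge> 1" for i
    using tail_scaled[of "real i / 2 ^ m"] that by simp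
  have "(\<lambda>n. real (n - 1) / real n * (real n * tail (real j / 2 ^ m * a n) -
      (if j < m * 2 ^ m then real n * tail (real (Suc j) / 2 ^ m * a n) else 0)))
      \<longlonglongrightarrow> 1 * (2 ^ m / j - (if j < m * 2 ^ m then 2 ^ m / Suc j else 0))"
  proof (intro tendsto_mult tendsto_diff pred_ratio t)
    show "(\<lambda>n. if j < m * 2 ^ m then real n * tail (real (Suc j) / 2 ^ m * a n) else 0)
      \<longlonglongrightarrow> (if j < m * 2 ^ m then 2 ^ m / real (Suc j) else 0)"
      using t[of "Suc j"] by (cases "j < m * 2 ^ m") (auto simp del: of_nat_Suc)
  qed (use j in auto)
  then show ?thesis
  proof (rule tendsto_eventually_eq)
    show "\<forall>\<^sub>F n in sequentially. real (n - 1) / real n * (real n * tail (real j / 2 ^ m * a n) -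
      (if j < m * 2 ^ m then real n * tail (real (Suc j) / 2 ^ m * a n) else 0)) =
      real (n - 1) * pmf (map_pmf (degree_cell m n) \<mu>) j"
      using eventually_a_gt[of 0] eventually_gt_at_top[of 0]
    proof eventually_elim
      case (elim n)
      have "real (n - 1) / real n * (real n * x - (if Q then real n * y else 0)) = real (n - 1) * (x - (if Q then y else 0))"
        for x y Q using elim by (simp add: right_diff_distrib)
      then show ?case unfolding pmf_degree_cell[OF elim(1) j] .
    qed
  qed (simp add: cell_rate_def)
qed

lemma prob_degree_cells_tendsto:
  "(\<lambda>n. measure_pmf.prob (replicate_pmf (n - 1) \<mu>)
      {t. \<forall>j\<in>{1..m * 2 ^ m}. count (mset (map (degree_cell m n) t)) j = d j})
    \<longlonglongrightarrow> (\<Prod>j=1..m * 2 ^ m. exp (- cell_rate m j) * cell_rate m j ^ d j / fact (d j))"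
proof -
  have "(\<lambda>n. measure_pmf.prob (replicate_pmf (n - 1) (map_pmf (degree_cell m n) \<mu>))
      {xs. \<forall>j\<in>{1..m * 2 ^ m}. count (mset xs) j = d j})
    \<longlonglongrightarrow> (\<Prod>j=1..m * 2 ^ m. exp (- cell_rate m j) * cell_rate m j ^ d j / fact (d j))"
  proof (rule multinomial_tendsto_poisson)
    show "set_pmf (map_pmf (degree_cell m n) \<mu>) \<subseteq> {..m * 2 ^ m}" for n
      using cell_le by (auto simp: degree_cell_def simp del: cell_le)
    show "filterlim (\<lambda>n. n - 1) at_top sequentially"
      by (rule filterlim_minus_const_nat_at_top)
  qed (use pmf_degree_cell_tendsto in auto)
  then show ?thesis
    by (simp add: map_replicate_pmf[symmetric] vimage_def)
qed

text \<open>The correction by \<open>1\<close> accounts for the degree of order \<open>B n\<close>, which lies in the last cell.\<close>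

definition profile :: "nat \<Rightarrow> real \<Rightarrow> nat \<Rightarrow> (nat \<Rightarrow> nat) \<Rightarrow> nat list set" where
  "profile m \<delta> n d = {xs.
     (\<forall>l\<in>{1..m * 2 ^ m}. count (mset (map (degree_cell m n) xs)) l = d l + (if l = m * 2 ^ m then 1 else 0)) \<and>
     (\<exists>x\<in>set xs. (1 - \<delta>) * B n \<le> real x) \<and> (\<forall>x\<in>set xs. real x \<le> (1 + \<delta>) * B n)}"

lemma rotate_in_profile: "rotate k xs \<in> profile m \<delta> n d \<longleftrightarrow> xs \<in> profile m \<delta> n d"
  unfolding profile_def by (simp add: mset_rotate rotate_map[symmetric])

text \<open>The relation between ranks and counts is the one for the limit in
  \<open>decreasing_rearrangement_cells\<close>. Degrees are ranked from 0 and atoms from 1, and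
  this offset is compensated by the big letter, which occupies rank 0 and adds 1 to the count of the
  last cell.\<close>

lemma profile_ordered_degree:
  assumes \<tau>: "outdegrees \<tau> \<in> profile m \<delta> n d" and "a n > 0" "B n > 0" "0 < \<delta>" "\<delta> < 1"
  shows "\<bar>real (ordered_degree \<tau> 0) / B n - 1\<bar> \<le> \<delta>"
    and "\<And>i j. 1 \<le> i \<Longrightarrow> j \<in> {1..m * 2 ^ m} \<Longrightarrow>
      real j / 2 ^ m \<le> real (ordered_degree \<tau> i) / a n \<longleftrightarrow> i \<le> (\<Sum>l=j..m * 2 ^ m. d l)"
proof -
  let ?xs = "outdegrees \<tau>"
  have p: "(1 - \<delta>) * B n > 0" using assms by simp
  obtain x where x: "x \<in> set ?xs" "(1 - \<delta>) * B n \<le> real x" using \<tau> by (auto simp: profile_def)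
  then have "x \<in> set (filter (\<lambda>x. (1 - \<delta>) * B n \<le> real x) ?xs)" by auto
  then have "length (filter (\<lambda>x. (1 - \<delta>) * B n \<le> real x) ?xs) > 0" by (rule length_pos_if_in_set)
  then have lo: "(1 - \<delta>) * B n \<le> real (ordered_degree \<tau> 0)" using ordered_degree_ge_iff[OF p] by simp
  have hi: "real (ordered_degree \<tau> 0) \<le> (1 + \<delta>) * B n"
  proof (cases "ordered_degree \<tau> 0 = 0")
    case True
    then show ?thesis using assms by simp
  next
    case False
    then have "length (filter (\<lambda>x. real (ordered_degree \<tau> 0) \<le> real x) ?xs) > 0"
      using ordered_degree_ge_iff[of "real (ordered_degree \<tau> 0)" \<tau> 0] by simp
    then obtain y where "y \<in> set ?xs" "real (ordered_degree \<tau> 0) \<le> real y"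
      by (auto simp: filter_empty_conv)
    then show ?thesis using \<tau> by (force simp: profile_def)
  qed
  have "1 - \<delta> \<le> real (ordered_degree \<tau> 0) / B n" "real (ordered_degree \<tau> 0) / B n \<le> 1 + \<delta>"
    using lo hi assms by (simp_all add: pos_le_divide_eq pos_divide_le_eq)
  then show "\<bar>real (ordered_degree \<tau> 0) / B n - 1\<bar> \<le> \<delta>" by linarith
  fix i j :: nat assume i: "1 \<le> i" and j: "j \<in> {1..m * 2 ^ m}"
  have t: "real j / 2 ^ m * a n > 0" using j assms by simp
  have "real j / 2 ^ m \<le> real (ordered_degree \<tau> i) / a n \<longleftrightarrow> real j / 2 ^ m * a n \<le> real (ordered_degree \<tau> i)"
    using assms by (simp add: pos_le_divide_eq)
  also have "\<dots> \<longleftrightarrow> i < length (filter (\<lambda>x. real j / 2 ^ m * a n \<le> real x) ?xs)"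
    by (rule ordered_degree_ge_iff[OF t])
  also have "length (filter (\<lambda>x. real j / 2 ^ m * a n \<le> real x) ?xs) = length (filter (\<lambda>x. j \<le> degree_cell m n x) ?xs)"
    using degree_cell_ge_iff[OF assms(2), of j m] j by simp
  also have "\<dots> = (\<Sum>l=j..m * 2 ^ m. count (mset (map (degree_cell m n) ?xs)) l)"
    using j by (intro sum_count_cell_ge[symmetric]) (auto simp: degree_cell_def simp del: cell_le intro: cell_le)
  also have "\<dots> = (\<Sum>l=j..m * 2 ^ m. d l + (if l = m * 2 ^ m then 1 else 0))"
    using \<tau> j by (intro sum.cong) (auto simp: profile_def)
  also have "\<dots> = (\<Sum>l=j..m * 2 ^ m. d l) + 1"
    using j by (simp add: sum.distrib)
  finally show "real j / 2 ^ m \<le> real (ordered_degree \<tau> i) / a n \<longleftrightarrow> i \<le> (\<Sum>l=j..m * 2 ^ m. d l)"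
    by (simp add: less_Suc_eq_le)
qed

lemma profile_disjoint:
  assumes "xs \<in> profile m \<delta> n d" "xs \<in> profile m \<delta> n d'" "l \<in> {1..m * 2 ^ m}"
  shows "d l = d' l"
  using assms unfolding profile_def by fastforce

text \<open>Quotient of the lower bound for one big jump with prescribed counts of the other letters
  by the upper bound for the total probability; the common factor \<open>rate n\<close>
  cancels.\<close>

lemma eventually_conditioned_BGW_profile:
  assumes "m \<ge> 1" and \<delta>: "0 < \<delta>" "\<delta> < 1" and "\<eta> > 0"
  shows "\<forall>\<^sub>F n in sequentially. prob_space (conditioned_BGW \<mu> n) \<and>
    (\<Prod>j=1..m * 2 ^ m. exp (- cell_rate m j) * cell_rate m j ^ d j / fact (d j)) - \<eta> \<le>
    measure (conditioned_BGW \<mu> n) {\<tau>. outdegrees \<tau> \<in> profile m \<delta> n d}"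
proof -
  define \<pi> where "\<pi> = (\<Prod>j=1..m * 2 ^ m. exp (- cell_rate m j) * cell_rate m j ^ d j / fact (d j))"
  define T where "T n = {t. \<forall>j\<in>{1..m * 2 ^ m}. count (mset (map (degree_cell m n) t)) j = d j}" for n
  have T: "(\<lambda>n. measure_pmf.prob (replicate_pmf (n - 1) \<mu>) (T n)) \<longlonglongrightarrow> \<pi>"
    unfolding T_def \<pi>_def by (rule prob_degree_cells_tendsto)
  have \<pi>1: "\<pi> \<le> 1" by (rule LIMSEQ_le_const2[OF T]) auto
  define e where "e = min (1/2) (\<eta> / 4)"
  have e: "0 < e" "e < 1" "4 * e \<le> \<eta>" using \<open>\<eta> > 0\<close> by (auto simp: e_def)
  define r where "r = min \<delta> (e / 16)"
  have r: "0 < r" "r \<le> \<delta>" "r \<le> e / 16" "r \<le> 1/2" using e \<delta> by (auto simp: r_def)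
  have ab: "\<forall>\<^sub>F n in sequentially. 2 * real m \<le> B n / (a n + 1)"
    using B_ratio_at_top by (simp add: filterlim_at_top)
  have PT: "\<forall>\<^sub>F n in sequentially. \<pi> - e < measure_pmf.prob (replicate_pmf (n - 1) \<mu>) (T n)"
    using order_tendstoD(1)[OF T, of "\<pi> - e"] e by simp
  show ?thesis
    using prob_sum_le[OF e(1,2)] prob_big_jump_ge[OF e(1,2) r(1,3)] PT ab eventually_a_gt[of 0]
      eventually_B_gt[of 0] eventually_rate_pos eventually_ge_at_top[of 1]
  proof eventually_elim
    case (elim n)
    let ?P = "measure_pmf.prob (replicate_pmf n \<mu>)"
    define S where "S = ?P {xs. Suc (sum_list xs) = n}"
    define X where "X = ?P {xs. Suc (sum_list xs) = n \<and> xs \<in> profile m \<delta> n d}"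
    define E where "E U = {xs. Suc (sum_list xs) = n \<and> (\<exists>k x t. rotate k xs = x # t \<and>
      \<bar>real x - B n\<bar> \<le> r * B n \<and> (\<forall>y\<in>set t. real y < (1 - r) * B n) \<and> t \<in> U)}" for U
    have E: "(1 - e) * rate n * (measure_pmf.prob (replicate_pmf (n - 1) \<mu>) U - e) \<le> ?P (E U)" for U
      using elim(2) unfolding E_def by blast
    \<comment> \<open>The big jump bound with no restriction on the other letters shows that the
      conditioning event has positive probability, which makes the conditioned law a probability
      measure.\<close>
    have "0 < (1 - e) * rate n * (1 - e)" using e elim by simp
    also have "\<dots> \<le> ?P (E UNIV)" using E[of UNIV] by simp
    also have "\<dots> \<le> S" unfolding S_def by (rule measure_pmf.finite_measure_mono) (auto simp: E_def)
    finally have S: "S > 0" .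
    have rB: "(1 - \<delta>) * B n \<le> (1 - r) * B n" "(1 + r) * B n \<le> (1 + \<delta>) * B n"
      using r elim by (intro mult_right_mono; simp)+
    \<comment> \<open>As \<open>B n\<close> exceeds \<open>2 * m * (a n + 1)\<close>, a letter at
      least \<open>(1 - r) * B n\<close> lies beyond the cut-off height \<open>m\<close> on the
      scale \<open>a n\<close>, that is, in the last cell.\<close>
    have big: "real m * a n \<le> (1 - r) * B n"
    proof -
      have "2 * real m * (a n + 1) \<le> B n" using elim by (simp add: field_simps)
      moreover have "real m * a n \<le> real m * (a n + 1)" by (intro mult_left_mono) auto
      moreover have "1 / 2 * B n \<le> (1 - r) * B n" using r elim by (intro mult_right_mono) auto
      ultimately show ?thesis by linarith
    qed
    have sub: "E (T n) \<subseteq> {xs. Suc (sum_list xs) = n \<and> xs \<in> profile m \<delta> n d}"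
    proof
      fix xs assume "xs \<in> E (T n)"
      then obtain k x t where k: "Suc (sum_list xs) = n" "rotate k xs = x # t" "\<bar>real x - B n\<bar> \<le> r * B n"
          "\<forall>y\<in>set t. real y < (1 - r) * B n" "t \<in> T n"
        unfolding E_def by blast
      have ms: "mset xs = add_mset x (mset t)" using mset_rotate[of k xs] k(2) by simp
      have set: "set xs = insert x (set t)" using arg_cong[OF ms, of set_mset] by simp
      have x: "(1 - r) * B n \<le> real x" "real x \<le> (1 + r) * B n"
        using k(3) unfolding left_diff_distrib distrib_right by linarith+
      have "m * 2 ^ m \<le> degree_cell m n x"
        using big x \<open>m \<ge> 1\<close> elim by (subst degree_cell_ge_iff) auto
      moreover have "degree_cell m n x \<le> m * 2 ^ m" unfolding degree_cell_def by (rule cell_le)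
      ultimately have cx: "degree_cell m n x = m * 2 ^ m" by (rule order_antisym[rotated])
      have "count (mset (map (degree_cell m n) xs)) l = d l + (if l = m * 2 ^ m then 1 else 0)"
        if "l \<in> {1..m * 2 ^ m}" for l
        using k(5) that by (simp add: T_def ms cx)
      moreover have "real y \<le> (1 + \<delta>) * B n" if "y \<in> set xs" for y
      proof (cases "y = x")
        case True
        then show ?thesis using x rB by linarith
      next
        case False
        then have "real y < (1 - r) * B n" using that k(4) by (simp add: set)
        then show ?thesis using x rB by linarith
      qed
      ultimately have "xs \<in> profile m \<delta> n d"
        using x rB unfolding profile_def by (auto simp: set intro: order_trans)
      then show "xs \<in> {xs. Suc (sum_list xs) = n \<and> xs \<in> profile m \<delta> n d}" using k(1) by simp
    qed
    have XE: "?P (E (T n)) \<le> X" unfolding X_def by (intro measure_pmf.finite_measure_mono sub) auto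
    \<comment> \<open>One \<open>e\<close> is lost in the limit of the cell counts and one in the
      big jump bound, giving \<open>\<pi> - 2 * e\<close>; replacing the quotient of
      \<open>1 - e\<close> and \<open>1 + e\<close> by 1 costs at most \<open>2 * e\<close> more,
      since \<open>\<pi>\<close> is at most 1. If \<open>\<pi> - 2 * e\<close> is not positive, the
      inequality is trivial.\<close>
    have "S * (\<pi> - 4 * e) \<le> X"
    proof (cases "\<pi> - 2 * e \<le> 0")
      case True
      then have "S * (\<pi> - 4 * e) \<le> 0" using S e by (intro mult_nonneg_nonpos) auto
      also have "0 \<le> X" by (simp add: X_def)
      finally show ?thesis .
    next
      case False
      have "(1 + e) * (\<pi> - 4 * e) \<le> (1 - e) * (\<pi> - 2 * e)"
      proof -
        have "0 \<le> e * (2 - 2 * \<pi> + 6 * e)" using e \<pi>1 by (intro mult_nonneg_nonneg) auto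
        then show ?thesis by (simp add: algebra_simps)
      qed
      then have "S * ((1 + e) * (\<pi> - 4 * e)) \<le> S * ((1 - e) * (\<pi> - 2 * e))" using S by (intro mult_left_mono) auto
      also have "\<dots> \<le> ((1 + e) * rate n) * ((1 - e) * (\<pi> - 2 * e))"
        using elim(1) False e by (intro mult_right_mono) (auto simp: S_def)
      also have "\<dots> = (1 + e) * ((1 - e) * rate n * (\<pi> - 2 * e))" by simp
      also have "\<dots> \<le> (1 + e) * ((1 - e) * rate n * (measure_pmf.prob (replicate_pmf (n - 1) \<mu>) (T n) - e))"
        using elim e by (intro mult_left_mono) auto
      also have "\<dots> \<le> (1 + e) * X" using E[of "T n"] XE e by (intro mult_left_mono) auto
      finally have "(1 + e) * (S * (\<pi> - 4 * e)) \<le> (1 + e) * X" by (simp add: mult.left_commute)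
      then show ?thesis using e by simp
    qed
    moreover have "S * (\<pi> - \<eta>) \<le> S * (\<pi> - 4 * e)" using S e by (intro mult_left_mono) auto
    ultimately have "S * (\<pi> - \<eta>) \<le> X" by linarith
    then have "\<pi> - \<eta> \<le> X / S" using S by (simp add: pos_le_divide_eq mult.commute)
    moreover have "measure (conditioned_BGW \<mu> n) {\<tau>. outdegrees \<tau> \<in> profile m \<delta> n d} = X / S"
      unfolding X_def S_def
      by (rule conditioned_BGW_eq(1)) (use elim S rotate_in_profile in \<open>auto simp: S_def\<close>)
    moreover have "prob_space (conditioned_BGW \<mu> n)"
      by (rule conditioned_BGW_eq(2)[where A = UNIV]) (use elim S in \<open>auto simp: S_def\<close>)
    ultimately show ?case by (simp add: \<pi>_def)
  qed
qed

end

section \<open>From probabilities of count profiles to expectations of continuous functions\<close>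

lemma tendsto_funI:
  fixes x :: "'b \<Rightarrow> 'a \<Rightarrow> 'c :: topological_space"
  assumes "\<And>i. ((\<lambda>m. x m i) \<longlongrightarrow> y i) F"
  shows "(x \<longlongrightarrow> y) F"
proof -
  have "limitin (product_topology (\<lambda>i. euclidean) UNIV) x y F"
    unfolding limitin_componentwise
  proof (intro conjI ballI)
    show "\<forall>\<^sub>F m in F. x m \<in> topspace (product_topology (\<lambda>i. euclidean) UNIV)" by simp
    show "limitin euclidean (\<lambda>m. x m i) (y i) F" for i using assms by simp
  qed simp
  then show ?thesis unfolding euclidean_product_topology limitin_canonical_iff .
qed

lemma sum_indicator_unique:
  fixes v :: "'a \<Rightarrow> real"
  assumes "finite G" "d \<in> G" "x \<in> E d" and unique: "\<And>d'. d' \<in> G \<Longrightarrow> x \<in> E d' \<Longrightarrow> d' = d"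
  shows "(\<Sum>d\<in>G. v d * indicator (E d) x) = v d"
proof -
  have "(\<Sum>d\<in>G. v d * indicator (E d) x) = (\<Sum>d'\<in>{d}. v d' * indicator (E d') x)"
  proof (rule sum.mono_neutral_right)
    show "\<forall>d'\<in>G - {d}. v d' * indicator (E d') x = 0"
      using unique by (metis DiffD1 DiffD2 indicator_simps(2) insertI1 mult_zero_right)
  qed (use assms(1,2) in auto)
  then show ?thesis using assms(3) by simp
qed

context cauchy_scaling
begin

definition scaled_degrees :: "nat \<Rightarrow> plane_tree \<Rightarrow> nat \<Rightarrow> real" where
  "scaled_degrees n \<tau> i = (if i = 0 then real (ordered_degree \<tau> 0) / B n else real (ordered_degree \<tau> i) / a n)"

text \<open>Replacing \<open>h\<close> by its infimum over the boxes determined by the cell counts reduces this bound to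
  lower bounds for the probabilities of disjoint events. Applied to \<open>K + h\<close> and \<open>K - h\<close> it gives the
  convergence of the expectation of \<open>h\<close>.\<close>

lemma liminf_expectation_scaled_degrees:
  fixes P :: "'p measure" and N :: "'p \<Rightarrow> (real \<times> real) measure" and \<Delta> :: "nat \<Rightarrow> 'p \<Rightarrow> real"
    and h :: "(nat \<Rightarrow> real) \<Rightarrow> real"
  assumes N: "poisson_random_measure P limit_intensity N"
    and \<Delta> [measurable]: "\<And>i. i \<ge> 1 \<Longrightarrow> \<Delta> i \<in> borel_measurable P"
    and dr: "AE \<omega> in P. decreasing_rearrangement (N \<omega>) (\<lambda>i. \<Delta> i \<omega>)"
    and cont: "continuous_on UNIV h" and h0: "\<And>x. 0 \<le> h x" and hK: "\<And>x. h x \<le> K"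
    and dep: "\<And>x y. (\<And>i. i \<in> J \<Longrightarrow> x i = y i) \<Longrightarrow> h x = h y"
    and "e > 0"
  shows "\<forall>\<^sub>F n in sequentially. (\<integral>\<omega>. h (\<lambda>i. if i = 0 then 1 else \<Delta> i \<omega>) \<partial>P) - e \<le>
    (\<integral>\<tau>. h (scaled_degrees n \<tau>) \<partial>conditioned_BGW \<mu> n)"
proof -
  interpret P: prob_space P using N by (rule poisson_random_measure_prob_space)
  define Y where "Y \<omega> i = (if i = 0 then 1 else \<Delta> i \<omega>)" for \<omega> and i :: nat
  define R :: "nat \<Rightarrow> nat" where "R m = m * 2 ^ m" for m
  \<comment> \<open>Tolerance for the coordinate 0: it lies strictly between 0 and 1, as the
    profiles require, and tends to 0.\<close>
  define dl where "dl m = 1 / (real m + 2)" for m :: nat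
  have dl: "0 < dl m" "dl m < 1" for m by (auto simp: dl_def)
  \<comment> \<open>All sequences whose coordinates in \<open>J\<close> are compatible with the
    counts \<open>d\<close>. The condition is shared by the rescaled degrees, through
    \<open>profile_ordered_degree\<close>, and by the limit, through
    \<open>decreasing_rearrangement_cells\<close>.\<close>
  define box where "box m d = {x :: nat \<Rightarrow> real. (0 \<in> J \<longrightarrow> \<bar>x 0 - 1\<bar> \<le> dl m) \<and>
    (\<forall>i\<in>J - {0}. \<forall>j\<in>{1..R m}. real j / 2 ^ m \<le> x i \<longleftrightarrow> i \<le> (\<Sum>l=j..R m. d l))}" for m d
  \<comment> \<open>For some \<open>d\<close> the box is empty; the value 0 keeps
    \<open>\<phi>\<close> between 0 and \<open>K\<close> there.\<close>
  define \<phi> where "\<phi> m d = (if box m d = {} then 0 else Inf (h ` box m d))" for m d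
  have K0: "K \<ge> 0" using h0[of undefined] hK[of undefined] by linarith
  have bdd: "bdd_below (h ` A)" for A using h0 by (intro bdd_belowI[of _ 0]) auto
  have \<phi>_le: "\<phi> m d \<le> h x" if "x \<in> box m d" for m d x
  proof -
    have "\<phi> m d = Inf (h ` box m d)" using that unfolding \<phi>_def by (metis empty_iff)
    also have "\<dots> \<le> h x" by (rule cInf_lower[OF imageI[OF that] bdd])
    finally show ?thesis .
  qed
  have \<phi>_0: "0 \<le> \<phi> m d" for m d
  proof (cases "box m d = {}")
    case False
    have "0 \<le> Inf (h ` box m d)" by (rule cInf_greatest) (use False h0 in auto)
    then show ?thesis using False by (simp add: \<phi>_def)
  qed (simp add: \<phi>_def)
  have \<phi>_K: "\<phi> m d \<le> K" for m d
  proof (cases "box m d = {}")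
    case False
    then show ?thesis using \<phi>_le hK order_trans by blast
  qed (simp add: \<phi>_def K0)
  have \<phi>_approx: "\<exists>x\<in>box m d. h x < \<phi> m d + r" if "box m d \<noteq> {}" "r > 0" for m d r
  proof -
    have "Inf (h ` box m d) < \<phi> m d + r" using that by (simp add: \<phi>_def)
    with that have "\<exists>v\<in>h ` box m d. v < \<phi> m d + r"
      by (intro cInf_lessD) simp_all
    then show ?thesis by simp
  qed
  define A where "A m j = {z :: real \<times> real. cell m (snd z) = j}" for m j
  define Ev where "Ev m d = {\<omega>\<in>space P. \<forall>j\<in>{1..R m}. emeasure (N \<omega>) (A m j) = of_nat (d j)}" for m d
  have A_sets: "A m j \<in> sets limit_intensity" for m j
    unfolding A_def sets_limit_intensity by (rule sets_borel_cell)
  have [measurable]: "(\<lambda>\<omega>. emeasure (N \<omega>) (A m j)) \<in> borel_measurable P" for m j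
    by (rule poisson_random_measure_measurable[OF N A_sets])
  have Ev_sets [measurable]: "Ev m d \<in> sets P" for m d
    unfolding Ev_def by measurable
  \<comment> \<open>Bounding the counts by \<open>k\<close> leaves finitely many disjoint events, so
    that finitely many eventual bounds can be combined. The limit in \<open>k\<close> is taken
    before the limit in \<open>m\<close>.\<close>
  define G where "G m k = PiE {1..R m} (\<lambda>_. {..k :: nat})" for m k
  have finG: "finite (G m k)" for m k by (auto simp: G_def intro!: finite_PiE)
  have G_eq: "d = d'" if "d \<in> G m k" "d' \<in> G m k" "\<And>l. l \<in> {1..R m} \<Longrightarrow> d l = d' l" for m k d d'
    by (rule PiE_ext[OF that(1,2)[unfolded G_def] that(3)])
  have Ev_unique: "d = d'" if "d \<in> G m k" "d' \<in> G m k" "\<omega> \<in> Ev m d" "\<omega> \<in> Ev m d'" for m k d d' \<omega>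
  proof (rule G_eq[OF that(1,2)])
    fix l assume "l \<in> {1..R m}"
    then have "(of_nat (d l) :: ennreal) = of_nat (d' l)" using that by (auto simp: Ev_def)
    then show "d l = d' l" by simp
  qed
  define \<pi> where "\<pi> m d = (\<Prod>j=1..R m. exp (- cell_rate m j) * cell_rate m j ^ d j / fact (d j))" for m d
  have Ev_prob: "measure P (Ev m d) = \<pi> m d" for m d
    unfolding Ev_def A_def \<pi>_def R_def by (rule poisson_random_measure_cells[OF N])
  define g where "g m k \<omega> = (\<Sum>d\<in>G m k. \<phi> m d * indicator (Ev m d) \<omega>)" for m k \<omega>
  have g_meas [measurable]: "g m k \<in> borel_measurable P" for m k
    unfolding g_def by measurable
  have g_cases: "g m k \<omega> = 0 \<or> (\<exists>d. g m k \<omega> = \<phi> m d)" for m k \<omega>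
  proof (cases "\<exists>d\<in>G m k. \<omega> \<in> Ev m d")
    case True
    then obtain d where d: "d \<in> G m k" "\<omega> \<in> Ev m d" by auto
    have "g m k \<omega> = \<phi> m d"
      unfolding g_def
      by (rule sum_indicator_unique[where E = "Ev m", OF finG d]) (rule Ev_unique[OF _ d(1) _ d(2)])
    then show ?thesis by blast
  next
    case False
    then have "g m k \<omega> = 0" unfolding g_def by (intro sum.neutral) auto
    then show ?thesis by blast
  qed
  have g_bd: "0 \<le> g m k \<omega>" "g m k \<omega> \<le> K" for m k \<omega>
    using g_cases[of m k \<omega>] \<phi>_0 \<phi>_K K0 by auto
  have g_int: "(\<integral>\<omega>. g m k \<omega> \<partial>P) = (\<Sum>d\<in>G m k. \<phi> m d * \<pi> m d)" for m k
  proof -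
    have "(\<integral>\<omega>. g m k \<omega> \<partial>P) = (\<Sum>d\<in>G m k. \<integral>\<omega>. \<phi> m d * indicator (Ev m d) \<omega> \<partial>P)"
      unfolding g_def
    proof (rule Bochner_Integration.integral_sum)
      show "integrable P (\<lambda>\<omega>. \<phi> m d * indicator (Ev m d) \<omega>)" for d
        by (rule P.integrable_const_bound[of _ K]) (use \<phi>_0 \<phi>_K K0 in \<open>auto simp: indicator_def\<close>)
    qed
    also have "\<dots> = (\<Sum>d\<in>G m k. \<phi> m d * \<pi> m d)"
      by (intro sum.cong) (auto simp: Ev_prob[symmetric])
    finally show ?thesis .
  qed
  \<comment> \<open>Almost surely \<open>g m k\<close> is constant in \<open>k\<close> once
    \<open>k\<close> exceeds the counts, with the infimum of \<open>h\<close> over the actual box as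
    its value. Defining \<open>gl\<close> by \<open>lim\<close> makes it measurable on the whole
    space.\<close>
  define gl where "gl m \<omega> = lim (\<lambda>k. g m k \<omega>)" for m \<omega>
  have gl_meas [measurable]: "gl m \<in> borel_measurable P" for m
    unfolding gl_def by measurable
  have "AE \<omega> in P. \<forall>m. \<forall>j\<in>{1..R m}. \<exists>c. emeasure (N \<omega>) (A m j) = of_nat c"
  proof -
    have "AE \<omega> in P. \<exists>c. emeasure (N \<omega>) (A m j) = of_nat c" if "j \<in> {1..R m}" for m j
    proof (rule poisson_random_measure_AE_finite[OF N A_sets])
      show "emeasure limit_intensity (A m j) < \<infinity>"
        unfolding A_def using that by (subst emeasure_limit_intensity_cell) (auto simp: R_def)
    qed
    then show ?thesis by (auto simp: AE_all_countable AE_ball_countable)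
  qed
  moreover have "AE \<omega> in P. emeasure (N \<omega>) {z. snd z \<le> 0} = 0"
    by (rule poisson_random_measure_AE_zero[OF N])
       (use sets_borel_strip[of "{..0}"] limit_intensity_nonpos in simp_all)
  moreover note dr
  moreover have "AE \<omega> in P. \<omega> \<in> space P" by simp
  ultimately have good: "AE \<omega> in P. (\<forall>m. (\<lambda>k. g m k \<omega>) \<longlonglongrightarrow> gl m \<omega>) \<and> (\<lambda>m. gl m \<omega>) \<longlonglongrightarrow> h (Y \<omega>)"
  proof eventually_elim
    case (elim \<omega>)
    have "\<exists>c. \<forall>m. \<forall>j\<in>{1..R m}. emeasure (N \<omega>) (A m j) = of_nat (c m j)"
      using elim(1) by metis
    then obtain c where c: "\<And>m j. j \<in> {1..R m} \<Longrightarrow> emeasure (N \<omega>) (A m j) = of_nat (c m j)" by blast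
    define dm where "dm m = restrict (c m) {1..R m}" for m
    have Ev: "\<omega> \<in> Ev m (dm m)" for m using c elim(4) by (auto simp: Ev_def dm_def)
    have g_ev: "\<forall>\<^sub>F k in sequentially. g m k \<omega> = \<phi> m (dm m)" for m
      using eventually_ge_at_top[of "\<Sum>j\<in>{1..R m}. c m j"]
    proof eventually_elim
      case (elim k)
      have "c m j \<le> k" if "j \<in> {1..R m}" for j
        using member_le_sum[of j "{1..R m}" "c m"] that elim by auto
      then have dm: "dm m \<in> G m k" by (auto simp: G_def dm_def)
      show ?case
        unfolding g_def
        by (rule sum_indicator_unique[where E = "Ev m", OF finG dm Ev]) (rule Ev_unique[OF _ dm _ Ev])
    qed
    have g_lim: "(\<lambda>k. g m k \<omega>) \<longlonglongrightarrow> \<phi> m (dm m)" for m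
      using g_ev by (rule tendsto_eventually)
    then have gl: "gl m \<omega> = \<phi> m (dm m)" for m unfolding gl_def by (rule limI)
    have cells: "\<And>i. 1 \<le> i \<Longrightarrow> \<Delta> i \<omega> > 0"
      "\<And>i j m. 1 \<le> i \<Longrightarrow> j \<in> {1..R m} \<Longrightarrow> real j / 2 ^ m \<le> \<Delta> i \<omega> \<longleftrightarrow> i \<le> (\<Sum>l=j..R m. dm m l)"
    proof -
      have cm: "emeasure (N \<omega>) {z. cell m (snd z) = l} = of_nat (dm m l)" if "l \<in> {1..m * 2 ^ m}" for m l
        using c[of l m] that by (simp add: A_def dm_def R_def)
      note * = decreasing_rearrangement_cells[OF elim(3,2) cm]
      show "\<Delta> i \<omega> > 0" if "1 \<le> i" for i by (rule *(1)[OF _ that])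
      show "real j / 2 ^ m \<le> \<Delta> i \<omega> \<longleftrightarrow> i \<le> (\<Sum>l=j..R m. dm m l)" if "1 \<le> i" "j \<in> {1..R m}" for i j m
        using *(2)[of m i j] that by (simp add: R_def)
    qed
    have Ybox: "Y \<omega> \<in> box m (dm m)" for m
      using cells(2) dl(1)[of m] by (auto simp: box_def Y_def)
    have "\<exists>x. x \<in> box m (dm m) \<and> h x < \<phi> m (dm m) + dl m" for m
      using \<phi>_approx[of m "dm m" "dl m"] Ybox[of m] dl(1)[of m] by blast
    then obtain x where x: "\<And>m. x m \<in> box m (dm m)" "\<And>m. h (x m) < \<phi> m (dm m) + dl m" by metis
    \<comment> \<open>The box restricts only the coordinates in \<open>J\<close>, and the
      near-minimiser may be arbitrary elsewhere. Taking the limit point itself off \<open>J\<close>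
      gives convergence in the product topology without changing \<open>h\<close>.\<close>
    define x' where "x' m i = (if i \<in> J then x m i else Y \<omega> i)" for m i
    have hx: "h (x' m) = h (x m)" for m by (rule dep) (simp add: x'_def)
    have dl_lim: "dl \<longlonglongrightarrow> 0"
      unfolding dl_def by (intro real_tendsto_divide_at_top[OF tendsto_const]
          filterlim_tendsto_add_at_top[OF tendsto_const filterlim_real_sequentially, of 2, unfolded add.commute[of 2]])
    have half_lim: "(\<lambda>m. 1 / 2 ^ m :: real) \<longlonglongrightarrow> 0"
      using LIMSEQ_realpow_zero[of "1/2 :: real"] by (simp add: power_one_over)
    have "x' \<longlonglongrightarrow> Y \<omega>"
    proof (rule tendsto_funI)
      fix i
      show "(\<lambda>m. x' m i) \<longlonglongrightarrow> Y \<omega> i"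
      proof (cases "i \<in> J")
        case False
        then show ?thesis by (simp add: x'_def)
      next
        case iJ: True
        show ?thesis
        proof (cases "i = 0")
          case True
          have "\<bar>x' m i - Y \<omega> i\<bar> \<le> dl m" for m using x(1)[of m] True iJ by (simp add: x'_def box_def Y_def)
          then show ?thesis
            by (intro Lim_transform_bound[of "\<lambda>m. x' m i - Y \<omega> i" dl, THEN LIM_zero_cancel] always_eventually dl_lim)
               (simp add: abs_of_pos[OF dl(1)])
        next
          case False
          \<comment> \<open>Once \<open>1 / 2 ^ m < y < m\<close>, the value \<open>y\<close> lies
            in a bounded cell of positive index, and the box confines both \<open>x m i\<close> and
            \<open>y\<close> to this interval of length \<open>1 / 2 ^ m\<close>.\<close>
          define y where "y = \<Delta> i \<omega>"
          have y: "y > 0" using cells(1)[of i] False by (simp add: y_def)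
          have "\<forall>\<^sub>F m in sequentially. 1 / 2 ^ m < y"
            by (rule order_tendstoD(2)[OF half_lim y])
          moreover have "\<forall>\<^sub>F m in sequentially. real m > y"
            using filterlim_real_sequentially by (simp add: filterlim_at_top_dense)
          ultimately have "\<forall>\<^sub>F m in sequentially. \<bar>x' m i - Y \<omega> i\<bar> \<le> 1 / 2 ^ m"
          proof eventually_elim
            case (elim m)
            define j where "j = nat \<lfloor>y * 2 ^ m\<rfloor>"
            have y2: "y * 2 ^ m > 1" using elim by (simp add: field_simps)
            have rj: "real j \<le> y * 2 ^ m" "y * 2 ^ m < real (Suc j)"
              using y2 unfolding j_def by linarith+
            have j1: "1 \<le> j" using y2 unfolding j_def by linarith
            have "y * 2 ^ m < real (R m)" using elim by (simp add: R_def)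
            then have "real j < real (R m)" using rj by linarith
            then have jR: "Suc j \<le> R m" by simp
            have "real j / 2 ^ m \<le> y" "\<not> real (Suc j) / 2 ^ m \<le> y"
              using rj by (simp_all only: pos_divide_le_eq zero_less_power zero_less_numeral not_le)
            then have "i \<le> (\<Sum>l=j..R m. dm m l)" "\<not> i \<le> (\<Sum>l=Suc j..R m. dm m l)"
              using cells(2)[of i j m] cells(2)[of i "Suc j" m] False j1 jR unfolding y_def by auto
            then have "real j / 2 ^ m \<le> x m i" "\<not> real (Suc j) / 2 ^ m \<le> x m i"
            proof -
              have "real l / 2 ^ m \<le> x m i \<longleftrightarrow> i \<le> (\<Sum>l=l..R m. dm m l)" if "l \<in> {1..R m}" for l
                using x(1)[of m] iJ False that unfolding box_def by blast
              from this[of j] this[of "Suc j"] show "real j / 2 ^ m \<le> x m i" "\<not> real (Suc j) / 2 ^ m \<le> x m i"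
                using \<open>i \<le> (\<Sum>l=j..R m. dm m l)\<close> \<open>\<not> i \<le> (\<Sum>l=Suc j..R m. dm m l)\<close> j1 jR
                by (simp_all del: of_nat_Suc)
            qed
            then have "real j / 2 ^ m \<le> x m i" "x m i < real j / 2 ^ m + 1 / 2 ^ m"
              "real j / 2 ^ m \<le> y" "y < real j / 2 ^ m + 1 / 2 ^ m"
              using \<open>real j / 2 ^ m \<le> y\<close> \<open>\<not> real (Suc j) / 2 ^ m \<le> y\<close> by (simp_all add: add_divide_distrib)
            then show ?case using iJ False by (simp add: x'_def Y_def y_def)
          qed
          then show ?thesis
            by (intro Lim_transform_bound[of "\<lambda>m. x' m i - Y \<omega> i" "\<lambda>m. 1 / 2 ^ m :: real", THEN LIM_zero_cancel] half_lim) auto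
        qed
      qed
    qed
    then have "(\<lambda>m. h (x' m)) \<longlonglongrightarrow> h (Y \<omega>)"
      using cont by (intro continuous_on_tendsto_compose[OF cont]) auto
    then have "(\<lambda>m. h (x' m) - dl m) \<longlonglongrightarrow> h (Y \<omega>) - 0"
      by (intro tendsto_diff dl_lim)
    then have lower: "(\<lambda>m. h (x' m) - dl m) \<longlonglongrightarrow> h (Y \<omega>)" by simp
    have "(\<lambda>m. gl m \<omega>) \<longlonglongrightarrow> h (Y \<omega>)"
    proof (rule tendsto_sandwich[OF _ _ lower tendsto_const])
      show "\<forall>\<^sub>F m in sequentially. h (x' m) - dl m \<le> gl m \<omega>"
        using x(2) by (intro always_eventually allI) (simp add: hx gl diff_le_eq less_imp_le)
      show "\<forall>\<^sub>F m in sequentially. gl m \<omega> \<le> h (Y \<omega>)"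
        using \<phi>_le[OF Ybox] by (simp add: gl)
    qed
    then show ?case using g_lim gl by simp
  qed
  have "Y \<in> borel_measurable P"
  proof (rule measurable_coordinatewise_then_product)
    fix i show "(\<lambda>\<omega>. Y \<omega> i) \<in> borel_measurable P" using \<Delta> by (cases "i = 0") (auto simp: Y_def)
  qed
  then have hY [measurable]: "(\<lambda>\<omega>. h (Y \<omega>)) \<in> borel_measurable P"
    using borel_measurable_continuous_onI[OF cont] by (rule measurable_compose)
  have gl_bd: "AE \<omega> in P. norm (gl m \<omega>) \<le> K" for m
    using good
  proof eventually_elim
    case (elim \<omega>)
    then have l: "(\<lambda>k. g m k \<omega>) \<longlonglongrightarrow> gl m \<omega>" by blast
    have "0 \<le> gl m \<omega>" "gl m \<omega> \<le> K"
      by (rule LIMSEQ_le_const[OF l], use g_bd in auto) (rule LIMSEQ_le_const2[OF l], use g_bd in auto)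
    then show ?case by simp
  qed
  have "(\<lambda>m. \<integral>\<omega>. gl m \<omega> \<partial>P) \<longlonglongrightarrow> (\<integral>\<omega>. h (Y \<omega>) \<partial>P)"
    by (rule integral_dominated_convergence[where w = "\<lambda>_. K"])
       (use good gl_bd in \<open>auto elim: eventually_mono\<close>)
  then have "\<forall>\<^sub>F m in sequentially. (\<integral>\<omega>. h (Y \<omega>) \<partial>P) - e / 3 < (\<integral>\<omega>. gl m \<omega> \<partial>P)"
    using \<open>e > 0\<close> by (intro order_tendstoD) auto
  then obtain m where m: "m \<ge> 1" "(\<integral>\<omega>. h (Y \<omega>) \<partial>P) - e / 3 < (\<integral>\<omega>. gl m \<omega> \<partial>P)"
    unfolding eventually_sequentially by (metis max.cobounded1 max.cobounded2)
  have "(\<lambda>k. \<integral>\<omega>. g m k \<omega> \<partial>P) \<longlonglongrightarrow> (\<integral>\<omega>. gl m \<omega> \<partial>P)"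
    by (rule integral_dominated_convergence[where w = "\<lambda>_. K"])
       (use good g_bd in \<open>auto elim: eventually_mono\<close>)
  then have "\<forall>\<^sub>F k in sequentially. (\<integral>\<omega>. gl m \<omega> \<partial>P) - e / 3 < (\<integral>\<omega>. g m k \<omega> \<partial>P)"
    using \<open>e > 0\<close> by (intro order_tendstoD) auto
  then obtain k where "(\<integral>\<omega>. gl m \<omega> \<partial>P) - e / 3 < (\<integral>\<omega>. g m k \<omega> \<partial>P)"
    unfolding eventually_sequentially by auto
  then have k: "(\<integral>\<omega>. h (Y \<omega>) \<partial>P) - 2 * e / 3 < (\<Sum>d\<in>G m k. \<phi> m d * \<pi> m d)"
    using m(2) by (simp add: g_int)
  \<comment> \<open>Each of the \<open>card (G m k)\<close> events has weight at most
    \<open>K\<close>, so the errors add up to at most \<open>e / 3\<close>; the summand 1 avoids a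
    zero denominator.\<close>
  define \<eta> where "\<eta> = e / (3 * (K * card (G m k) + 1))"
  have \<eta>: "\<eta> > 0" "\<eta> * (K * card (G m k)) \<le> e / 3"
  proof -
    have p: "K * card (G m k) \<ge> 0" using K0 by simp
    then show "\<eta> > 0" using \<open>e > 0\<close> by (simp add: \<eta>_def add_nonneg_pos)
    have "\<eta> * (K * card (G m k)) \<le> \<eta> * (K * card (G m k) + 1)" using \<open>\<eta> > 0\<close> by (intro mult_left_mono) auto
    also have "\<dots> = e / 3"
    proof -
      have "K * card (G m k) + 1 \<noteq> 0" using p by linarith
      moreover have "e / (3 * c) * c = e / 3" if "c \<noteq> 0" for c using that by simp
      ultimately show ?thesis unfolding \<eta>_def by blast
    qed
    finally show "\<eta> * (K * card (G m k)) \<le> e / 3" .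
  qed
  have "\<forall>\<^sub>F n in sequentially. \<forall>d\<in>G m k. prob_space (conditioned_BGW \<mu> n) \<and>
      \<pi> m d - \<eta> \<le> measure (conditioned_BGW \<mu> n) {\<tau>. outdegrees \<tau> \<in> profile m (dl m) n d}"
    unfolding \<pi>_def R_def
    by (rule eventually_ball_finite[OF finG])
       (use eventually_conditioned_BGW_profile[OF m(1) dl[of m] \<eta>(1)] in blast)
  moreover have "\<forall>\<^sub>F n in sequentially. prob_space (conditioned_BGW \<mu> n)"
    by (rule eventually_mono[OF eventually_conditioned_BGW_profile[OF m(1) dl[of m] \<eta>(1), of "\<lambda>_. 0"]]) simp
  ultimately show ?thesis
    using eventually_a_gt[of 0] eventually_B_gt[of 0]
  proof eventually_elim
    case (elim n)
    interpret C: prob_space "conditioned_BGW \<mu> n" by (rule elim)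
    have meas [measurable]: "f \<in> borel_measurable (conditioned_BGW \<mu> n)" for f :: "plane_tree \<Rightarrow> real"
      by (auto simp: measurable_def)
    define S where "S d = {\<tau>. outdegrees \<tau> \<in> profile m (dl m) n d}" for d
    have S_sets [measurable]: "S d \<in> sets (conditioned_BGW \<mu> n)" for d by simp
    have S_unique: "d = d'" if "d \<in> G m k" "d' \<in> G m k" "\<tau> \<in> S d" "\<tau> \<in> S d'" for d d' \<tau>
      using that profile_disjoint[of "outdegrees \<tau>" m "dl m" n d d'] by (intro G_eq[OF that(1,2)]) (auto simp: S_def R_def)
    have pw: "(\<Sum>d\<in>G m k. \<phi> m d * indicator (S d) \<tau>) \<le> h (scaled_degrees n \<tau>)" for \<tau>
    proof (cases "\<exists>d\<in>G m k. \<tau> \<in> S d")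
      case True
      then obtain d where d: "d \<in> G m k" "\<tau> \<in> S d" by auto
      have "(\<Sum>d\<in>G m k. \<phi> m d * indicator (S d) \<tau>) = \<phi> m d"
        by (rule sum_indicator_unique[where E = S, OF finG d]) (rule S_unique[OF _ d(1) _ d(2)])
      also have "\<dots> \<le> h (scaled_degrees n \<tau>)"
      proof (rule \<phi>_le)
        have \<tau>: "outdegrees \<tau> \<in> profile m (dl m) n d" using d by (simp add: S_def)
        show "scaled_degrees n \<tau> \<in> box m d"
          using profile_ordered_degree[OF \<tau> elim(3,4) dl] by (auto simp: box_def scaled_degrees_def R_def)
      qed
      finally show ?thesis .
    next
      case False
      then have "(\<Sum>d\<in>G m k. \<phi> m d * indicator (S d) \<tau>) = 0" by (intro sum.neutral) auto
      then show ?thesis using h0 by simp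
    qed
    have intS: "integrable (conditioned_BGW \<mu> n) (\<lambda>\<tau>. \<phi> m d * indicator (S d) \<tau>)" for d
      by (rule C.integrable_const_bound[of _ K]) (auto simp: \<phi>_0 \<phi>_K K0 indicator_def)
    have "(\<Sum>d\<in>G m k. \<phi> m d * \<pi> m d) - e / 3 \<le> (\<Sum>d\<in>G m k. \<phi> m d * (\<pi> m d - \<eta>))"
    proof -
      have "(\<Sum>d\<in>G m k. \<phi> m d * \<eta>) \<le> (\<Sum>d\<in>G m k. K * \<eta>)"
        using \<phi>_K \<eta> by (intro sum_mono mult_right_mono) auto
      also have "\<dots> \<le> e / 3" using \<eta>(2) by (simp add: mult_ac)
      finally show ?thesis by (simp add: right_diff_distrib sum_subtractf)
    qed
    also have "\<dots> \<le> (\<Sum>d\<in>G m k. \<phi> m d * measure (conditioned_BGW \<mu> n) (S d))"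
      using elim(1) \<phi>_0 by (intro sum_mono mult_left_mono) (auto simp: S_def)
    also have "\<dots> = (\<Sum>d\<in>G m k. \<integral>\<tau>. \<phi> m d * indicator (S d) \<tau> \<partial>conditioned_BGW \<mu> n)"
      by (intro sum.cong) auto
    also have "\<dots> = (\<integral>\<tau>. (\<Sum>d\<in>G m k. \<phi> m d * indicator (S d) \<tau>) \<partial>conditioned_BGW \<mu> n)"
      by (rule Bochner_Integration.integral_sum[symmetric]) (rule intS)
    also have "\<dots> \<le> (\<integral>\<tau>. h (scaled_degrees n \<tau>) \<partial>conditioned_BGW \<mu> n)"
    proof (rule integral_mono)
      show "integrable (conditioned_BGW \<mu> n) (\<lambda>\<tau>. h (scaled_degrees n \<tau>))"
        by (rule C.integrable_const_bound[of _ K]) (use h0 hK in auto)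
    qed (use intS pw in auto)
    finally show ?case using k \<open>e > 0\<close> unfolding Y_def by linarith
  qed
qed

end

theorem theorem3:
  fixes L :: "real \<Rightarrow> real"
    and \<mu> :: "nat pmf"
    and a b :: "nat \<Rightarrow> real"
    and P :: "'p measure"
    and N :: "'p \<Rightarrow> (real \<times> real) measure"
    and \<Delta> :: "nat \<Rightarrow> 'p \<Rightarrow> real"
  assumes "slowly_varying L"
    and "(\<lambda>i. real i * pmf \<mu> i) sums 1"
    and "(\<lambda>n. pmf \<mu> n) \<sim>[sequentially] (\<lambda>n. L (real n) / (real n)\<^sup>2)"
    and "(\<lambda>n. real n * measure_pmf.prob (step_law \<mu>) {x. a n \<le> real_of_int x}) \<longlonglongrightarrow> 1"
    and "\<And>n. n \<ge> 1 \<Longrightarrow>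
           b n = real n * measure_pmf.expectation (step_law \<mu>)
             (\<lambda>x. real_of_int x * indicator {x. \<bar>real_of_int x\<bar> \<le> a n} x)"
    and "poisson_random_measure P limit_intensity N"
    and "\<And>i. i \<ge> 1 \<Longrightarrow> \<Delta> i \<in> borel_measurable P"
    and "AE \<omega> in P. decreasing_rearrangement (N \<omega>) (\<lambda>i. \<Delta> i \<omega>)"
  shows "fdd_convergence
           (conditioned_BGW \<mu>)
           (\<lambda>n i \<tau>. if i = 0 then real (ordered_degree \<tau> 0) / \<bar>b n\<bar>
                    else real (ordered_degree \<tau> i) / a n)
           P
           (\<lambda>i \<omega>. if i = 0 then 1 else \<Delta> i \<omega>)"
proof -
  interpret critical_cauchy L \<mu> by unfold_locales (fact assms)+
  have "measure_pmf.prob (step_law \<mu>) {x. a n \<le> real_of_int x} = tail (a n + 1)" for n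
    by (simp add: step_law_def tail_def vimage_def algebra_simps)
  then interpret cauchy_scaling L \<mu> a by unfold_locales (use assms(4) in simp)
  \<comment> \<open>The step is at least -1, so for \<open>a n > 1\<close> the condition on its
    absolute value is the upper bound alone, and the truncated mean is
    \<open>- excess (a n + 1)\<close>.\<close>
  have b: "\<forall>\<^sub>F n in sequentially. \<bar>b n\<bar> = B n"
    using eventually_ge_at_top[of 1] eventually_a_gt[of 1] eventually_B_gt[of 0]
  proof eventually_elim
    case (elim n)
    have "measure_pmf.expectation (step_law \<mu>) (\<lambda>x. real_of_int x * indicator {x. \<bar>real_of_int x\<bar> \<le> a n} x) =
        measure_pmf.expectation \<mu> (\<lambda>k. (real k - 1) * indicator {k. real k \<le> a n + 1} k)"
      unfolding step_law_def integral_map_pmf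
      using elim by (intro Bochner_Integration.integral_cong) (auto simp: indicator_def)
    then have "b n = - B n" using assms(5)[OF elim(1)] by (simp add: excess_eq B_def)
    then show ?case using elim by simp
  qed
  interpret P: prob_space P using assms(6) by (rule poisson_random_measure_prob_space)
  define Y where "Y \<omega> i = (if i = 0 then 1 else \<Delta> i \<omega>)" for \<omega> and i :: nat
  show ?thesis
    unfolding fdd_convergence_def
  proof (intro allI impI)
    fix J :: "nat set" and f :: "(nat \<Rightarrow> real) \<Rightarrow> real"
    assume f: "continuous_map (powertop_real J) euclideanreal f" "bounded (f ` (J \<rightarrow>\<^sub>E UNIV))"
    \<comment> \<open>Extends the test function from the coordinates in \<open>J\<close> to all
      sequences, so that continuity can be used on one fixed space; \<open>dep\<close> retains the
      dependence on \<open>J\<close> alone.\<close>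
    define h where "h x = f (restrict x J)" for x
    have "continuous_map (powertop_real UNIV) (powertop_real J) (\<lambda>x. restrict x J)"
      by (rule continuous_on_restrict) simp
    then have "continuous_map (powertop_real UNIV) euclideanreal (f \<circ> (\<lambda>x. restrict x J))"
      by (rule continuous_map_compose[OF _ f(1)])
    then have cont: "continuous_on UNIV h"
      unfolding euclidean_product_topology by (simp add: h_def comp_def)
    obtain K where K: "\<And>x. \<bar>h x\<bar> \<le> K"
    proof -
      obtain K where "\<forall>y\<in>f ` (J \<rightarrow>\<^sub>E UNIV). norm y \<le> K" using f(2) unfolding bounded_iff by auto
      then have "\<bar>h x\<bar> \<le> K" for x by (auto simp: h_def)
      then show ?thesis by (rule that)
    qed
    have dep: "h x = h y" if "\<And>i. i \<in> J \<Longrightarrow> x i = y i" for x y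
    proof -
      have "restrict x J = restrict y J" using that by (intro ext) (simp add: restrict_def)
      then show ?thesis by (simp add: h_def)
    qed
    have "Y \<in> borel_measurable P"
    proof (rule measurable_coordinatewise_then_product)
      fix i show "(\<lambda>\<omega>. Y \<omega> i) \<in> borel_measurable P" using assms(7) by (cases "i = 0") (auto simp: Y_def)
    qed
    then have "(\<lambda>\<omega>. h (Y \<omega>)) \<in> borel_measurable P"
      using borel_measurable_continuous_onI[OF cont] by (rule measurable_compose)
    then have hY: "integrable P (\<lambda>\<omega>. h (Y \<omega>))"
      by (intro P.integrable_const_bound[of _ K]) (use K in auto)
    have "(\<lambda>n. \<integral>\<tau>. h (scaled_degrees n \<tau>) \<partial>conditioned_BGW \<mu> n) \<longlonglongrightarrow> (\<integral>\<omega>. h (Y \<omega>) \<partial>P)"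
    proof (rule tendstoI)
      fix e :: real assume "e > 0"
      then have e2: "e / 2 > 0" by simp
      have "\<forall>\<^sub>F n in sequentially. (\<integral>\<omega>. K + h (Y \<omega>) \<partial>P) - e / 2 \<le> (\<integral>\<tau>. K + h (scaled_degrees n \<tau>) \<partial>conditioned_BGW \<mu> n)"
        unfolding Y_def
      proof (rule liminf_expectation_scaled_degrees[where J = J and K = "2 * K", OF assms(6,7,8) _ _ _ _ e2])
        show "continuous_on UNIV (\<lambda>x. K + h x)" by (intro continuous_intros cont)
        show "0 \<le> K + h x" "K + h x \<le> 2 * K" for x using K[of x] by auto
        show "K + h x = K + h y" if "\<And>i. i \<in> J \<Longrightarrow> x i = y i" for x y using dep[OF that] by simp
      qed
      moreover have "\<forall>\<^sub>F n in sequentially. (\<integral>\<omega>. K - h (Y \<omega>) \<partial>P) - e / 2 \<le> (\<integral>\<tau>. K - h (scaled_degrees n \<tau>) \<partial>conditioned_BGW \<mu> n)"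
        unfolding Y_def
      proof (rule liminf_expectation_scaled_degrees[where J = J and K = "2 * K", OF assms(6,7,8) _ _ _ _ e2])
        show "continuous_on UNIV (\<lambda>x. K - h x)" by (intro continuous_intros cont)
        show "0 \<le> K - h x" "K - h x \<le> 2 * K" for x using K[of x] by auto
        show "K - h x = K - h y" if "\<And>i. i \<in> J \<Longrightarrow> x i = y i" for x y using dep[OF that] by simp
      qed
      moreover have "\<forall>\<^sub>F n in sequentially. prob_space (conditioned_BGW \<mu> n)"
        by (rule eventually_mono[OF eventually_conditioned_BGW_profile[of 1 "1/2" 1]]) auto
      ultimately show "\<forall>\<^sub>F n in sequentially.
          dist (\<integral>\<tau>. h (scaled_degrees n \<tau>) \<partial>conditioned_BGW \<mu> n) (\<integral>\<omega>. h (Y \<omega>) \<partial>P) < e"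
      proof eventually_elim
        case (elim n)
        interpret C: prob_space "conditioned_BGW \<mu> n" by (rule elim)
        have int: "integrable (conditioned_BGW \<mu> n) (\<lambda>\<tau>. h (scaled_degrees n \<tau>))"
          by (rule C.integrable_const_bound[of _ K]) (use K in \<open>auto simp: measurable_def\<close>)
        have "measure (conditioned_BGW \<mu> n) UNIV = 1" using C.prob_space by simp
        then show ?case
          using elim(1,2) hY int \<open>e > 0\<close> by (simp add: P.prob_space dist_real_def abs_less_iff)
      qed
    qed
    moreover have "\<forall>\<^sub>F n in sequentially. (\<integral>\<tau>. h (scaled_degrees n \<tau>) \<partial>conditioned_BGW \<mu> n) =
      (\<integral>\<tau>. f (\<lambda>i\<in>J. if i = 0 then real (ordered_degree \<tau> 0) / \<bar>b n\<bar> else real (ordered_degree \<tau> i) / a n) \<partial>conditioned_BGW \<mu> n)"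
      using b
    proof eventually_elim
      case (elim n)
      then show ?case unfolding h_def scaled_degrees_def by (simp cong: restrict_cong if_cong)
    qed
    ultimately show "(\<lambda>n. \<integral>\<tau>. f (\<lambda>i\<in>J. if i = 0 then real (ordered_degree \<tau> 0) / \<bar>b n\<bar> else real (ordered_degree \<tau> i) / a n) \<partial>conditioned_BGW \<mu> n)
      \<longlonglongrightarrow> (\<integral>\<omega>. f (\<lambda>i\<in>J. if i = 0 then 1 else \<Delta> i \<omega>) \<partial>P)"
      unfolding h_def Y_def by (rule Lim_transform_eventually)
  qed
qed

end
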